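(* Let $\nu$ be the distribution of a positive random variable $\zeta$ with $\mathbb E[\zeta]<+\infty$, let $\alpha,\beta,\lambda_\infty>0$, $x>0$, $0<T<+\infty$, and for each integer $N\ge 1$ put $h=h_N=T/N$. Let $(U^N_k)_{k}$ be a sequence of independent uniform random variables on $[0,1]$ and $(\zeta^N_k)_{k}$ an i.i.d. sequence with distribution $\nu$, independent of $(U^N_k)_k$. 1. (Exponential kernel $\phi(u)=\alpha e^{-\beta u}$.) Assume $\alpha\,\mathbb E[\zeta]<\beta$. Let $l^N_0=x$ and, for $k\ge 0$, $$l^N_{k+1}=\lambda_\infty(1-e^{-\beta h})+\big(l^N_k+\alpha\,\zeta^N_{k+1}\mathbf 1_{\{U^N_{k+1}<l^N_k h\}}\big)e^{-\beta h},$$ and set $\tilde\lambda^N_t=l^N_{\lfloor Nt/T\rfloor}$ for $t\ge 0$. Let $(\lambda_t)_{t\ge 0}$ be the (càdlàg) intensity, started from $\lambda_0=x$, of the compound Hawkes process with exponential kernel and mark distribution $\nu$. Then, as $N\to+\infty$, $$(\tilde\lambda^N_t)_{t\in[0,+\infty)}\Longrightarrow(\lambda_t)_{t\in[0,+\infty)}$$ weakly in the Skorokhod space $D_{\mathbb R_+}[0,+\infty)$. 2. (Erlang kernel $\phi(u)=\alpha u e^{-\beta u}$.) Assume $\alpha\,\mathbb E[\zeta]<\beta^2$. Let $l^N_0=x$, $a^N_0=0$ and, for $k\ge 0$, $$a^N_{k+1}=\big(a^N_k+\alpha\,\zeta^N_{k+1}\mathbf 1_{\{U^N_{k+1}<l^N_k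 h\}}\big)e^{-\beta h},\qquad l^N_{k+1}=\lambda_\infty(1-e^{-\beta h})+l^N_k e^{-\beta h}+a^N_{k+1}h,$$ and set $\tilde\lambda^N_t=l^N_{\lfloor Nt/T\rfloor}$, $\tilde\xi^N_t=a^N_{\lfloor Nt/T\rfloor}$ for $t\ge 0$. Let $(\lambda_t,\xi_t)_{t\ge 0}$ be the (càdlàg) pair formed by the intensity and the auxiliary process, started from $(\lambda_0,\xi_0)=(x,0)$, of the compound Hawkes process with Erlang kernel and mark distribution $\nu$. Then, as $N\to+\infty$, $$(\tilde\lambda^N_t,\tilde\xi^N_t)_{t\in[0,+\infty)}\Longrightarrow(\lambda_t,\xi_t)_{t\in[0,+\infty)}$$ weakly in the Skorokhod space $D_{\mathbb R_+^2}[0,+\infty)$.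
   Context: $\mathbb R_+=[0,+\infty)$. For $E=\mathbb R_+$ or $\mathbb R_+^2$, $D_E[0,+\infty)$ is the set of càdlàg functions $[0,+\infty)\to E$ with the Skorokhod topology. Compound Hawkes process: a point process with jump times $0<\theta_1<\theta_2<\cdots$, counting process $H_t=\sum_i\mathbf 1_{\theta_i\le t}$, i.i.d. marks $\zeta_i\sim\nu$ and loss process $L_t=\sum_{i=1}^{H_t}\zeta_i$, such that, given the past, jumps occur at rate $\lambda_{t-}$ and each new mark has law $\nu$ independently of the past (i.e. the jump measure of $L$ has predictable compensator $\lambda_{t-}\,dt\,\nu(dz)$). The intensity is taken in its càdlàg version. Exponential kernel: $\lambda_t=\lambda_\infty+(x-\lambda_\infty)e^{-\beta t}+\int_{[0,t]}\alpha e^{-\beta(t-s)}\,dL_s$; equivalently $d\lambda_t=\beta(\lambda_\infty-\lambda_t)\,dt+\alpha\,dL_t$, $\lambda_0=x$. Erlang kernel: $\lambda_t=\lambda_\infty+(x-\lambda_\infty)e^{-\beta t}+\int_{[0,t]}\alpha(t-s)e^{-\beta(t-s)}\,dL_s$ with auxiliary process $\xi_t=\int_{[0,t]}\alpha e^{-\beta(t-s)}\,dL_s$; equivalently $d\lambda_t=\beta(\lambda_\infty-\lambda_t)\,dt+\xi_t\,dt$, $d\xi_t=-\beta\xi_t\,dt+\alpha\,dL_t$, $\lambda_0=x$, $\xi_0=0$. *)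

theory Defs
  imports "HOL-Probability.Probability"
begin

section \<open>The Skorokhod space of cadlag paths\<close>

text \<open>Paths are indexed by \<open>[0,\<infinity>)\<close>; they are taken extensional, so that two paths which agree on
  \<open>[0,\<infinity>)\<close> are equal.\<close>

definition cadlag_paths :: "'e::metric_space set \<Rightarrow> (real \<Rightarrow> 'e) set" where
  "cadlag_paths E = {x \<in> {0..} \<rightarrow>\<^sub>E E.
     (\<forall>t\<ge>0. (x \<longlongrightarrow> x t) (at_right t)) \<and>
     (\<forall>t>0. \<exists>l\<in>E. (x \<longlongrightarrow> l) (at_left t))}"

text \<open>An increasing function of \<open>[0,\<infinity>)\<close> onto itself is automatically continuous.\<close>

definition time_change :: "(real \<Rightarrow> real) \<Rightarrow> bool" where
  "time_change \<mu> \<longleftrightarrow> strict_mono_on {0..} \<mu> \<and> \<mu> ` {0..} = {0..}"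

definition skorokhod_nbhd ::
    "'e::metric_space set \<Rightarrow> (real \<Rightarrow> 'e) \<Rightarrow> real \<Rightarrow> real \<Rightarrow> (real \<Rightarrow> 'e) set" where
  "skorokhod_nbhd E x m e = {y \<in> cadlag_paths E. \<exists>\<mu> d. time_change \<mu> \<and> d < e \<and>
     (\<forall>s\<ge>0. \<bar>\<mu> s - s\<bar> \<le> d) \<and> (\<forall>s\<in>{0..m}. dist (y (\<mu> s)) (x s) \<le> d)}"

text \<open>The Skorokhod (J1) topology on \<open>D\<^sub>E[0,\<infinity>)\<close>. The sets \<open>skorokhod_nbhd E x m e\<close> form a base of
  open neighbourhoods of \<open>x\<close> (\<open>m = k\<close>, \<open>e = 1/k\<close> suffice), and the convergent sequences are those described in
  \<open>limitin_skorokhod\<close> below, which is the usual definition of Skorokhod convergence.\<close>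

definition skorokhod_topology :: "'e::metric_space set \<Rightarrow> (real \<Rightarrow> 'e) topology" where
  "skorokhod_topology E = topology (\<lambda>U. U \<subseteq> cadlag_paths E \<and>
     (\<forall>x\<in>U. \<exists>m>0. \<exists>e>0. skorokhod_nbhd E x m e \<subseteq> U))"

lemma skorokhod_nbhd_mono:
  assumes "m \<le> m'" "e' \<le> e"
  shows "skorokhod_nbhd E x m' e' \<subseteq> skorokhod_nbhd E x m e"
proof
  fix y assume "y \<in> skorokhod_nbhd E x m' e'"
  then obtain \<mu> d where "y \<in> cadlag_paths E" "time_change \<mu>" "d < e'"
    "\<forall>s\<ge>0. \<bar>\<mu> s - s\<bar> \<le> d" "\<forall>s\<in>{0..m'}. dist (y (\<mu> s)) (x s) \<le> d"
    unfolding skorokhod_nbhd_def by blast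
  moreover have "{0..m} \<subseteq> {0..m'}" "d < e' \<Longrightarrow> d < e" using assms by auto
  ultimately show "y \<in> skorokhod_nbhd E x m e"
    unfolding skorokhod_nbhd_def by blast
qed

lemma openin_skorokhod:
  "openin (skorokhod_topology E) U \<longleftrightarrow> U \<subseteq> cadlag_paths E \<and>
     (\<forall>x\<in>U. \<exists>m>0. \<exists>e>0. skorokhod_nbhd E x m e \<subseteq> U)"
proof -
  have "istopology (\<lambda>U. U \<subseteq> cadlag_paths E \<and>
     (\<forall>x\<in>U. \<exists>m>0. \<exists>e>0. skorokhod_nbhd E x m e \<subseteq> U))" (is "istopology ?P")
    unfolding istopology_def
  proof (intro conjI allI impI)
    fix S R assume S: "?P S" and R: "?P R"
    show "S \<inter> R \<subseteq> cadlag_paths E" using S by auto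
    show "\<forall>x\<in>S \<inter> R. \<exists>m>0. \<exists>e>0. skorokhod_nbhd E x m e \<subseteq> S \<inter> R"
    proof
      fix x assume "x \<in> S \<inter> R"
      then obtain m e m' e' where m: "m > 0" "e > 0" "skorokhod_nbhd E x m e \<subseteq> S"
        and m': "m' > 0" "e' > 0" "skorokhod_nbhd E x m' e' \<subseteq> R"
        using S R by (meson IntD1 IntD2)
      have "skorokhod_nbhd E x (max m m') (min e e') \<subseteq> S \<inter> R"
        using m(3) m'(3) skorokhod_nbhd_mono[of m "max m m'" "min e e'" e E x]
          skorokhod_nbhd_mono[of m' "max m m'" "min e e'" e' E x] by fastforce
      then show "\<exists>m>0. \<exists>e>0. skorokhod_nbhd E x m e \<subseteq> S \<inter> R"
        using m m' by (intro exI[of _ "max m m'"] conjI exI[of _ "min e e'"]) auto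
    qed
  next
    fix K assume K: "\<forall>S\<in>K. ?P S"
    then show "\<Union>K \<subseteq> cadlag_paths E" by blast
    show "\<forall>x\<in>\<Union>K. \<exists>m>0. \<exists>e>0. skorokhod_nbhd E x m e \<subseteq> \<Union>K"
      using K by (meson Union_iff Union_upper order_trans)
  qed
  then show ?thesis unfolding skorokhod_topology_def by simp
qed

lemma topspace_skorokhod [simp]: "topspace (skorokhod_topology E) = cadlag_paths E"
proof -
  have "openin (skorokhod_topology E) (cadlag_paths E)"
    unfolding openin_skorokhod by (auto simp: skorokhod_nbhd_def intro!: exI[of _ "1::real"])
  then have "cadlag_paths E \<subseteq> topspace (skorokhod_topology E)"
    by (rule openin_subset)
  moreover have "topspace (skorokhod_topology E) \<subseteq> cadlag_paths E"
    using openin_skorokhod[of E "topspace (skorokhod_topology E)"] by simp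
  ultimately show ?thesis by (rule subset_antisym[rotated])
qed

lemma time_change_nonneg: "time_change \<mu> \<Longrightarrow> 0 \<le> s \<Longrightarrow> 0 \<le> \<mu> s"
  unfolding time_change_def by auto

lemma time_change_id: "time_change (\<lambda>s. s)"
  by (auto simp: time_change_def strict_mono_on_def)

lemma time_change_comp:
  assumes "time_change \<mu>" "time_change \<mu>'"
  shows "time_change (\<lambda>s. \<mu>' (\<mu> s))"
proof -
  have "(\<lambda>s. \<mu>' (\<mu> s)) ` {0..} = {0..}"
    using assms unfolding time_change_def by (simp add: image_image[symmetric, of \<mu>' \<mu>])
  moreover have "strict_mono_on {0..} (\<lambda>s. \<mu>' (\<mu> s))"
    using assms time_change_nonneg[OF assms(1)]
    unfolding time_change_def strict_mono_on_def by simp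
  ultimately show ?thesis unfolding time_change_def by blast
qed

lemma time_change_mono: "time_change \<mu> \<Longrightarrow> 0 \<le> s \<Longrightarrow> s \<le> t \<Longrightarrow> \<mu> s \<le> \<mu> t"
  unfolding time_change_def strict_mono_on_def by (cases "s = t") (auto intro: less_imp_le)

lemma skorokhod_nbhd_self:
  "x \<in> cadlag_paths E \<Longrightarrow> e > 0 \<Longrightarrow> x \<in> skorokhod_nbhd E x m e"
  unfolding skorokhod_nbhd_def
  by (auto intro!: exI[of _ "\<lambda>s. s"] exI[of _ "0::real"] time_change_id)

lemma openin_skorokhod_nbhd:
  assumes "m \<ge> 0"
  shows "openin (skorokhod_topology E) (skorokhod_nbhd E x m e)"
  unfolding openin_skorokhod
proof (intro conjI ballI)
  show "skorokhod_nbhd E x m e \<subseteq> cadlag_paths E" by (auto simp: skorokhod_nbhd_def)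
  fix y assume "y \<in> skorokhod_nbhd E x m e"
  then obtain \<mu> d where \<mu>: "time_change \<mu>" "d < e" "\<And>s. s \<ge> 0 \<Longrightarrow> \<bar>\<mu> s - s\<bar> \<le> d"
    "\<And>s. s \<in> {0..m} \<Longrightarrow> dist (y (\<mu> s)) (x s) \<le> d"
    unfolding skorokhod_nbhd_def by auto
  define m' where "m' = \<mu> m + 1"
  have m'0: "m' > 0" using time_change_nonneg[OF \<mu>(1) assms] by (simp add: m'_def)
  have "skorokhod_nbhd E y m' (e - d) \<subseteq> skorokhod_nbhd E x m e"
  proof
    fix z assume "z \<in> skorokhod_nbhd E y m' (e - d)"
    then obtain \<mu>' d' where \<mu>': "time_change \<mu>'" "d' < e - d"
      "\<And>s. s \<ge> 0 \<Longrightarrow> \<bar>\<mu>' s - s\<bar> \<le> d'"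
      "\<And>s. s \<in> {0..m'} \<Longrightarrow> dist (z (\<mu>' s)) (y s) \<le> d'" and z: "z \<in> cadlag_paths E"
      unfolding skorokhod_nbhd_def by auto
    have "\<bar>\<mu>' (\<mu> s) - s\<bar> \<le> d + d'" if "s \<ge> 0" for s
      using \<mu>(3)[OF that] \<mu>'(3)[OF time_change_nonneg[OF \<mu>(1) that]] by linarith
    moreover have "dist (z (\<mu>' (\<mu> s))) (x s) \<le> d + d'" if s: "s \<in> {0..m}" for s
    proof -
      have "\<mu> s \<in> {0..m'}"
        using time_change_nonneg[OF \<mu>(1), of s] time_change_mono[OF \<mu>(1), of s m] s
        by (auto simp: m'_def)
      then show ?thesis
        using \<mu>'(4) \<mu>(4)[OF s] dist_triangle[of "z (\<mu>' (\<mu> s))" "x s" "y (\<mu> s)"] by fastforce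
    qed
    ultimately show "z \<in> skorokhod_nbhd E x m e"
      unfolding skorokhod_nbhd_def using z \<mu>'(2) time_change_comp[OF \<mu>(1) \<mu>'(1)]
      by (intro CollectI conjI exI[of _ "\<lambda>s. \<mu>' (\<mu> s)"] exI[of _ "d + d'"]) auto
  qed
  then show "\<exists>m'>0. \<exists>e'>0. skorokhod_nbhd E y m' e' \<subseteq> skorokhod_nbhd E x m e"
    using m'0 \<mu>(2) by (intro exI[of _ m'] conjI exI[of _ "e - d"]) auto
qed

lemma limitin_skorokhod:
  "limitin (skorokhod_topology E) X x sequentially \<longleftrightarrow>
     x \<in> cadlag_paths E \<and> (\<forall>\<^sub>F n in sequentially. X n \<in> cadlag_paths E) \<and>
     (\<exists>\<mu>. (\<forall>n. time_change (\<mu> n)) \<and>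
        uniform_limit {0..} \<mu> (\<lambda>s. s) sequentially \<and>
        (\<forall>m. uniform_limit {0..m} (\<lambda>n s. X n (\<mu> n s)) x sequentially))"
  (is "?L \<longleftrightarrow> ?x \<and> ?ev \<and> ?R")
proof
  assume L: ?L
  then have x: ?x by (simp add: limitin_def)
  have ev: ?ev
    using L x openin_topspace[of "skorokhod_topology E"] unfolding limitin_def by simp
  define P where "P n j \<longleftrightarrow> X n \<in> skorokhod_nbhd E x (real j) (1 / Suc j)" for n j
  have evP: "\<forall>\<^sub>F n in sequentially. P n j" for j
    using L openin_skorokhod_nbhd[of "real j" E x "1 / Suc j"]
      skorokhod_nbhd_self[OF x, of "1 / Suc j" "real j"]
    unfolding limitin_def P_def by simp
  have mono: "P n i" if "P n j" "i \<le> j" for n i j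
    using that skorokhod_nbhd_mono[of "real i" "real j" "1 / Suc j" "1 / Suc i" E x]
    unfolding P_def by (auto simp: frac_le)
  define k where "k n = Max ({0} \<union> {j. j \<le> n \<and> P n j})" for n
  have kfin: "finite ({0} \<union> {j. j \<le> n \<and> P n j})" for n by simp
  have kP: "P n (k n) \<or> \<not> P n 0" for n
  proof -
    have "k n \<in> {0} \<union> {j. j \<le> n \<and> P n j}" unfolding k_def by (rule Max_in) auto
    then show ?thesis by auto
  qed
  have k_lim: "\<forall>\<^sub>F n in sequentially. j \<le> k n" for j
    using evP[of j] eventually_ge_at_top[of j]
  proof eventually_elim
    case (elim n) then show ?case unfolding k_def by (intro Max_ge) auto
  qed
  define Q where "Q n \<mu> \<longleftrightarrow> time_change \<mu> \<and> (P n 0 \<longrightarrow>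
      (\<forall>s\<ge>0. \<bar>\<mu> s - s\<bar> \<le> 1 / Suc (k n)) \<and>
      (\<forall>s\<in>{0..real (k n)}. dist (X n (\<mu> s)) (x s) \<le> 1 / Suc (k n)))" for n \<mu>
  have "\<exists>\<mu>. Q n \<mu>" for n
  proof (cases "P n 0")
    case True
    then have "P n (k n)" using kP by blast
    then obtain \<mu> d where "time_change \<mu>" and d: "d < 1 / Suc (k n)"
      and 1: "\<forall>s\<ge>0. \<bar>\<mu> s - s\<bar> \<le> d"
      and 2: "\<forall>s\<in>{0..real (k n)}. dist (X n (\<mu> s)) (x s) \<le> d"
      unfolding P_def skorokhod_nbhd_def by blast
    have "\<forall>s\<ge>0. \<bar>\<mu> s - s\<bar> \<le> 1 / Suc (k n)"
      using 1 d by (meson less_imp_le order_trans)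
    moreover have "\<forall>s\<in>{0..real (k n)}. dist (X n (\<mu> s)) (x s) \<le> 1 / Suc (k n)"
      using 2 d by (meson less_imp_le order_trans)
    ultimately have "Q n \<mu>" unfolding Q_def using \<open>time_change \<mu>\<close> by blast
    then show ?thesis by blast
  next
    case False
    then have "Q n (\<lambda>s. s)" unfolding Q_def using time_change_id by blast
    then show ?thesis by blast
  qed
  then have "\<forall>n. \<exists>\<mu>. Q n \<mu>" by blast
  then obtain \<mu> where Q: "\<forall>n. Q n (\<mu> n)" by (rule choice[THEN exE])
  have tc: "time_change (\<mu> n)" for n using Q unfolding Q_def by blast
  have \<mu>1: "\<bar>\<mu> n s - s\<bar> \<le> 1 / Suc (k n)" if "P n 0" "s \<ge> 0" for n s
    using Q that unfolding Q_def by blast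
  have \<mu>2: "dist (X n (\<mu> n s)) (x s) \<le> 1 / Suc (k n)" if "P n 0" "s \<in> {0..real (k n)}" for n s
    using Q that unfolding Q_def by blast
  have small: "\<forall>\<^sub>F n in sequentially. P n 0 \<and> 1 / Suc (k n) < e \<and> m \<le> k n" if e0: "e > 0" for e :: real and m :: real
  proof -
    obtain j where j: "1 / Suc j < e" using nat_approx_posE[OF e0] by blast
    obtain i :: nat where i: "m \<le> i" using real_arch_simple by blast
    show ?thesis using evP[of 0] k_lim[of j] k_lim[of i]
    proof eventually_elim
      case (elim n)
      have "1 / Suc (k n) \<le> 1 / real (Suc j)" using elim by (simp add: frac_le)
      then show ?case using elim i j by linarith
    qed
  qed
  have "uniform_limit {0..} \<mu> (\<lambda>s. s) sequentially"
    unfolding uniform_limit_iff dist_real_def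
  proof (intro allI impI)
    fix e :: real assume "e > 0"
    show "\<forall>\<^sub>F n in sequentially. \<forall>s\<in>{0..}. \<bar>\<mu> n s - s\<bar> < e"
      using small[OF \<open>e > 0\<close>, of 0] by eventually_elim (auto intro: le_less_trans[OF \<mu>1])
  qed
  moreover have "uniform_limit {0..m} (\<lambda>n s. X n (\<mu> n s)) x sequentially" for m
    unfolding uniform_limit_iff
  proof (intro allI impI)
    fix e :: real assume "e > 0"
    show "\<forall>\<^sub>F n in sequentially. \<forall>s\<in>{0..m}. dist (X n (\<mu> n s)) (x s) < e"
      using small[OF \<open>e > 0\<close>, of m] by eventually_elim (auto intro!: le_less_trans[OF \<mu>2])
  qed
  ultimately show "?x \<and> ?ev \<and> ?R" using x ev tc by blast
next
  assume R: "?x \<and> ?ev \<and> ?R"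
  then obtain \<mu> where tc: "\<And>n. time_change (\<mu> n)"
    and u1: "uniform_limit {0..} \<mu> (\<lambda>s. s) sequentially"
    and u2: "\<And>m. uniform_limit {0..m} (\<lambda>n s. X n (\<mu> n s)) x sequentially"
    by blast
  show ?L unfolding limitin_def
  proof (intro conjI allI impI)
    show "x \<in> topspace (skorokhod_topology E)" using R by simp
    fix U assume "openin (skorokhod_topology E) U \<and> x \<in> U"
    then obtain m e where m: "e > 0" "skorokhod_nbhd E x m e \<subseteq> U"
      unfolding openin_skorokhod by blast
    have e2: "e / 2 > 0" using m by simp
    have "\<forall>\<^sub>F n in sequentially. X n \<in> cadlag_paths E" using R by blast
    then show "\<forall>\<^sub>F n in sequentially. X n \<in> U"
      using u1[unfolded uniform_limit_iff, rule_format, OF e2]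
        u2[of m, unfolded uniform_limit_iff, rule_format, OF e2]
    proof eventually_elim
      case (elim n)
      then have "X n \<in> skorokhod_nbhd E x m e"
        unfolding skorokhod_nbhd_def using tc[of n] m(1)
        by (intro CollectI conjI exI[of _ "\<mu> n"] exI[of _ "e / 2"])
          (auto simp: dist_real_def less_imp_le)
      then show ?case using m(2) by blast
    qed
  qed
qed

section \<open>Weak convergence\<close>

definition borel_of_topology :: "'p topology \<Rightarrow> 'p measure" where
  "borel_of_topology T = sigma (topspace T) {U. openin T U}"

text \<open>\<open>\<mu>\<close> is the law of \<open>X\<close> on the topological space \<open>T\<close>. As usual, \<open>X\<close> is only required to be
  almost surely equal to a random element of \<open>T\<close>: it may leave \<open>T\<close> on a null set.\<close>

definition has_law :: "'p topology \<Rightarrow> 'a measure \<Rightarrow> ('a \<Rightarrow> 'p) \<Rightarrow> 'p measure \<Rightarrow> bool" where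
  "has_law T M X \<mu> \<longleftrightarrow> (\<exists>X' \<in> M \<rightarrow>\<^sub>M borel_of_topology T.
     (AE \<omega> in M. X \<omega> = X' \<omega>) \<and> \<mu> = distr M (borel_of_topology T) X')"

definition converges_weakly :: "'p topology \<Rightarrow> (nat \<Rightarrow> 'p measure) \<Rightarrow> 'p measure \<Rightarrow> bool" where
  "converges_weakly T \<mu>s \<mu> \<longleftrightarrow>
     (\<forall>f. continuous_map T euclideanreal f \<and> bounded (f ` topspace T) \<longrightarrow>
        (\<lambda>n. \<integral>p. f p \<partial>\<mu>s n) \<longlonglongrightarrow> (\<integral>p. f p \<partial>\<mu>))"

definition converges_in_law :: "'p topology \<Rightarrow> (nat \<Rightarrow> 'a measure) \<Rightarrow> (nat \<Rightarrow> 'a \<Rightarrow> 'p) \<Rightarrow>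
    'b measure \<Rightarrow> ('b \<Rightarrow> 'p) \<Rightarrow> bool" where
  "converges_in_law T Ms Xs M X \<longleftrightarrow>
     (\<exists>\<mu>s \<mu>. (\<forall>n. has_law T (Ms n) (Xs n) (\<mu>s n)) \<and> has_law T M X \<mu> \<and> converges_weakly T \<mu>s \<mu>)"

definition sample_path :: "(real \<Rightarrow> 'a \<Rightarrow> 'e) \<Rightarrow> 'a \<Rightarrow> real \<Rightarrow> 'e" where
  "sample_path X \<omega> = restrict (\<lambda>t. X t \<omega>) {0..}"

section \<open>Compound Hawkes processes\<close>

text \<open>\<open>\<theta> i\<close> and \<open>\<zeta> i\<close> are the \<open>(i+1)\<close>-st jump time and mark. With \<open>L\<^sub>t = (\<Sum>i | \<theta> i \<le> t. \<zeta> i)\<close> the pure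
  jump loss process, \<open>loss_integral \<theta> \<zeta> f t\<close> is the integral of \<open>f\<close> against \<open>dL\<close> over \<open>[0,t]\<close>.\<close>

definition loss_integral ::
    "(nat \<Rightarrow> 'a \<Rightarrow> real) \<Rightarrow> (nat \<Rightarrow> 'a \<Rightarrow> real) \<Rightarrow> (real \<Rightarrow> real) \<Rightarrow> real \<Rightarrow> 'a \<Rightarrow> real" where
  "loss_integral \<theta> \<zeta> f t \<omega> = (\<Sum>i | \<theta> i \<omega> \<le> t. f (\<theta> i \<omega>) * \<zeta> i \<omega>)"

definition hawkes_intensity :: "(real \<Rightarrow> real) \<Rightarrow> real \<Rightarrow> real \<Rightarrow> real \<Rightarrow>
    (nat \<Rightarrow> 'a \<Rightarrow> real) \<Rightarrow> (nat \<Rightarrow> 'a \<Rightarrow> real) \<Rightarrow> real \<Rightarrow> 'a \<Rightarrow> real" where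
  "hawkes_intensity \<phi> \<beta> lam_inf x \<theta> \<zeta> t \<omega> =
     lam_inf + (x - lam_inf) * exp (- \<beta> * t) + loss_integral \<theta> \<zeta> (\<lambda>s. \<phi> (t - s)) t \<omega>"

definition exp_kernel :: "real \<Rightarrow> real \<Rightarrow> real \<Rightarrow> real" where
  "exp_kernel \<alpha> \<beta> u = \<alpha> * exp (- \<beta> * u)"

definition erlang_kernel :: "real \<Rightarrow> real \<Rightarrow> real \<Rightarrow> real" where
  "erlang_kernel \<alpha> \<beta> u = \<alpha> * u * exp (- \<beta> * u)"

definition erlang_auxiliary :: "real \<Rightarrow> real \<Rightarrow>
    (nat \<Rightarrow> 'a \<Rightarrow> real) \<Rightarrow> (nat \<Rightarrow> 'a \<Rightarrow> real) \<Rightarrow> real \<Rightarrow> 'a \<Rightarrow> real" where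
  "erlang_auxiliary \<alpha> \<beta> \<theta> \<zeta> t = loss_integral \<theta> \<zeta> (\<lambda>s. \<alpha> * exp (- \<beta> * (t - s))) t"

definition predictable_sigma :: "'a measure \<Rightarrow> (real \<Rightarrow> 'a measure) \<Rightarrow> ('a \<times> real) measure" where
  "predictable_sigma M F = sigma (space M \<times> {0..})
     ({A \<times> {0} | A. A \<in> sets (F 0)} \<union>
      {A \<times> {s<..t} | A s t. 0 \<le> s \<and> s \<le> t \<and> A \<in> sets (F s)})"

text \<open>Compound Hawkes process with intensity \<open>lam\<close> and mark distribution \<open>\<nu>\<close>, with respect to a
  filtration \<open>F\<close> to which the marked point process is adapted (in particular the one it generates).
  The last assumption says that the jump measure of the loss process has the predictable compensator
  \<open>lam\<^sub>t\<^sub>- dt \<nu>(dz)\<close>.\<close>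

locale compound_hawkes = prob_space M + filtration "space M" F
  for M :: "'a measure" and F :: "real \<Rightarrow> 'a measure" +
  fixes \<theta> \<zeta> :: "nat \<Rightarrow> 'a \<Rightarrow> real" and \<nu> :: "real measure" and lam :: "real \<Rightarrow> 'a \<Rightarrow> real"
  assumes sub_algebra: "\<And>t. sets (F t) \<subseteq> sets M"
    and jump_times_pos: "\<And>\<omega>. \<omega> \<in> space M \<Longrightarrow> 0 < \<theta> 0 \<omega>"
    and jump_times_increasing: "\<And>\<omega>. \<omega> \<in> space M \<Longrightarrow> strict_mono (\<lambda>i. \<theta> i \<omega>)"
    and finitely_many_jumps: "\<And>\<omega> t. \<omega> \<in> space M \<Longrightarrow> finite {i. \<theta> i \<omega> \<le> t}"
    and adapted: "\<And>i t B. 0 \<le> t \<Longrightarrow> B \<in> sets borel \<Longrightarrow>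
          {\<omega> \<in> space M. \<theta> i \<omega> \<le> t \<and> \<zeta> i \<omega> \<in> B} \<in> sets (F t)"
    and marks_indep: "indep_vars (\<lambda>_. borel) \<zeta> UNIV"
    and marks_distr: "\<And>i. distr M borel (\<zeta> i) = \<nu>"
    and compensator: "\<And>W :: ('a \<times> real) \<times> real \<Rightarrow> ennreal.
          W \<in> borel_measurable (predictable_sigma M F \<Otimes>\<^sub>M borel) \<Longrightarrow>
          (\<integral>\<^sup>+\<omega>. (\<Sum>i. W ((\<omega>, \<theta> i \<omega>), \<zeta> i \<omega>)) \<partial>M) =
          (\<integral>\<^sup>+\<omega>. (\<integral>\<^sup>+t\<in>{0..}. (\<integral>\<^sup>+z. W ((\<omega>, t), z) \<partial>\<nu>) *
             ennreal (Lim (at_left t) (\<lambda>s. lam s \<omega>)) \<partial>lborel) \<partial>M)"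

section \<open>The discretisation schemes\<close>

locale scheme_noise = prob_space M
  for M :: "'a measure" +
  fixes U Z :: "nat \<Rightarrow> 'a \<Rightarrow> real" and \<nu> :: "real measure"
  assumes U_indep: "indep_vars (\<lambda>_. borel) U UNIV"
    and U_distr: "\<And>k. distr M borel (U k) = uniform_measure lborel {0..1}"
    and Z_indep: "indep_vars (\<lambda>_. borel) Z UNIV"
    and Z_distr: "\<And>k. distr M borel (Z k) = \<nu>"
    and U_Z_indep: "indep_var (\<Pi>\<^sub>M k\<in>UNIV. borel) (\<lambda>\<omega> k. U k \<omega>) (\<Pi>\<^sub>M k\<in>UNIV. borel) (\<lambda>\<omega> k. Z k \<omega>)"

primrec exp_scheme :: "real \<Rightarrow> real \<Rightarrow> real \<Rightarrow> real \<Rightarrow> real \<Rightarrow>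
    (nat \<Rightarrow> real) \<Rightarrow> (nat \<Rightarrow> real) \<Rightarrow> nat \<Rightarrow> real" where
  "exp_scheme \<alpha> \<beta> lam_inf x h u z 0 = x"
| "exp_scheme \<alpha> \<beta> lam_inf x h u z (Suc k) =
     (let l = exp_scheme \<alpha> \<beta> lam_inf x h u z k in
      lam_inf * (1 - exp (- \<beta> * h)) +
      (l + \<alpha> * z (Suc k) * of_bool (u (Suc k) < l * h)) * exp (- \<beta> * h))"

text \<open>The pair \<open>(l\<^sub>k, a\<^sub>k)\<close>.\<close>

primrec erlang_scheme :: "real \<Rightarrow> real \<Rightarrow> real \<Rightarrow> real \<Rightarrow> real \<Rightarrow>
    (nat \<Rightarrow> real) \<Rightarrow> (nat \<Rightarrow> real) \<Rightarrow> nat \<Rightarrow> real \<times> real" where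
  "erlang_scheme \<alpha> \<beta> lam_inf x h u z 0 = (x, 0)"
| "erlang_scheme \<alpha> \<beta> lam_inf x h u z (Suc k) =
     (let (l, a) = erlang_scheme \<alpha> \<beta> lam_inf x h u z k;
          a' = (a + \<alpha> * z (Suc k) * of_bool (u (Suc k) < l * h)) * exp (- \<beta> * h)
      in (lam_inf * (1 - exp (- \<beta> * h)) + l * exp (- \<beta> * h) + a' * h, a'))"

definition exp_interpolation :: "real \<Rightarrow> real \<Rightarrow> real \<Rightarrow> real \<Rightarrow> real \<Rightarrow> nat \<Rightarrow>
    (nat \<Rightarrow> 'a \<Rightarrow> real) \<Rightarrow> (nat \<Rightarrow> 'a \<Rightarrow> real) \<Rightarrow> real \<Rightarrow> 'a \<Rightarrow> real" where
  "exp_interpolation \<alpha> \<beta> lam_inf x T N U Z t \<omega> =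
     exp_scheme \<alpha> \<beta> lam_inf x (T / real N) (\<lambda>k. U k \<omega>) (\<lambda>k. Z k \<omega>) (nat \<lfloor>real N * t / T\<rfloor>)"

definition erlang_interpolation :: "real \<Rightarrow> real \<Rightarrow> real \<Rightarrow> real \<Rightarrow> real \<Rightarrow> nat \<Rightarrow>
    (nat \<Rightarrow> 'a \<Rightarrow> real) \<Rightarrow> (nat \<Rightarrow> 'a \<Rightarrow> real) \<Rightarrow> real \<Rightarrow> 'a \<Rightarrow> real \<times> real" where
  "erlang_interpolation \<alpha> \<beta> lam_inf x T N U Z t \<omega> =
     erlang_scheme \<alpha> \<beta> lam_inf x (T / real N) (\<lambda>k. U k \<omega>) (\<lambda>k. Z k \<omega>) (nat \<lfloor>real N * t / T\<rfloor>)"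

end

theory Submission
  imports Defs
begin

text \<open>The law of a compound Hawkes process is determined by the compensator: if \<open>S\<^sub>n\<close> is the
  intensity integrated between the \<open>n\<close>-th and the next jump, then testing the compensator formula with
  functions of the past and of the running integral shows that the pairs \<open>(S\<^sub>n, \<zeta>\<^sub>n)\<close> are independent with
  law \<open>Exp(1) \<otimes> \<nu>\<close>. The scheme, on the other hand, follows the exact flow of the intensity between
  its jumps, and by the lack of memory of the exponential law it has the same law as a scheme which jumps
  as soon as the sum of the discrete hazards \<open>- ln (1 - l\<^sub>k h)\<close> exceeds an exponential clock. Driving this
  scheme with the clocks \<open>S\<^sub>n\<close> and marks \<open>\<zeta>\<^sub>n\<close> of the Hawkes process couples the two processes: the
  discrete hazards are Riemann sums for the integrated intensity, so the jump times converge almost surely,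
  hence the paths converge in the Skorokhod topology.

  Both kernels are instances of \<open>(c\<^sub>1 + c\<^sub>2 u) e\<^bsup>-\<beta>u\<^esup>\<close>, with \<open>c\<^sub>2 = 0\<close> for the exponential and
  \<open>c\<^sub>1 = 0\<close> for the Erlang kernel; the exponential case is the first coordinate of the pair.\<close>

section \<open>Neighbourhoods of piecewise continuous paths\<close>

text \<open>Tightness and a uniqueness theorem for the limit are avoided: the coupled schemes live
  on the probability space of the Hawkes process and converge there almost surely, only their laws
  are compared with the given schemes, and dominated convergence does the rest. Two obstacles shape
  the proof. The limit path jumps, so uniform closeness fails and jump times have to be matched by
  an explicit piecewise linear time change. The filtration is general, so the compensator may be
  tested only with predictable integrands; these are assembled from the marked points strictly
  before the current time. Marks are positive only almost surely: truncation at 0 makes the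
  constructions valid for every outcome, and the last step returns to the given processes up to null
  sets. Both forms of the scheme are recursions on the initial state with shifted noise, since then
  the first noise variables can be integrated out and equality in law is an induction on the number
  of steps.\<close>

lemma time_change_stretch:
  fixes a b c :: real
  assumes "0 \<le> a" "a < b" "a < c"
  shows "time_change (\<lambda>s. if s \<le> a then s else if s \<le> b then a + (s - a) * ((c - a) / (b - a)) else s + c - b)"
    (is "time_change ?g")
proof -
  define r where "r = (c - a) / (b - a)"
  have r: "r > 0" using assms by (simp add: r_def)
  have rb: "(b - a) * r = c - a" using assms by (simp add: r_def)
  have seg: "a < a + (s - a) * r" if "a < s" for s
    using mult_pos_pos[of "s - a" r] that r by linarith
  have seg2: "a + (s - a) * r \<le> c" if "s \<le> b" for s
    using mult_right_mono[of "s - a" "b - a" r] that r rb by linarith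
  have seg3: "(s - a) * r < (t - a) * r" if "s < t" for s t
    using that r by (intro mult_strict_right_mono) auto
  let ?f = "\<lambda>s. if s \<le> a then s else if s \<le> b then a + (s - a) * r else s + c - b"
  have "?f s < ?f t" if st: "0 \<le> s" "s < t" for s t
    using st seg[of t] seg[of s] seg2[of s] seg3[of s t] assms by auto
  then have "strict_mono_on {0..} ?f" by (simp add: strict_mono_on_def)
  moreover have "?f ` {0..} = {0..}"
  proof
    show "?f ` {0..} \<subseteq> {0..}" 
    proof (rule image_subsetI)
      fix s :: real assume "s \<in> {0..}"
      then show "?f s \<in> {0..}" using seg[of s] assms by auto
    qed
    show "{0..} \<subseteq> ?f ` {0..}"
    proof
      fix y :: real assume y: "y \<in> {0..}"
      show "y \<in> ?f ` {0..}"
      proof (cases "y \<le> a")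
        case True then show ?thesis using y by (intro image_eqI[of _ _ y]) auto
      next
        case False
        show ?thesis
        proof (cases "y \<le> c")
          case True
          define s where "s = a + (y - a) / r"
          have "a < s" using False r by (simp add: s_def)
          moreover have "s \<le> b"
          proof -
            have "(y - a) / r \<le> (c - a) / r" using True r by (intro divide_right_mono) auto
            also have "\<dots> = b - a" using assms by (simp add: r_def)
            finally show ?thesis by (simp add: s_def)
          qed
          moreover have "a + (s - a) * r = y" using r by (simp add: s_def)
          ultimately show ?thesis using assms by (intro image_eqI[of _ _ s]) auto
        next
          case False then show ?thesis using assms by (intro image_eqI[of _ _ "y + b - c"]) auto
        qed
      qed
    qed
  qed
  ultimately show ?thesis unfolding time_change_def r_def by blast
qed

text \<open>Nodes are added one at a time: the map built so far is followed by a stretch that is the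
  identity up to \<sigma> n. Between two nodes the displacement is a convex combination of the
  displacements at the nodes, so it stays within d.\<close>

lemma time_change_interpolation:
  fixes \<tau> \<sigma> :: "nat \<Rightarrow> real"
  assumes "\<tau> 0 = 0" "\<sigma> 0 = 0"
    and "\<And>i. i < n \<Longrightarrow> \<tau> i < \<tau> (Suc i)" and "\<And>i. i < n \<Longrightarrow> \<sigma> i < \<sigma> (Suc i)"
    and "\<And>i. i \<le> n \<Longrightarrow> \<bar>\<sigma> i - \<tau> i\<bar> \<le> d"
  obtains \<mu> where "time_change \<mu>" "\<And>s. 0 \<le> s \<Longrightarrow> \<bar>\<mu> s - s\<bar> \<le> d" "\<And>i. i \<le> n \<Longrightarrow> \<mu> (\<tau> i) = \<sigma> i"
proof -
  \<comment> \<open>Beyond the last node the map is kept a translation, so that the next stretch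
    acts on a known function.\<close>
  have "\<exists>\<mu>. time_change \<mu> \<and> (\<forall>s\<ge>0. \<bar>\<mu> s - s\<bar> \<le> d) \<and> (\<forall>i\<le>n. 0 \<le> \<tau> i \<and> \<tau> i \<le> \<tau> n \<and> \<mu> (\<tau> i) = \<sigma> i)
     \<and> (\<forall>s\<ge>\<tau> n. \<mu> s = s + \<sigma> n - \<tau> n)"
    using assms(3-5)
  proof (induction n)
    case 0
    then show ?case using assms(1,2) by (intro exI[of _ "\<lambda>s. s"]) (auto simp: time_change_id)
  next
    case (Suc n)
    have "\<exists>\<mu>. time_change \<mu> \<and> (\<forall>s\<ge>0. \<bar>\<mu> s - s\<bar> \<le> d)
       \<and> (\<forall>i\<le>n. 0 \<le> \<tau> i \<and> \<tau> i \<le> \<tau> n \<and> \<mu> (\<tau> i) = \<sigma> i) \<and> (\<forall>s\<ge>\<tau> n. \<mu> s = s + \<sigma> n - \<tau> n)"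
      using Suc.prems by (intro Suc.IH) auto
    then obtain \<mu> where \<mu>: "time_change \<mu>" "\<And>s. s\<ge>0 \<Longrightarrow> \<bar>\<mu> s - s\<bar> \<le> d"
      "\<And>i. i \<le> n \<Longrightarrow> 0 \<le> \<tau> i" "\<And>i. i \<le> n \<Longrightarrow> \<tau> i \<le> \<tau> n" "\<And>i. i \<le> n \<Longrightarrow> \<mu> (\<tau> i) = \<sigma> i"
      "\<And>s. s\<ge>\<tau> n \<Longrightarrow> \<mu> s = s + \<sigma> n - \<tau> n"
      by blast
    \<comment> \<open>\<open>b\<close> is where the translation sends \<tau> (Suc n) before the
      stretch; \<open>c\<close> is where it has to go.\<close>
    define a b c where abc: "a = \<sigma> n" "b = \<tau> (Suc n) + \<sigma> n - \<tau> n" "c = \<sigma> (Suc n)"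
    define g where "g s = (if s \<le> a then s else if s \<le> b then a + (s - a) * ((c - a) / (b - a)) else s + c - b)" for s
    have a0: "0 \<le> a" using time_change_nonneg[OF \<mu>(1) \<mu>(3)[of n]] \<mu>(5)[of n] by (simp add: abc)
    have ab: "a < b" using Suc.prems(1)[of n] by (simp add: abc)
    have ac: "a < c" using Suc.prems(2)[of n] by (simp add: abc)
    have g: "time_change g" unfolding g_def[abs_def] using time_change_stretch[OF a0 ab ac] .
    let ?\<mu> = "\<lambda>s. g (\<mu> s)"
    have low: "?\<mu> s = \<mu> s" if "0 \<le> s" "s \<le> \<tau> n" for s
    proof -
      have "\<mu> s \<le> a" using time_change_mono[OF \<mu>(1) that] \<mu>(5)[of n] by (simp add: abc)
      then show ?thesis by (simp add: g_def)
    qed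
    have high: "?\<mu> s = s + \<sigma> (Suc n) - \<tau> (Suc n)" if "\<tau> (Suc n) \<le> s" for s
    proof -
      have "\<mu> s = s + \<sigma> n - \<tau> n" using \<mu>(6)[of s] that Suc.prems(1)[of n] by simp
      then have "\<mu> s \<ge> b" "\<mu> s - b = s - \<tau> (Suc n)" using that by (auto simp: abc)
      then show ?thesis using ab by (cases "\<mu> s = b") (auto simp: g_def abc(3))
    qed
    have mid: "\<bar>?\<mu> s - s\<bar> \<le> d" if s: "\<tau> n < s" "s < \<tau> (Suc n)" for s
    proof -
      have ms: "\<mu> s = s + \<sigma> n - \<tau> n" using \<mu>(6)[of s] s by simp
      have ba: "b - a = \<tau> (Suc n) - \<tau> n" by (simp add: abc)
      \<comment> \<open>Barycentric coordinate of s between the two nodes; the displacement at s is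
        affine in it.\<close>
      define u where "u = (s - \<tau> n) / (b - a)"
      have u: "0 \<le> u" "u \<le> 1" using s ba by (auto simp: u_def)
      have us: "s - \<tau> n = u * (b - a)" using ab by (simp add: u_def)
      have "?\<mu> s = a + u * (c - a)"
        using s ms us by (auto simp: g_def abc u_def)
      then have "?\<mu> s - s = (1 - u) * (\<sigma> n - \<tau> n) + u * (\<sigma> (Suc n) - \<tau> (Suc n))"
        using us ba by (simp add: abc algebra_simps)
      then have "\<bar>?\<mu> s - s\<bar> \<le> (1 - u) * \<bar>\<sigma> n - \<tau> n\<bar> + u * \<bar>\<sigma> (Suc n) - \<tau> (Suc n)\<bar>"
        using u abs_triangle_ineq[of "(1 - u) * (\<sigma> n - \<tau> n)"  "u * (\<sigma> (Suc n) - \<tau> (Suc n))"]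
        by (simp add: abs_mult)
      also have "\<dots> \<le> (1 - u) * d + u * d"
        using u Suc.prems(3)[of n] Suc.prems(3)[of "Suc n"] by (intro add_mono mult_left_mono) auto
      finally show ?thesis by (simp add: algebra_simps)
    qed
    have "\<bar>?\<mu> s - s\<bar> \<le> d" if "0 \<le> s" for s
      using low[OF that] high[of s] mid[of s] \<mu>(2)[OF that] Suc.prems(3)[of "Suc n"] by force
    moreover have "?\<mu> (\<tau> i) = \<sigma> i" if "i \<le> Suc n" for i
      using that low[of "\<tau> i"] high[of "\<tau> (Suc n)"] \<mu>(3-5)[of i] by (auto simp: le_Suc_eq)
    moreover have "0 \<le> \<tau> i \<and> \<tau> i \<le> \<tau> (Suc n)" if "i \<le> Suc n" for i
      using that \<mu>(3,4)[of i] \<mu>(3)[of n] Suc.prems(1)[of n] by (auto simp: le_Suc_eq)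
    ultimately show ?case using time_change_comp[OF \<mu>(1) g] high by (intro exI[of _ ?\<mu>]) auto
  qed
  then show ?thesis using that by blast
qed

lemma ex_piece:
  fixes \<tau> :: "nat \<Rightarrow> real"
  assumes "\<tau> 0 \<le> s" "s < \<tau> (Suc n)"
  obtains j where "j \<le> n" "\<tau> j \<le> s" "s < \<tau> (Suc j)"
proof -
  have "\<exists>j\<le>n. \<tau> j \<le> s \<and> s < \<tau> (Suc j)"
    using assms
  proof (induction n)
    case (Suc n)
    then show ?case by (cases "s < \<tau> (Suc n)") (auto simp: le_Suc_eq)
  qed auto
  then show ?thesis using that by blast
qed

text \<open>The interpolating time change maps \<open>[\<tau> j, \<tau> (Suc j))\<close> onto
  \<open>[\<sigma> j, \<sigma> (Suc j))\<close>, so values have to be compared only inside matching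
  pieces. The displacement in time has its own, smaller tolerance \<delta>.\<close>

lemma skorokhod_nbhd_pieces:
  fixes \<tau> \<sigma> :: "nat \<Rightarrow> real"
  assumes y: "y \<in> cadlag_paths E" and de: "\<delta> \<le> d" "d < e" and m: "m < \<tau> (Suc n)"
    and 0: "\<tau> 0 = 0" "\<sigma> 0 = 0"
    and mono: "\<And>i. i \<le> n \<Longrightarrow> \<tau> i < \<tau> (Suc i)" "\<And>i. i \<le> n \<Longrightarrow> \<sigma> i < \<sigma> (Suc i)"
    and close: "\<And>i. i \<le> Suc n \<Longrightarrow> \<bar>\<sigma> i - \<tau> i\<bar> \<le> \<delta>"
    and val: "\<And>j s s'. j \<le> n \<Longrightarrow> \<tau> j \<le> s \<Longrightarrow> s < \<tau> (Suc j) \<Longrightarrow> \<sigma> j \<le> s' \<Longrightarrow> s' < \<sigma> (Suc j)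
       \<Longrightarrow> 0 \<le> s \<Longrightarrow> 0 \<le> s' \<Longrightarrow> s < \<tau> (Suc n) \<Longrightarrow> \<bar>s' - s\<bar> \<le> \<delta> \<Longrightarrow> dist (y s') (x s) \<le> d"
  shows "y \<in> skorokhod_nbhd E x m e"
proof -
  have "\<And>i. i < Suc n \<Longrightarrow> \<tau> i < \<tau> (Suc i)" "\<And>i. i < Suc n \<Longrightarrow> \<sigma> i < \<sigma> (Suc i)"
    using mono by auto
  from time_change_interpolation[OF 0 this close]
  obtain \<mu> where \<mu>: "time_change \<mu>" "\<And>s. 0 \<le> s \<Longrightarrow> \<bar>\<mu> s - s\<bar> \<le> \<delta>"
    "\<And>i. i \<le> Suc n \<Longrightarrow> \<mu> (\<tau> i) = \<sigma> i"
    by blast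
  have \<tau>0: "0 \<le> \<tau> i" if "i \<le> Suc n" for i
    using that
  proof (induction i)
    case (Suc i) then show ?case using mono(1)[of i] by simp
  qed (simp add: 0)
  have "dist (y (\<mu> s)) (x s) \<le> d" if s: "s \<in> {0..m}" for s
  proof -
    obtain j where j: "j \<le> n" "\<tau> j \<le> s" "s < \<tau> (Suc j)"
      using ex_piece[of \<tau> s n] s 0 m by auto
    have "\<mu> (\<tau> j) \<le> \<mu> s" using time_change_mono[OF \<mu>(1) \<tau>0 j(2)] j by simp
    moreover have "\<mu> s < \<mu> (\<tau> (Suc j))"
      using \<mu>(1) j s \<tau>0[of "Suc j"] unfolding time_change_def strict_mono_on_def by auto
    ultimately show ?thesis using val[of j s "\<mu> s"] j \<mu> s time_change_nonneg[OF \<mu>(1), of s] m by auto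
  qed
  moreover have "\<bar>\<mu> s - s\<bar> \<le> d" if "0 \<le> s" for s using \<mu>(2)[OF that] de by linarith
  ultimately show ?thesis unfolding skorokhod_nbhd_def using y de \<mu>(1) by blast
qed

text \<open>Each \<open>G j\<close> is continuous beyond both ends of its piece; its value at the
  right end supplies the left limit there, and closedness of E keeps that limit in E.\<close>

lemma cadlag_paths_pieces:
  fixes \<tau> :: "nat \<Rightarrow> real" and G :: "nat \<Rightarrow> real \<Rightarrow> 'e::metric_space"
  assumes E: "closed E" and 0: "\<tau> 0 = 0" and unb: "\<And>t. \<exists>n. t < \<tau> n"
    and f: "\<And>j t. \<tau> j \<le> t \<Longrightarrow> t < \<tau> (Suc j) \<Longrightarrow> f t = G j t"
    and fE: "\<And>t. 0 \<le> t \<Longrightarrow> f t \<in> E"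
    and G: "\<And>j. continuous_on UNIV (G j)"
    and ext: "f \<in> extensional {0..}"
  shows "f \<in> cadlag_paths E"
proof -
  have ex: "\<exists>j. \<tau> j \<le> t \<and> t < \<tau> (Suc j)" if "0 \<le> t" for t
  proof -
    obtain n where "t < \<tau> n" using unb by blast
    then show ?thesis using ex_piece[of \<tau> t "n - 1"] 0 that by (cases n) auto
  qed
  have ex': "\<exists>j. \<tau> j < t \<and> t \<le> \<tau> (Suc j)" if "0 < t" for t
  proof -
    have "\<exists>j. \<tau> j \<le> t \<and> t < \<tau> (Suc j)" using ex that by simp
    then obtain j where j: "\<tau> j \<le> t" "t < \<tau> (Suc j)" by blast
    \<comment> \<open>A left limit at a breakpoint belongs to the piece that ends there: take the
      least index with t \<le> \<tau> j and then its predecessor.\<close>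
    define j' where "j' = (LEAST j. t \<le> \<tau> j)"
    have "t \<le> \<tau> (Suc j)" using j by simp
    then have j': "t \<le> \<tau> j'" unfolding j'_def by (rule LeastI)
    then have "j' \<noteq> 0" using 0 that by (cases j') auto
    then obtain k where k: "j' = Suc k" by (cases j') auto
    have "\<not> t \<le> \<tau> k" unfolding j'_def using k not_less_Least[of k "\<lambda>j. t \<le> \<tau> j"] j'_def by simp
    then show ?thesis using j' k by (intro exI[of _ k]) auto
  qed
  have contG: "isCont (G j) t" for j t using G[of j] by (simp add: continuous_on_eq_continuous_at)
  have "(f \<longlongrightarrow> f t) (at_right t)" if tt: "t \<ge> 0" for t
  proof -
    obtain j where j: "\<tau> j \<le> t" "t < \<tau> (Suc j)" using ex[OF tt] by auto
    have "(G j \<longlongrightarrow> f t) (at_right t)" using contG[where j=j and t=t] f[OF j]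
      by (auto simp: isCont_def intro: tendsto_within_subset)
    moreover have "\<forall>\<^sub>F s in at_right t. G j s = f s"
      using eventually_at_right_real[OF j(2)] by eventually_elim (use f[of j] j in force)
    ultimately show ?thesis by (rule Lim_transform_eventually)
  qed
  moreover have "\<exists>l\<in>E. (f \<longlongrightarrow> l) (at_left t)" if tt: "t > 0" for t
  proof -
    obtain j where j: "\<tau> j < t" "t \<le> \<tau> (Suc j)" using ex'[OF tt] by auto
    have "(G j \<longlongrightarrow> G j t) (at_left t)" using contG[where j=j and t=t]
      by (auto simp: isCont_def intro: tendsto_within_subset)
    moreover have "\<forall>\<^sub>F s in at_left t. G j s = f s"
      using eventually_at_left_real[OF j(1)] by eventually_elim (use f[of j] j in force)
    ultimately have lim: "(f \<longlongrightarrow> G j t) (at_left t)" by (rule Lim_transform_eventually)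
    have "\<forall>\<^sub>F s in at_left t. f s \<in> E"
      using eventually_at_left_real[OF tt] by eventually_elim (auto intro: fE)
    then have "G j t \<in> E" using Lim_in_closed_set[OF E _ _ lim] by auto
    then show ?thesis using lim by blast
  qed
  moreover have "f \<in> {0..} \<rightarrow>\<^sub>E E" using fE ext by (auto simp: PiE_iff)
  ultimately show ?thesis unfolding cadlag_paths_def by blast
qed

section \<open>Laws on a topological space\<close>

lemma space_borel_of_topology [simp]: "space (borel_of_topology T) = topspace T"
  unfolding borel_of_topology_def by (rule space_measure_of) (auto dest: openin_subset)

lemma measurable_borel_of_topologyI:
  assumes "\<And>\<omega>. \<omega> \<in> space M \<Longrightarrow> X \<omega> \<in> topspace T"
    and "\<And>V. openin T V \<Longrightarrow> {\<omega> \<in> space M. X \<omega> \<in> V} \<in> sets M"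
  shows "X \<in> M \<rightarrow>\<^sub>M borel_of_topology T"
  unfolding borel_of_topology_def
proof (rule measurable_measure_of)
  show "{U. openin T U} \<subseteq> Pow (topspace T)" by (auto dest: openin_subset)
  show "X \<in> space M \<rightarrow> topspace T" using assms(1) by auto
  fix y assume "y \<in> {U. openin T U}"
  then show "X -` y \<inter> space M \<in> sets M"
    using assms(2)[of y] by (simp add: vimage_def Int_def conj_commute)
qed

lemma openin_in_borel_of_topology: "openin T U \<Longrightarrow> U \<in> sets (borel_of_topology T)"
  unfolding borel_of_topology_def by (auto dest: openin_subset)

lemma continuous_map_measurable:
  assumes "continuous_map S T g"
  shows "g \<in> borel_of_topology S \<rightarrow>\<^sub>M borel_of_topology T"
proof (rule measurable_borel_of_topologyI)
  fix \<omega> assume "\<omega> \<in> space (borel_of_topology S)"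
  then show "g \<omega> \<in> topspace T" using assms by (auto simp: continuous_map_def)
next
  fix V assume "openin T V"
  then show "{\<omega> \<in> space (borel_of_topology S). g \<omega> \<in> V} \<in> sets (borel_of_topology S)"
    using assms by (auto simp: continuous_map_def intro!: openin_in_borel_of_topology)
qed

lemma continuous_map_borel_measurable:
  fixes f :: "'p \<Rightarrow> real"
  assumes "continuous_map T euclideanreal f"
  shows "f \<in> borel_measurable (borel_of_topology T)"
proof (rule borel_measurableI)
  fix S :: "real set" assume "open S"
  then have "openin T {p \<in> topspace T. f p \<in> S}"
    using assms by (auto simp: continuous_map_def)
  then show "f -` S \<inter> space (borel_of_topology T) \<in> sets (borel_of_topology T)"
    using openin_in_borel_of_topology[of T] by (simp add: vimage_def Int_def conj_commute)
qed

lemma has_law_continuous_map: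
  assumes "has_law S M X \<mu>" "continuous_map S T g"
    and "AE \<omega> in M. Y \<omega> = g (X \<omega>)"
  shows "has_law T M Y (distr \<mu> (borel_of_topology T) g)"
proof -
  obtain X' where X': "X' \<in> M \<rightarrow>\<^sub>M borel_of_topology S" "AE \<omega> in M. X \<omega> = X' \<omega>"
    "\<mu> = distr M (borel_of_topology S) X'"
    using assms(1) unfolding has_law_def by blast
  note g = continuous_map_measurable[OF assms(2)]
  have "AE \<omega> in M. Y \<omega> = (g \<circ> X') \<omega>" using X'(2) assms(3) by eventually_elim simp
  moreover have "g \<circ> X' \<in> M \<rightarrow>\<^sub>M borel_of_topology T" using X'(1) g by (rule measurable_comp)
  moreover have "distr \<mu> (borel_of_topology T) g = distr M (borel_of_topology T) (g \<circ> X')"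
    unfolding X'(3) using distr_distr[OF g X'(1)] .
  ultimately show ?thesis unfolding has_law_def by blast
qed

lemma has_law_sets: "has_law T M X \<mu> \<Longrightarrow> sets \<mu> = sets (borel_of_topology T)"
  unfolding has_law_def by auto

text \<open>The continuous mapping theorem in a form that tolerates null sets; it also exchanges the
  versions with truncated marks for the given processes.\<close>

lemma converges_in_law_continuous_map:
  assumes "converges_in_law S Ms Xs M X" and g: "continuous_map S T g"
    and Ys: "\<And>n. AE \<omega> in Ms n. Ys n \<omega> = g (Xs n \<omega>)" and Y: "AE \<omega> in M. Y \<omega> = g (X \<omega>)"
  shows "converges_in_law T Ms Ys M Y"
proof -
  obtain \<mu>s \<mu> where law: "\<And>n. has_law S (Ms n) (Xs n) (\<mu>s n)" "has_law S M X \<mu>"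
    and conv: "converges_weakly S \<mu>s \<mu>"
    using assms(1) unfolding converges_in_law_def by blast
  have gm: "g \<in> borel_of_topology S \<rightarrow>\<^sub>M borel_of_topology T" by (rule continuous_map_measurable[OF g])
  have "converges_weakly T (\<lambda>n. distr (\<mu>s n) (borel_of_topology T) g) (distr \<mu> (borel_of_topology T) g)"
    unfolding converges_weakly_def
  proof (intro allI impI)
    fix f assume f: "continuous_map T euclideanreal f \<and> bounded (f ` topspace T)"
    have fm: "f \<in> borel_measurable (borel_of_topology T)"
      using f continuous_map_borel_measurable by blast
    have gs: "g ` topspace S \<subseteq> topspace T" using g by (auto simp: continuous_map_def)
    have "continuous_map S euclideanreal (f \<circ> g)" using f g continuous_map_compose by blast
    moreover have "bounded ((f \<circ> g) ` topspace S)"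
      using f gs by (metis bounded_subset image_comp image_mono)
    ultimately have "(\<lambda>n. \<integral>p. (f \<circ> g) p \<partial>\<mu>s n) \<longlonglongrightarrow> (\<integral>p. (f \<circ> g) p \<partial>\<mu>)"
      using conv unfolding converges_weakly_def by blast
    moreover have "(\<integral>p. f p \<partial>distr \<mu>' (borel_of_topology T) g) = (\<integral>p. (f \<circ> g) p \<partial>\<mu>')"
      if "sets \<mu>' = sets (borel_of_topology S)" for \<mu>'
      using that gm fm by (subst integral_distr) (auto cong: measurable_cong_sets simp: comp_def)
    ultimately show "(\<lambda>n. \<integral>p. f p \<partial>distr (\<mu>s n) (borel_of_topology T) g)
        \<longlonglongrightarrow> (\<integral>p. f p \<partial>distr \<mu> (borel_of_topology T) g)"
      using has_law_sets[OF law(1)] has_law_sets[OF law(2)] by simp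
  qed
  moreover have "\<forall>n. has_law T (Ms n) (Ys n) (distr (\<mu>s n) (borel_of_topology T) g)"
    using has_law_continuous_map[OF law(1) g Ys] by blast
  ultimately show ?thesis unfolding converges_in_law_def
    using has_law_continuous_map[OF law(2) g Y]
    by (intro exI[of _ "\<lambda>n. distr (\<mu>s n) (borel_of_topology T) g"] exI conjI)
qed

text \<open>The projection is 1-Lipschitz, so the same time change and the same bound show that
  neighbourhoods are mapped into neighbourhoods.\<close>

lemma continuous_map_skorokhod_fst:
  "continuous_map (skorokhod_topology (E \<times> E')) (skorokhod_topology E) (\<lambda>p. restrict (\<lambda>t. fst (p t)) {0..})"
  (is "continuous_map ?S ?T ?g")
proof -
  have g_cadlag: "?g p \<in> cadlag_paths E" if "p \<in> cadlag_paths (E \<times> E')" for p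
  proof -
    have p: "p \<in> {0..} \<rightarrow>\<^sub>E E \<times> E'" "\<And>t. t \<ge> 0 \<Longrightarrow> (p \<longlongrightarrow> p t) (at_right t)"
      "\<And>t. t > 0 \<Longrightarrow> \<exists>l\<in>E \<times> E'. (p \<longlongrightarrow> l) (at_left t)"
      using that unfolding cadlag_paths_def by auto
    have "(?g p \<longlongrightarrow> ?g p t) (at_right t)" if "t \<ge> 0" for t
    proof -
      have "((\<lambda>s. fst (p s)) \<longlongrightarrow> fst (p t)) (at_right t)" by (intro tendsto_fst p that)
      moreover have "\<forall>\<^sub>F s in at_right t. fst (p s) = ?g p s"
        using eventually_at_right_less[of t] by eventually_elim (use that in auto)
      ultimately show ?thesis using that Lim_transform_eventually by fastforce
    qed
    moreover have "\<exists>l\<in>E. (?g p \<longlongrightarrow> l) (at_left t)" if t: "t > 0" for t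
    proof -
      obtain l where l: "l \<in> E \<times> E'" "(p \<longlongrightarrow> l) (at_left t)" using p(3)[OF t] by blast
      have "((\<lambda>s. fst (p s)) \<longlongrightarrow> fst l) (at_left t)" by (intro tendsto_fst l)
      moreover have "\<forall>\<^sub>F s in at_left t. fst (p s) = ?g p s"
        using eventually_at_left_real[OF t] by eventually_elim auto
      ultimately have "(?g p \<longlongrightarrow> fst l) (at_left t)" by (rule Lim_transform_eventually)
      then show ?thesis using l by auto
    qed
    moreover have "?g p \<in> {0..} \<rightarrow>\<^sub>E E" using p(1) by (auto simp: PiE_iff mem_Times_iff)
    ultimately show ?thesis unfolding cadlag_paths_def by blast
  qed
  have nb: "?g y \<in> skorokhod_nbhd E (?g p) m e" if y: "y \<in> skorokhod_nbhd (E \<times> E') p m e" for y p m e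
  proof -
    obtain \<mu> d where \<mu>: "y \<in> cadlag_paths (E \<times> E')" "time_change \<mu>" "d < e" "\<forall>s\<ge>0. \<bar>\<mu> s - s\<bar> \<le> d"
      "\<forall>s\<in>{0..m}. dist (y (\<mu> s)) (p s) \<le> d"
      using y unfolding skorokhod_nbhd_def by blast
    have "\<forall>s\<in>{0..m}. dist (?g y (\<mu> s)) (?g p s) \<le> d"
      using \<mu>(5) time_change_nonneg[OF \<mu>(2)] by (auto intro: order_trans[OF dist_fst_le])
    then show ?thesis using \<mu>(2-4) g_cadlag[OF \<mu>(1)] unfolding skorokhod_nbhd_def by blast
  qed
  show ?thesis unfolding continuous_map_def
  proof (intro conjI allI impI)
    show "?g \<in> topspace ?S \<rightarrow> topspace ?T" 
      by (rule funcsetI) (simp only: topspace_skorokhod, rule g_cadlag)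
    fix V assume V: "openin ?T V"
    show "openin ?S {p \<in> topspace ?S. ?g p \<in> V}" unfolding openin_skorokhod
    proof (intro conjI ballI)
      fix p assume "p \<in> {p \<in> topspace ?S. ?g p \<in> V}"
      then obtain m e where m: "m > 0" "e > 0" "skorokhod_nbhd E (?g p) m e \<subseteq> V"
        using V unfolding openin_skorokhod by blast
      have "skorokhod_nbhd (E \<times> E') p m e \<subseteq> {p \<in> topspace ?S. ?g p \<in> V}"
      proof
        fix y assume y: "y \<in> skorokhod_nbhd (E \<times> E') p m e"
        then have "y \<in> topspace ?S" by (simp add: skorokhod_nbhd_def)
        moreover have "?g y \<in> V" using m(3) nb[OF y] by (rule subsetD)
        ultimately show "y \<in> {p \<in> topspace ?S. ?g p \<in> V}" by blast
      qed
      then show "\<exists>m>0. \<exists>e>0. skorokhod_nbhd (E \<times> E') p m e \<subseteq> {p \<in> topspace ?S. ?g p \<in> V}"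
        using m by blast
    qed auto
  qed
qed

section \<open>Affine jump dynamics and their discretisation\<close>

locale affine_hawkes =
  fixes c1 c2 \<beta> lam_inf x :: real
  assumes c1: "0 \<le> c1" and c2: "0 \<le> c2" and \<beta>: "0 < \<beta>" and lam_inf: "0 < lam_inf" and x: "0 < x"
begin

text \<open>The exact time-h map of l' = \<beta>(lam_inf - l) + a, a' = - \<beta> a; one step of
  either scheme is a \<open>jump\<close>, if there is one, followed by this map.\<close>

definition flow :: "real \<Rightarrow> real \<times> real \<Rightarrow> real \<times> real" where
  "flow h s = (lam_inf * (1 - exp (- \<beta> * h)) + fst s * exp (- \<beta> * h) + snd s * exp (- \<beta> * h) * h,
     snd s * exp (- \<beta> * h))"

text \<open>The truncation preserves the quadrant for every real mark, so that positivity of the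
  marks is needed only almost surely.\<close>

definition jump :: "real \<Rightarrow> real \<times> real \<Rightarrow> real \<times> real" where
  "jump z s = (fst s + c1 * max 0 z, snd s + c2 * max 0 z)"

text \<open>The solutions of \<open>l' = \<beta>(lam_inf - l) + a\<close>, \<open>a' = - \<beta> a\<close>; a jump with mark \<open>z\<close> at time \<open>s\<close> moves the
  coefficients by \<open>P += (c1 - c2 s) e\<^bsup>\<beta>s\<^esup> z\<close> and \<open>Q += c2 e\<^bsup>\<beta>s\<^esup> z\<close>.\<close>

definition orbit :: "real \<Rightarrow> real \<Rightarrow> real \<Rightarrow> real \<times> real" where
  "orbit P Q t = (lam_inf + exp (- \<beta> * t) * (P + Q * t), exp (- \<beta> * t) * Q)"

text \<open>An antiderivative in t of \<open>fst (orbit P Q t)\<close>; it matters through its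
  increments, the integrated intensities.\<close>

definition cumhaz :: "real \<Rightarrow> real \<Rightarrow> real \<Rightarrow> real" where
  "cumhaz P Q t = lam_inf * t - exp (- \<beta> * t) * (P / \<beta> + Q / \<beta>\<^sup>2 + Q * t / \<beta>)"

definition coefP :: "(nat \<Rightarrow> real) \<Rightarrow> (nat \<Rightarrow> real) \<Rightarrow> nat \<Rightarrow> real" where
  "coefP \<theta> z n = x - lam_inf + (\<Sum>i<n. (c1 - c2 * \<theta> i) * exp (\<beta> * \<theta> i) * z i)"

definition coefQ :: "(nat \<Rightarrow> real) \<Rightarrow> (nat \<Rightarrow> real) \<Rightarrow> nat \<Rightarrow> real" where
  "coefQ \<theta> z n = (\<Sum>i<n. c2 * exp (\<beta> * \<theta> i) * z i)"

text \<open>Continued to all real times, so that pieces with slightly different jump times can be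
  compared beyond their ends.\<close>

definition state :: "(nat \<Rightarrow> real) \<Rightarrow> (nat \<Rightarrow> real) \<Rightarrow> nat \<Rightarrow> real \<Rightarrow> real \<times> real" where
  "state \<theta> z n = orbit (coefP \<theta> z n) (coefQ \<theta> z n)"

lemma flow_orbit: "flow h (orbit P Q t) = orbit P Q (t + h)"
proof -
  have "exp (- \<beta> * (t + h)) = exp (- \<beta> * t) * exp (- \<beta> * h)"
    by (simp add: exp_add[symmetric] algebra_simps)
  then show ?thesis by (simp only: flow_def orbit_def fst_conv snd_conv) (simp add: algebra_simps)
qed

lemma jump_orbit:
  "0 \<le> z \<Longrightarrow> jump z (orbit P Q t) = orbit (P + (c1 - c2 * t) * exp (\<beta> * t) * z) (Q + c2 * exp (\<beta> * t) * z) t"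
  by (simp add: jump_def orbit_def field_simps exp_minus)

lemma coef_Suc:
  "coefP \<theta> z (Suc n) = coefP \<theta> z n + (c1 - c2 * \<theta> n) * exp (\<beta> * \<theta> n) * z n"
  "coefQ \<theta> z (Suc n) = coefQ \<theta> z n + c2 * exp (\<beta> * \<theta> n) * z n"
  by (simp_all add: coefP_def coefQ_def)

lemma jump_state: "0 \<le> z n \<Longrightarrow> jump (z n) (state \<theta> z n (\<theta> n)) = state \<theta> z (Suc n) (\<theta> n)"
  by (simp add: state_def jump_orbit coef_Suc)

lemma coef_cong:
  assumes "\<And>i. i < n \<Longrightarrow> \<theta> i = \<theta>' i" "\<And>i. i < n \<Longrightarrow> z i = z' i"
  shows "coefP \<theta> z n = coefP \<theta>' z' n" "coefQ \<theta> z n = coefQ \<theta>' z' n"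
  unfolding coefP_def coefQ_def using assms by (auto intro!: sum.cong)

lemma state_cong:
  assumes "\<And>i. i < n \<Longrightarrow> \<theta> i = \<theta>' i" "\<And>i. i < n \<Longrightarrow> z i = z' i"
  shows "state \<theta> z n = state \<theta>' z' n"
  unfolding state_def using coef_cong[OF assms] by simp

text \<open>Factoring exp (- \<beta> t) out of the kernel (c1 + c2 u) exp (- \<beta> u) leaves a
  polynomial of degree at most one in t whose coefficients change only at jumps: the Markovian form
  of the Hawkes sum.\<close>

lemma fst_state:
  "fst (state \<theta> z n t) = lam_inf + (x - lam_inf) * exp (- \<beta> * t) +
     (\<Sum>i<n. (c1 + c2 * (t - \<theta> i)) * exp (- \<beta> * (t - \<theta> i)) * z i)"
  and snd_state: "snd (state \<theta> z n t) = (\<Sum>i<n. c2 * exp (- \<beta> * (t - \<theta> i)) * z i)"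
proof -
  have e: "exp (- \<beta> * (t - s)) = exp (- \<beta> * t) * exp (\<beta> * s)" for s
    by (simp add: exp_add[symmetric] algebra_simps)
  show "snd (state \<theta> z n t) = (\<Sum>i<n. c2 * exp (- \<beta> * (t - \<theta> i)) * z i)"
    unfolding e state_def orbit_def coefQ_def sum_distrib_left snd_conv by (simp add: mult_ac)
  have "(\<Sum>i<n. (c1 + c2 * (t - \<theta> i)) * (exp (- \<beta> * t) * exp (\<beta> * \<theta> i)) * z i)
     = exp (- \<beta> * t) * ((\<Sum>i<n. (c1 - c2 * \<theta> i) * exp (\<beta> * \<theta> i) * z i) + (\<Sum>i<n. c2 * exp (\<beta> * \<theta> i) * z i) * t)"
    unfolding sum_distrib_left sum_distrib_right sum.distrib[symmetric]
    by (rule sum.cong) (auto simp: algebra_simps)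
  then show "fst (state \<theta> z n t) = lam_inf + (x - lam_inf) * exp (- \<beta> * t) +
     (\<Sum>i<n. (c1 + c2 * (t - \<theta> i)) * exp (- \<beta> * (t - \<theta> i)) * z i)"
    unfolding e state_def orbit_def coefP_def coefQ_def fst_conv by (simp add: algebra_simps)
qed

text \<open>Without jumps the intensity is a convex combination of x and lam_inf, and jumps only add
  to it. The positive lower bound makes the cumulative hazard strictly increasing.\<close>

lemma state_bounds:
  assumes "0 \<le> t" "\<And>i. i < n \<Longrightarrow> \<theta> i \<le> t" "\<And>i. i < n \<Longrightarrow> 0 \<le> z i"
  shows "min x lam_inf \<le> fst (state \<theta> z n t)" "0 \<le> snd (state \<theta> z n t)"
proof -
  have q: "exp (- \<beta> * t) \<le> 1" using assms(1) \<beta> by simp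
  have "min x lam_inf = min x lam_inf * (1 - exp (- \<beta> * t)) + min x lam_inf * exp (- \<beta> * t)"
    by (simp add: algebra_simps)
  also have "\<dots> \<le> lam_inf * (1 - exp (- \<beta> * t)) + x * exp (- \<beta> * t)"
    using q by (intro add_mono mult_right_mono) auto
  also have "\<dots> = lam_inf + (x - lam_inf) * exp (- \<beta> * t)" by (simp add: algebra_simps)
  finally have 1: "min x lam_inf \<le> lam_inf + (x - lam_inf) * exp (- \<beta> * t)" .
  have "0 \<le> (\<Sum>i<n. (c1 + c2 * (t - \<theta> i)) * exp (- \<beta> * (t - \<theta> i)) * z i)"
    using assms c1 c2 by (intro sum_nonneg mult_nonneg_nonneg add_nonneg_nonneg) auto
  with 1 show "min x lam_inf \<le> fst (state \<theta> z n t)" unfolding fst_state by linarith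
  show "0 \<le> snd (state \<theta> z n t)" unfolding snd_state
    using assms c1 c2 by (intro sum_nonneg mult_nonneg_nonneg) auto
qed

lemma state_pos:
  assumes "0 \<le> t" "\<And>i. i < n \<Longrightarrow> \<theta> i \<le> t" "\<And>i. i < n \<Longrightarrow> 0 \<le> z i"
  shows "0 < fst (state \<theta> z n t)"
  using state_bounds(1)[of t n \<theta> z] assms x lam_inf by fastforce

section \<open>Regularity of the orbits and the error of the discrete hazards\<close>

lemma continuous_orbit: "continuous_on UNIV (orbit P Q)"
  unfolding orbit_def by (intro continuous_intros)

lemma cumhaz_deriv: "(cumhaz P Q has_real_derivative fst (orbit P Q t)) (at t)"
proof -
  have "(cumhaz P Q has_real_derivative
     lam_inf * 1 - (exp (- \<beta> * t) * (- \<beta> * 1) * (P / \<beta> + Q / \<beta>\<^sup>2 + Q * t / \<beta>) + (Q * 1 / \<beta>) * exp (- \<beta> * t))) (at t)"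
    unfolding cumhaz_def using \<beta> by (auto intro!: derivative_eq_intros simp: field_simps power2_eq_square)
  moreover have "lam_inf * 1 - (exp (- \<beta> * t) * (- \<beta> * 1) * (P / \<beta> + Q / \<beta>\<^sup>2 + Q * t / \<beta>) + (Q * 1 / \<beta>) * exp (- \<beta> * t))
     = fst (orbit P Q t)"
    using \<beta> by (simp add: orbit_def field_simps power2_eq_square)
  ultimately show ?thesis by simp
qed

lemma orbit_deriv:
  "((\<lambda>t. fst (orbit P Q t)) has_real_derivative exp (- \<beta> * t) * (Q - \<beta> * (P + Q * t))) (at t)"
  unfolding orbit_def by (auto intro!: derivative_eq_intros simp: algebra_simps)

text \<open>The constant bounds the derivative from \<open>orbit_deriv\<close> on [0, K]; the
  decaying exponential is estimated by 1.\<close>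

lemma orbit_lipschitz:
  assumes "0 \<le> s" "0 \<le> t" "s \<le> K" "t \<le> K" "\<bar>P\<bar> \<le> C" "\<bar>Q\<bar> \<le> C"
  shows "\<bar>fst (orbit P Q t) - fst (orbit P Q s)\<bar> \<le> (C + \<beta> * (C + C * K)) * \<bar>t - s\<bar>"
proof -
  have bound: "\<bar>exp (- \<beta> * u) * (Q - \<beta> * (P + Q * u))\<bar> \<le> C + \<beta> * (C + C * K)" if "0 \<le> u" "u \<le> K" for u
  proof -
    have "\<bar>Q - \<beta> * (P + Q * u)\<bar> \<le> \<bar>Q\<bar> + \<beta> * \<bar>P + Q * u\<bar>"
      using abs_triangle_ineq4[of Q "\<beta> * (P + Q * u)"] \<beta> by (simp add: abs_mult)
    also have "\<dots> \<le> \<bar>Q\<bar> + \<beta> * (\<bar>P\<bar> + \<bar>Q\<bar> * \<bar>u\<bar>)"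
      using abs_triangle_ineq[of P "Q * u"] \<beta>
      by (intro add_left_mono mult_left_mono) (auto simp: abs_mult)
    also have "\<dots> \<le> C + \<beta> * (C + C * K)"
      using assms that \<beta> by (intro add_mono mult_mono) auto
    finally have 1: "\<bar>Q - \<beta> * (P + Q * u)\<bar> \<le> C + \<beta> * (C + C * K)" .
    have "\<bar>exp (- \<beta> * u) * (Q - \<beta> * (P + Q * u))\<bar> \<le> 1 * \<bar>Q - \<beta> * (P + Q * u)\<bar>"
      using that \<beta> unfolding abs_mult by (intro mult_right_mono) auto
    then show ?thesis using 1 by simp
  qed
  have "norm (fst (orbit P Q t) - fst (orbit P Q s)) \<le> (C + \<beta> * (C + C * K)) * norm (t - s)"
  proof (rule field_differentiable_bound[of "{0..K}"])
    show "((\<lambda>t. fst (orbit P Q t)) has_field_derivative exp (- \<beta> * z) * (Q - \<beta> * (P + Q * z)))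
      (at z within {0..K})" for z by (rule has_field_derivative_at_within[OF orbit_deriv])
  qed (use assms bound in auto)
  then show ?thesis by simp
qed

lemma orbit_bound:
  assumes "0 \<le> t" "t \<le> K" "\<bar>P\<bar> \<le> C" "\<bar>Q\<bar> \<le> C"
  shows "\<bar>fst (orbit P Q t)\<bar> \<le> lam_inf + (C + C * K)"
proof -
  have "\<bar>exp (- \<beta> * t) * (P + Q * t)\<bar> \<le> 1 * (\<bar>P\<bar> + \<bar>Q\<bar> * \<bar>t\<bar>)"
    unfolding abs_mult using assms \<beta> abs_triangle_ineq[of P "Q * t"]
    by (intro mult_mono) (auto simp: abs_mult)
  also have "\<dots> \<le> 1 * (C + C * K)" using assms by (intro mult_mono add_mono) auto
  finally have "\<bar>exp (- \<beta> * t) * (P + Q * t)\<bar> \<le> C + C * K" by simp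
  then show ?thesis using lam_inf by (simp add: orbit_def)
qed

text \<open>Two second-order errors add up. Replacing -ln (1 - y) by y costs at most 2 y^2 for |y|
  \<le> 1/2, where y is at most the intensity bound times h; replacing the integrated intensity of a
  step by its left end value costs the Lipschitz constant times h^2.\<close>

lemma hazard_step_error:
  assumes h: "0 < h" and t: "0 \<le> t" "t + h \<le> K" and C: "\<bar>P\<bar> \<le> C" "\<bar>Q\<bar> \<le> C"
    and small: "(lam_inf + (C + C * K)) * h \<le> 1 / 2"
  shows "\<bar>- ln (1 - fst (orbit P Q t) * h) - (cumhaz P Q (t + h) - cumhaz P Q t)\<bar>
     \<le> (2 * (lam_inf + (C + C * K))\<^sup>2 + (C + \<beta> * (C + C * K))) * h\<^sup>2"
proof -
  let ?B = "lam_inf + (C + C * K)" and ?D = "C + \<beta> * (C + C * K)" and ?l = "\<lambda>t. fst (orbit P Q t)"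
  have C0: "0 \<le> C" using C by linarith
  have D0: "0 \<le> ?D" using C0 \<beta> t h by simp
  have l: "\<bar>?l t\<bar> \<le> ?B" using orbit_bound[of t K P C Q] t h C by simp
  then have lh: "\<bar>?l t * h\<bar> \<le> ?B * h" using h by (simp add: abs_mult mult_right_mono)
  then have "\<bar>ln (1 + - (?l t * h)) - - (?l t * h)\<bar> \<le> 2 * (- (?l t * h))\<^sup>2"
    using small by (intro abs_ln_one_plus_x_minus_x_bound) auto
  also have "\<dots> \<le> 2 * (?B * h)\<^sup>2" using power_mono[OF lh, of 2] by simp
  finally have 1: "\<bar>- ln (1 - ?l t * h) - ?l t * h\<bar> \<le> 2 * ?B\<^sup>2 * h\<^sup>2"
    by (simp add: power_mult_distrib abs_if split: if_splits)
  obtain \<xi> where \<xi>: "t < \<xi>" "\<xi> < t + h" "cumhaz P Q (t + h) - cumhaz P Q t = (t + h - t) * ?l \<xi>"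
    using MVT2[of t "t + h" "cumhaz P Q" ?l] cumhaz_deriv h by auto
  have "\<bar>?l \<xi> - ?l t\<bar> \<le> ?D * \<bar>\<xi> - t\<bar>" using orbit_lipschitz[of t \<xi> K P C Q] t h C \<xi> by simp
  also have "\<dots> \<le> ?D * h" using \<xi> D0 by (intro mult_left_mono) auto
  finally have "h * \<bar>?l \<xi> - ?l t\<bar> \<le> h * (?D * h)" using h by (intro mult_left_mono) auto
  then have 2: "\<bar>?l t * h - (cumhaz P Q (t + h) - cumhaz P Q t)\<bar> \<le> ?D * h\<^sup>2"
  proof -
    have "\<bar>?l t * h - (cumhaz P Q (t + h) - cumhaz P Q t)\<bar> = \<bar>h * (?l t - ?l \<xi>)\<bar>"
      using \<xi>(3) by (simp add: algebra_simps)
    also have "\<dots> = h * \<bar>?l \<xi> - ?l t\<bar>" using h by (simp add: abs_mult abs_minus_commute)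
    also have "\<dots> \<le> h * (?D * h)" by fact
    finally show ?thesis by (simp add: power2_eq_square mult_ac)
  qed
  have "\<bar>- ln (1 - ?l t * h) - (cumhaz P Q (t + h) - cumhaz P Q t)\<bar> \<le> 2 * ?B\<^sup>2 * h\<^sup>2 + ?D * h\<^sup>2"
    using 1 2 by linarith
  then show ?thesis by (simp add: algebra_simps)
qed

definition hazard_sum :: "real \<Rightarrow> real \<Rightarrow> real \<Rightarrow> real \<Rightarrow> nat \<Rightarrow> real" where
  "hazard_sum h P Q t m = (\<Sum>j<m. - ln (1 - fst (orbit P Q (t + real j * h)) * h))"

text \<open>The m errors of order h^2 accumulate, and m h \<le> K turns them into one of order
  h.\<close>

lemma hazard_sum_error:
  assumes h: "0 < h" and t: "0 \<le> t" "t + real m * h \<le> K" and C: "\<bar>P\<bar> \<le> C" "\<bar>Q\<bar> \<le> C"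
    and small: "(lam_inf + (C + C * K)) * h \<le> 1 / 2"
  shows "\<bar>hazard_sum h P Q t m - (cumhaz P Q (t + real m * h) - cumhaz P Q t)\<bar>
     \<le> (2 * (lam_inf + (C + C * K))\<^sup>2 + (C + \<beta> * (C + C * K))) * h * K"
proof -
  let ?c = "2 * (lam_inf + (C + C * K))\<^sup>2 + (C + \<beta> * (C + C * K))"
  have C0: "0 \<le> C" using C by linarith
  have K0: "0 \<le> K" using t h mult_nonneg_nonneg[of "real m" h] by linarith
  have c0: "0 \<le> ?c" using C0 K0 \<beta> by simp
  have "\<bar>hazard_sum h P Q t m - (cumhaz P Q (t + real m * h) - cumhaz P Q t)\<bar> \<le> real m * (?c * h\<^sup>2)"
    using t(2)
  proof (induction m)
    case (Suc m)
    have th: "t + real m * h + h \<le> K" using Suc.prems by (simp add: algebra_simps)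
    have 1: "\<bar>- ln (1 - fst (orbit P Q (t + real m * h)) * h) - (cumhaz P Q (t + real m * h + h) - cumhaz P Q (t + real m * h))\<bar> \<le> ?c * h\<^sup>2"
      using hazard_step_error[OF h _ th C small] t(1) h by simp
    have 2: "\<bar>hazard_sum h P Q t m - (cumhaz P Q (t + real m * h) - cumhaz P Q t)\<bar> \<le> real m * (?c * h\<^sup>2)"
      using Suc.IH th h by simp
    have 3: "t + real (Suc m) * h = t + real m * h + h" by (simp add: algebra_simps)
    have 4: "hazard_sum h P Q t (Suc m) = hazard_sum h P Q t m + - ln (1 - fst (orbit P Q (t + real m * h)) * h)"
      by (simp add: hazard_sum_def)
    have 5: "real (Suc m) * (?c * h\<^sup>2) = real m * (?c * h\<^sup>2) + ?c * h\<^sup>2" by (simp add: algebra_simps)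
    show ?case unfolding 3 4 5 using 1 2 by linarith
  qed (simp add: hazard_sum_def)
  also have "\<dots> = ?c * h * (real m * h)" by (simp add: power2_eq_square mult_ac)
  also have "\<dots> \<le> ?c * h * K" using c0 h t by (intro mult_left_mono) auto
  finally show ?thesis .
qed

text \<open>Step m is the one at which the clock e expires. The bounds on the intensity are included
  because the logarithm stands for a hazard only when 0 \<le> l h < 1.\<close>

definition first_passage :: "real \<Rightarrow> real \<Rightarrow> real \<Rightarrow> real \<Rightarrow> real \<Rightarrow> nat \<Rightarrow> bool" where
  "first_passage h P Q t e m \<longleftrightarrow>
     (\<forall>j\<le>m. 0 \<le> fst (orbit P Q (t + real j * h)) \<and> fst (orbit P Q (t + real j * h)) * h < 1) \<and>
     hazard_sum h P Q t m < e \<and> e \<le> hazard_sum h P Q t (Suc m)"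

text \<open>The scheme driven by unit exponential clocks \<open>fst (Y i)\<close> and marks \<open>snd (Y i)\<close>: the clock of the
  next jump decreases by \<open>- ln (1 - l h)\<close> at each step, which is infinite when \<open>l h \<ge> 1\<close>, and a jump occurs
  when it is exhausted.\<close>

primrec clock_scheme :: "real \<Rightarrow> nat \<Rightarrow> real \<times> real \<Rightarrow> (nat \<Rightarrow> real \<times> real) \<Rightarrow> real \<times> real" where
  "clock_scheme h 0 = (\<lambda>s Y. s)"
| "clock_scheme h (Suc k) = (\<lambda>s Y.
     if fst s * h < 1 \<and> - ln (1 - fst s * h) < fst (Y 0)
     then clock_scheme h k (flow h s) (Y(0 := (fst (Y 0) + ln (1 - fst s * h), snd (Y 0))))
     else clock_scheme h k (flow h (jump (snd (Y 0)) s)) (\<lambda>i. Y (Suc i)))"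

section \<open>Deterministic runs of the clock scheme up to its next jump\<close>

lemma hazard_sum_Suc_shift:
  "hazard_sum h P Q t (Suc m) = - ln (1 - fst (orbit P Q t) * h) + hazard_sum h P Q (t + h) m"
  unfolding hazard_sum_def sum.lessThan_Suc_shift by (simp add: algebra_simps)

lemma hazard_nonneg:
  assumes "0 \<le> l" "0 < h" "l * h < 1" shows "0 \<le> - ln (1 - l * (h::real))"
  using assms by (simp add: ln_le_zero_iff)

lemma hazard_sum_mono:
  assumes "m \<le> m'" "0 < h" "\<And>j. j < m' \<Longrightarrow> 0 \<le> fst (orbit P Q (t + real j * h)) \<and> fst (orbit P Q (t + real j * h)) * h < 1"
  shows "hazard_sum h P Q t m \<le> hazard_sum h P Q t m'"
  unfolding hazard_sum_def using assms hazard_nonneg by (intro sum_mono2) auto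

text \<open>\<open>clock_scheme\<close> recurses on its initial state, so the induction peels off
  the first step and restarts the orbit at t + h, the clock having lost one hazard.\<close>

lemma clock_scheme_run:
  assumes "0 < h" "\<And>j. j < m \<Longrightarrow> 0 \<le> fst (orbit P Q (t + real j * h)) \<and> fst (orbit P Q (t + real j * h)) * h < 1"
    and "hazard_sum h P Q t m < fst (Y 0)"
  shows "clock_scheme h (m + k) (orbit P Q t) Y =
     clock_scheme h k (orbit P Q (t + real m * h)) (Y(0 := (fst (Y 0) - hazard_sum h P Q t m, snd (Y 0))))"
  using assms(2,3)
proof (induction m arbitrary: t Y)
  case 0
  then show ?case by (simp add: hazard_sum_def)
next
  case (Suc m)
  let ?\<eta> = "- ln (1 - fst (orbit P Q t) * h)"
  have cond: "0 \<le> fst (orbit P Q (t + h + real j * h)) \<and> fst (orbit P Q (t + h + real j * h)) * h < 1" if "j < m" for j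
    using Suc.prems(1)[of "Suc j"] that by (simp add: algebra_simps)
  have nn: "0 \<le> hazard_sum h P Q (t + h) m"
    using hazard_sum_mono[of 0 m h P Q "t + h"] cond assms(1) by (simp add: hazard_sum_def)
  have lt: "?\<eta> < fst (Y 0)" using Suc.prems(2) nn unfolding hazard_sum_Suc_shift by linarith
  have l1: "fst (orbit P Q t) * h < 1" using Suc.prems(1)[of 0] by simp
  let ?Y = "Y(0 := (fst (Y 0) + ln (1 - fst (orbit P Q t) * h), snd (Y 0)))"
  have "clock_scheme h (Suc m + k) (orbit P Q t) Y = clock_scheme h (m + k) (orbit P Q (t + h)) ?Y"
    using lt l1 by (simp add: flow_orbit)
  also have "\<dots> = clock_scheme h k (orbit P Q (t + h + real m * h)) (?Y(0 := (fst (?Y 0) - hazard_sum h P Q (t + h) m, snd (?Y 0))))"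
  proof (rule Suc.IH[OF cond])
    show "hazard_sum h P Q (t + h) m < fst (?Y 0)" using Suc.prems(2) by (simp add: hazard_sum_Suc_shift)
  qed
  also have "t + h + real m * h = t + real (Suc m) * h" by (simp add: algebra_simps)
  also have "?Y(0 := (fst (?Y 0) - hazard_sum h P Q (t + h) m, snd (?Y 0)))
     = Y(0 := (fst (Y 0) - hazard_sum h P Q t (Suc m), snd (Y 0)))"
    by (rule ext) (simp add: hazard_sum_Suc_shift)
  finally show ?case .
qed

text \<open>After m surviving steps the rest of the clock is at most the next hazard. The jump is
  applied to the state at step m and then transported by \<open>flow\<close>, so it becomes visible
  at step m + 1.\<close>

lemma clock_scheme_jump:
  assumes "0 < h" "first_passage h P Q t (fst (Y 0)) m"
  shows "clock_scheme h (Suc m + k) (orbit P Q t) Y =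
     clock_scheme h k (flow h (jump (snd (Y 0)) (orbit P Q (t + real m * h)))) (\<lambda>i. Y (Suc i))"
proof -
  have "hazard_sum h P Q t (Suc m) = hazard_sum h P Q t m - ln (1 - fst (orbit P Q (t + real m * h)) * h)"
    by (simp add: hazard_sum_def)
  then show ?thesis using clock_scheme_run[of h m P Q t Y "Suc k"] assms by (simp add: first_passage_def)
qed


lemma orbit_uniform:
  assumes "0 < e"
  obtains \<delta> where "0 < \<delta>" "\<And>P' Q' s s'. \<bar>P' - P\<bar> < \<delta> \<Longrightarrow> \<bar>Q' - Q\<bar> < \<delta> \<Longrightarrow> 0 \<le> s \<Longrightarrow> s \<le> K \<Longrightarrow> \<bar>s' - s\<bar> < \<delta>
     \<Longrightarrow> dist (orbit P' Q' s') (orbit P Q s) < e"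
proof -
  let ?S = "{P - 1..P + 1} \<times> {Q - 1..Q + 1} \<times> {- 1..K + 1}"
  let ?f = "\<lambda>(P, Q, t). orbit P Q t"
  have "continuous_on ?S ?f"
    unfolding orbit_def case_prod_beta by (intro continuous_intros)
  moreover have "compact ?S" by (intro compact_Times compact_Icc)
  ultimately have "uniformly_continuous_on ?S ?f" by (rule compact_uniformly_continuous)
  then obtain d where d: "d > 0" "\<And>a b. a \<in> ?S \<Longrightarrow> b \<in> ?S \<Longrightarrow> dist b a < d \<Longrightarrow> dist (?f b) (?f a) < e"
    using assms unfolding uniformly_continuous_on_def by metis
  \<comment> \<open>The cap 1 keeps the perturbed point in the enlarged box; a third of d goes to
    each of the three coordinates.\<close>
  define \<delta> where "\<delta> = min 1 (d / 3)"
  show ?thesis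
  proof (rule that[of \<delta>])
    show "0 < \<delta>" using d by (simp add: \<delta>_def)
    fix P' Q' s s' assume *: "\<bar>P' - P\<bar> < \<delta>" "\<bar>Q' - Q\<bar> < \<delta>" "0 \<le> s" "s \<le> K" "\<bar>s' - s\<bar> < \<delta>"
    have "dist (P', Q', s') (P, Q, s) \<le> dist P' P + dist (Q', s') (Q, s)"
      unfolding dist_prod_def[of "(P', Q', s')"] by (simp add: sqrt_sum_squares_le_sum)
    also have "\<dots> \<le> dist P' P + (dist Q' Q + dist s' s)"
      unfolding dist_prod_def[of "(Q', s')"] by (simp add: sqrt_sum_squares_le_sum)
    also have "\<dots> < d" using * by (simp add: dist_real_def \<delta>_def)
    finally have "dist (P', Q', s') (P, Q, s) < d" .
    moreover have "(P, Q, s) \<in> ?S" "(P', Q', s') \<in> ?S" using * by (auto simp: \<delta>_def)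
    ultimately show "dist (orbit P' Q' s') (orbit P Q s) < e"
      using d(2)[of "(P, Q, s)" "(P', Q', s')"] by simp
  qed
qed

section \<open>Limits of coefficients, cumulative hazards and waiting times\<close>

lemma tendsto_coef:
  assumes "\<And>i. i < n \<Longrightarrow> ((\<lambda>\<iota>. \<theta>' \<iota> i) \<longlongrightarrow> \<theta> i) F" "\<And>i. i < n \<Longrightarrow> ((\<lambda>\<iota>. z' \<iota> i) \<longlongrightarrow> z i) F"
  shows "((\<lambda>\<iota>. coefP (\<theta>' \<iota>) (z' \<iota>) n) \<longlongrightarrow> coefP \<theta> z n) F" "((\<lambda>\<iota>. coefQ (\<theta>' \<iota>) (z' \<iota>) n) \<longlongrightarrow> coefQ \<theta> z n) F"
  unfolding coefP_def coefQ_def using assms by (auto intro!: tendsto_intros)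

lemma tendsto_cumhaz:
  assumes "(P' \<longlongrightarrow> P) F" "(Q' \<longlongrightarrow> Q) F" "(t' \<longlongrightarrow> t) F"
  shows "((\<lambda>\<iota>. cumhaz (P' \<iota>) (Q' \<iota>) (t' \<iota>)) \<longlongrightarrow> cumhaz P Q t) F"
  unfolding cumhaz_def using assms \<beta> by (auto intro!: tendsto_intros)

lemma cumhaz_strict_mono:
  assumes "s < t" "\<And>u. s \<le> u \<Longrightarrow> u \<le> t \<Longrightarrow> 0 < fst (orbit P Q u)"
  shows "cumhaz P Q s < cumhaz P Q t"
proof (rule DERIV_pos_imp_increasing[OF assms(1)])
  fix u assume "s \<le> u" "u \<le> t"
  then show "\<exists>y. (cumhaz P Q has_real_derivative y) (at u) \<and> 0 < y"
    using assms(2) cumhaz_deriv by (intro exI[of _ "fst (orbit P Q u)"] conjI)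
qed

lemma tendsto_grid:
  assumes "\<And>N. 0 < h N" "h \<longlonglongrightarrow> (0::real)" "0 \<le> t"
  shows "(\<lambda>N. real (nat \<lfloor>t / h N\<rfloor>) * h N) \<longlonglongrightarrow> t"
proof (rule tendsto_sandwich[of "\<lambda>N. t - h N" _ _ "\<lambda>N. t"])
  have f: "0 \<le> \<lfloor>t / h N\<rfloor>" for N using assms(1)[of N] assms(3) by simp
  have "t - h N \<le> real (nat \<lfloor>t / h N\<rfloor>) * h N" for N
  proof -
    have "t / h N - 1 \<le> real_of_int \<lfloor>t / h N\<rfloor>" by linarith
    then have "(t / h N - 1) * h N \<le> real (nat \<lfloor>t / h N\<rfloor>) * h N"
      using f assms(1)[of N] by (intro mult_right_mono) (auto intro: less_imp_le)
    then show ?thesis using assms(1)[of N] by (simp add: algebra_simps)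
  qed
  then show "\<forall>\<^sub>F N in sequentially. t - h N \<le> real (nat \<lfloor>t / h N\<rfloor>) * h N" by simp
  have "real (nat \<lfloor>t / h N\<rfloor>) * h N \<le> t" for N
  proof -
    have "real (nat \<lfloor>t / h N\<rfloor>) * h N \<le> t / h N * h N"
      using f assms(1)[of N] by (intro mult_right_mono) (auto intro: less_imp_le)
    then show ?thesis using assms(1)[of N] by simp
  qed
  then show "\<forall>\<^sub>F N in sequentially. real (nat \<lfloor>t / h N\<rfloor>) * h N \<le> t" by simp
  show "(\<lambda>N. t - h N) \<longlonglongrightarrow> t" using tendsto_diff[OF tendsto_const assms(2), of t] by simp
qed simp

text \<open>The sums of the discrete hazards are Riemann sums for the cumulative hazard, up to a uniform error of
  order \<open>h\<close>.\<close>

lemma waiting_time_converges: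
  assumes h: "\<And>N. 0 < h N" "h \<longlonglongrightarrow> 0" and PQ: "P' \<longlonglongrightarrow> P" "Q' \<longlonglongrightarrow> Q"
    and \<sigma>: "(\<lambda>N. real (\<sigma> N) * h N) \<longlonglongrightarrow> \<tau>" and \<tau>: "0 \<le> \<tau>" "\<tau> < \<theta>"
    and e: "0 < e" "cumhaz P Q \<theta> - cumhaz P Q \<tau> = e"
    and pos: "\<And>t. \<tau> \<le> t \<Longrightarrow> 0 < fst (orbit P Q t)"
    and nonneg: "\<forall>\<^sub>F N in sequentially. \<forall>j. 0 \<le> fst (orbit (P' N) (Q' N) (real (\<sigma> N) * h N + real j * h N))"
  obtains m where "(\<lambda>N. real (\<sigma> N + m N) * h N) \<longlonglongrightarrow> \<theta>"
    "\<forall>\<^sub>F N in sequentially. first_passage (h N) (P' N) (Q' N) (real (\<sigma> N) * h N) e (m N)"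
proof -
  define l where "l N j = fst (orbit (P' N) (Q' N) (real (\<sigma> N) * h N + real j * h N))" for N j
  define R where "R N = hazard_sum (h N) (P' N) (Q' N) (real (\<sigma> N) * h N)" for N
  \<comment> \<open>The scheme jumps at the first step whose hazard exhausts the clock;
    \<open>R N (Suc m)\<close> includes the hazard of step m itself.\<close>
  define m where "m N = (LEAST m. e \<le> R N (Suc m))" for N
  \<comment> \<open>The bracketing times stay below \<theta> + 1, so one unit is left for rounding
    to the grid.\<close>
  define K where "K = \<theta> + 2"
  obtain C1 C2 where C1: "\<And>N. \<bar>P' N\<bar> \<le> C1" and C2: "\<And>N. \<bar>Q' N\<bar> \<le> C2"
    using convergent_imp_Bseq[OF convergentI[OF PQ(1)]] convergent_imp_Bseq[OF convergentI[OF PQ(2)]]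
    unfolding Bseq_def by (metis real_norm_def)
  define C where "C = max C1 C2"
  have C: "\<bar>P' N\<bar> \<le> C" "\<bar>Q' N\<bar> \<le> C" for N using C1[of N] C2[of N] by (auto simp: C_def)
  have C0: "0 \<le> C" using C(1)[of 0] by linarith
  define B where "B = lam_inf + (C + C * K)"
  define c where "c = 2 * B\<^sup>2 + (C + \<beta> * (C + C * K))"
  have "(\<lambda>N. B * h N) \<longlonglongrightarrow> B * 0" using h(2) by (intro tendsto_intros)
  then have small: "\<forall>\<^sub>F N in sequentially. B * h N < 1 / 2"
    by (rule order_tendstoD) simp
  have hsmall: "\<forall>\<^sub>F N in sequentially. h N < 1" using h(2) by (rule order_tendstoD) simp
  define k where "k t N = nat \<lfloor>t / h N\<rfloor>" for t N
  have grid: "(\<lambda>N. real (k t N) * h N) \<longlonglongrightarrow> t" if "0 \<le> t" for t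
    unfolding k_def by (rule tendsto_grid[OF h that])
  have late: "\<forall>\<^sub>F N in sequentially. \<sigma> N \<le> k t N" if t: "\<tau> < t" for t
  proof -
    have "\<forall>\<^sub>F N in sequentially. real (\<sigma> N) * h N < (\<tau> + t) / 2"
      using \<sigma> by (rule order_tendstoD) (use t in simp)
    moreover have "\<forall>\<^sub>F N in sequentially. (\<tau> + t) / 2 < real (k t N) * h N"
      using \<tau> t by (intro order_tendstoD(1)[OF grid[of t]]) auto
    ultimately show ?thesis
    proof eventually_elim
      case (elim N)
      then have "real (\<sigma> N) * h N < real (k t N) * h N" by linarith
      then show ?case using h(1)[of N] by simp
    qed
  qed
  have bounded: "\<forall>\<^sub>F N in sequentially. \<forall>j. \<sigma> N + j \<le> k t N \<longrightarrow> 0 \<le> l N j \<and> l N j * h N < 1"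
    if t: "\<tau> < t" "t < \<theta> + 1" for t
  proof -
    have "\<forall>\<^sub>F N in sequentially. real (k t N) * h N < \<theta> + 1"
      using t \<tau> by (intro order_tendstoD(2)[OF grid[of t]]) auto
    with small late[OF t(1)] nonneg show ?thesis
  proof eventually_elim
    case (elim N)
    show ?case
    proof (intro allI impI)
      fix j assume j: "\<sigma> N + j \<le> k t N"
      have "real (\<sigma> N) * h N + real j * h N = real (\<sigma> N + j) * h N" by (simp add: algebra_simps)
      also have "\<dots> \<le> real (k t N) * h N" using j h(1)[of N] by (intro mult_right_mono) auto
      also have "\<dots> \<le> K" using elim t \<tau> by (simp add: K_def)
      finally have "\<bar>l N j\<bar> \<le> B"
        unfolding l_def B_def using C h(1)[of N] by (intro orbit_bound) (auto intro: less_imp_le)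
      then have "l N j * h N \<le> B * h N" using h(1)[of N] by (intro mult_right_mono) auto
      then show "0 \<le> l N j \<and> l N j * h N < 1" using elim by (auto simp: l_def)
    qed
  qed
  qed
  \<comment> \<open>\<open>k t N\<close> is the last grid index up to t; \<open>Suc\<close> includes
    its own hazard, so the sum runs up to the next grid point.\<close>
  have limit: "(\<lambda>N. R N (Suc (k t N - \<sigma> N))) \<longlonglongrightarrow> cumhaz P Q t - cumhaz P Q \<tau>"
    if t: "\<tau> < t" "t < \<theta> + 1" for t
  proof -
    let ?t = "\<lambda>N. real (k t N) * h N + h N"
    have lim: "?t \<longlonglongrightarrow> t" using tendsto_add[OF grid[of t] h(2)] t \<tau> by simp
    have L1: "(\<lambda>N. cumhaz (P' N) (Q' N) (?t N) - cumhaz (P' N) (Q' N) (real (\<sigma> N) * h N))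
        \<longlonglongrightarrow> cumhaz P Q t - cumhaz P Q \<tau>"
      by (intro tendsto_diff tendsto_cumhaz PQ lim \<sigma>)
    have L2: "(\<lambda>N. R N (Suc (k t N - \<sigma> N)) - (cumhaz (P' N) (Q' N) (?t N) - cumhaz (P' N) (Q' N) (real (\<sigma> N) * h N))) \<longlonglongrightarrow> 0"
    proof (rule Lim_null_comparison)
      have "\<forall>\<^sub>F N in sequentially. ?t N < K"
        using lim by (rule order_tendstoD) (use t in \<open>simp add: K_def\<close>)
      then show "\<forall>\<^sub>F N in sequentially. norm (R N (Suc (k t N - \<sigma> N)) -
          (cumhaz (P' N) (Q' N) (?t N) - cumhaz (P' N) (Q' N) (real (\<sigma> N) * h N))) \<le> c * h N * K"
        using small late[OF t(1)]
      proof eventually_elim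
        case (elim N)
        have "real (\<sigma> N) * h N + real (Suc (k t N - \<sigma> N)) * h N = ?t N"
          using elim by (simp add: of_nat_diff algebra_simps)
        then show ?case
          using hazard_sum_error[of "h N" "real (\<sigma> N) * h N" "Suc (k t N - \<sigma> N)" K "P' N" C "Q' N"] h(1)[of N] C elim
          by (simp add: R_def c_def B_def less_imp_le)
      qed
      have "(\<lambda>N. c * h N * K) \<longlonglongrightarrow> c * 0 * K" using h(2) by (intro tendsto_intros)
      then show "(\<lambda>N. c * h N * K) \<longlonglongrightarrow> 0" by simp
    qed
    show ?thesis using tendsto_add[OF L2 L1] by simp
  qed
  \<comment> \<open>The cumulative hazard increases strictly through \<theta>, so its increments at
    t1 and t2 lie strictly on either side of e; for large N the crossing is caught between the two
    grid indices.\<close>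
  have bracket: "\<forall>\<^sub>F N in sequentially. e \<le> R N (Suc (m N)) \<and> R N (m N) < e \<and>
      (\<forall>j\<le>m N. 0 \<le> l N j \<and> l N j * h N < 1) \<and> t1 < real (\<sigma> N + m N) * h N \<and> real (\<sigma> N + m N) * h N \<le> t2"
    if t: "\<tau> < t1" "t1 < \<theta>" "\<theta> < t2" "t2 < \<theta> + 1" for t1 t2
  proof -
    have t12: "t1 < \<theta> + 1" "\<tau> < t2" using t \<tau> by auto
    have "cumhaz P Q t1 < cumhaz P Q \<theta>" "cumhaz P Q \<theta> < cumhaz P Q t2"
      using t pos \<tau> by (auto intro!: cumhaz_strict_mono)
    then have "cumhaz P Q t1 - cumhaz P Q \<tau> < e" "e < cumhaz P Q t2 - cumhaz P Q \<tau>" using e by auto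
    then have "\<forall>\<^sub>F N in sequentially. R N (Suc (k t1 N - \<sigma> N)) < e" "\<forall>\<^sub>F N in sequentially. e < R N (Suc (k t2 N - \<sigma> N))"
      using order_tendstoD(2)[OF limit[OF t(1) t12(1)]] order_tendstoD(1)[OF limit[OF t12(2) t(4)]] by auto
    then show ?thesis using late[OF t(1)] late[OF t12(2)] bounded[OF t12(2) t(4)]
    proof eventually_elim
      case (elim N)
      have "e \<le> R N (Suc (k t2 N - \<sigma> N))" using elim by simp
      then have 1: "e \<le> R N (Suc (m N))" and 2: "m N \<le> k t2 N - \<sigma> N"
        unfolding m_def by (rule LeastI, rule Least_le)
      have 3: "R N (m N) < e"
      proof (cases "m N")
        case 0 then show ?thesis using e by (simp add: R_def hazard_sum_def)
      next
        case (Suc m')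
        then show ?thesis using not_less_Least[of m' "\<lambda>m. e \<le> R N (Suc m)"] m_def[of N] by auto
      qed
      have 4: "0 \<le> l N j \<and> l N j * h N < 1" if "j \<le> m N" for j
        using elim 2 that by simp
      \<comment> \<open>The hazard sums are monotone and still below e at the grid index of t1, so
        the crossing cannot come that early.\<close>
      have "\<not> m N \<le> k t1 N - \<sigma> N"
      proof
        assume *: "m N \<le> k t1 N - \<sigma> N"
        have "k t1 N \<le> k t2 N" unfolding k_def using t h(1)[of N]
          by (intro nat_mono floor_mono divide_right_mono) auto
        then have "0 \<le> l N j \<and> l N j * h N < 1" if "j \<le> k t1 N - \<sigma> N" for j
          using elim that by simp
        then have "R N (Suc (m N)) \<le> R N (Suc (k t1 N - \<sigma> N))"
          unfolding R_def using h(1)[of N] * by (intro hazard_sum_mono) (auto simp: l_def less_Suc_eq_le)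
        then show False using 1 elim by linarith
      qed
      \<comment> \<open>Being past the floor of t1 / h by at least one step gives the strict lower
        bound t1.\<close>
      then have ge: "k t1 N + 1 \<le> \<sigma> N + m N" using elim by linarith
      have "t1 < (real_of_int \<lfloor>t1 / h N\<rfloor> + 1) * h N"
        using h(1)[of N] by (simp add: pos_divide_less_eq[symmetric])
      also have "\<dots> \<le> real (k t1 N + 1) * h N" unfolding k_def using h(1)[of N] t \<tau>
        by (intro mult_right_mono) auto
      also have "\<dots> \<le> real (\<sigma> N + m N) * h N" using ge h(1)[of N] by (intro mult_right_mono) (auto simp del: of_nat_add)
      finally have 5: "t1 < real (\<sigma> N + m N) * h N" .
      have "real (\<sigma> N + m N) * h N \<le> real (k t2 N) * h N"
        using 2 elim h(1)[of N] by (intro mult_right_mono) (auto simp del: of_nat_add)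
      also have "\<dots> = real_of_int \<lfloor>t2 / h N\<rfloor> * h N" unfolding k_def using t \<tau> h(1)[of N] by simp
      also have "\<dots> \<le> t2 / h N * h N" using h(1)[of N] by (intro mult_right_mono) auto
      finally have 6: "real (\<sigma> N + m N) * h N \<le> t2" using h(1)[of N] by simp
      show ?case using 1 3 4 5 6 by blast
    qed
  qed
  show ?thesis
  proof (rule that[of m])
    show "(\<lambda>N. real (\<sigma> N + m N) * h N) \<longlonglongrightarrow> \<theta>"
    proof (rule order_tendstoI)
      fix a assume a: "a < \<theta>"
      \<comment> \<open>The maximum keeps the lower bracket above \<tau>.\<close>
      have "\<tau> < max a ((\<tau> + \<theta>) / 2)" "max a ((\<tau> + \<theta>) / 2) < \<theta>"
        using a \<tau> by (simp_all add: max_def field_simps)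
      from bracket[OF this, of "\<theta> + 1/2"] show "\<forall>\<^sub>F N in sequentially. a < real (\<sigma> N + m N) * h N"
        by (auto elim!: eventually_mono)
    next
      fix a assume a: "\<theta> < a"
      have "\<tau> < (\<tau> + \<theta>) / 2" "(\<tau> + \<theta>) / 2 < \<theta>" "\<theta> < min (\<theta> + 1/2) ((\<theta> + a)/2)" "min (\<theta> + 1/2) ((\<theta> + a)/2) < \<theta> + 1"
        using a \<tau> by (simp_all add: min_def field_simps)
      from bracket[OF this] show "\<forall>\<^sub>F N in sequentially. real (\<sigma> N + m N) * h N < a"
        using a by (auto elim!: eventually_mono)
    qed
    show "\<forall>\<^sub>F N in sequentially. first_passage (h N) (P' N) (Q' N) (real (\<sigma> N) * h N) e (m N)"
      using bracket[of "(\<tau> + \<theta>) / 2" "\<theta> + 1/2"] \<tau> unfolding R_def l_def first_passage_def by (auto elim!: eventually_mono)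
  qed
qed

end

section \<open>Convergence of the discretised paths\<close>

text \<open>Index 0 gives the time origin, so that the interval before the first jump is treated
  like every other.\<close>

primrec prev_jump :: "(nat \<Rightarrow> real) \<Rightarrow> nat \<Rightarrow> real" where
  "prev_jump \<theta> 0 = 0"
| "prev_jump \<theta> (Suc n) = \<theta> n"

text \<open>If \<open>\<kappa> i\<close> is the step at which the \<open>(i+1)\<close>-st jump of a scheme is decided, then \<open>first_step \<kappa> i\<close> is
  the first step at which \<open>i\<close> jumps are visible.\<close>

primrec first_step :: "(nat \<Rightarrow> nat) \<Rightarrow> nat \<Rightarrow> nat" where
  "first_step \<kappa> 0 = 0"
| "first_step \<kappa> (Suc n) = Suc (\<kappa> n)"

definition jump_sequence :: "(nat \<Rightarrow> real) \<Rightarrow> (nat \<Rightarrow> real) \<Rightarrow> bool" where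
  "jump_sequence \<theta> z \<longleftrightarrow> 0 < \<theta> 0 \<and> strict_mono \<theta> \<and> (\<forall>t. finite {i. \<theta> i \<le> t}) \<and> (\<forall>i. 0 \<le> z i)"

definition step_path :: "real \<Rightarrow> (nat \<Rightarrow> 'e) \<Rightarrow> real \<Rightarrow> 'e" where
  "step_path h l = restrict (\<lambda>t. l (nat \<lfloor>t / h\<rfloor>)) {0..}"

lemma prev_jump_less: "0 < \<theta> 0 \<Longrightarrow> strict_mono \<theta> \<Longrightarrow> prev_jump \<theta> n < \<theta> n"
  by (cases n) (auto simp: strict_mono_def)

lemma prev_jump_nonneg: "0 < \<theta> 0 \<Longrightarrow> strict_mono \<theta> \<Longrightarrow> 0 \<le> prev_jump \<theta> n"
proof (cases n)
  case (Suc m)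
  assume "0 < \<theta> 0" "strict_mono \<theta>"
  then show ?thesis using Suc strict_mono_less_eq[of \<theta> 0 m] by simp
qed simp

lemma le_prev_jump: "strict_mono \<theta> \<Longrightarrow> i < n \<Longrightarrow> \<theta> i \<le> prev_jump \<theta> n"
  by (cases n) (auto simp: strict_mono_less_eq)

lemma jump_count:
  assumes "strict_mono \<theta>" "prev_jump \<theta> n \<le> t" "t < \<theta> n"
  shows "{i. \<theta> i \<le> t} = {..<n}"
proof -
  have "\<theta> i \<le> t \<longleftrightarrow> i < n" for i
  proof
    assume "\<theta> i \<le> t"
    then have "\<theta> i < \<theta> n" using assms(3) by simp
    then show "i < n" using assms(1) by (simp add: strict_mono_less)
  next
    assume "i < n"
    then obtain m where m: "n = Suc m" "i \<le> m" by (cases n) auto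
    then have "\<theta> i \<le> \<theta> m" using assms(1) by (simp add: strict_mono_less_eq)
    then show "\<theta> i \<le> t" using assms(2) m by simp
  qed
  then show ?thesis by auto
qed

lemma jump_sequence_unbounded:
  assumes "finite {i. \<theta> i \<le> (t::real)}"
  obtains n :: nat where "t < \<theta> n"
proof -
  have "{i. \<theta> i \<le> t} \<noteq> UNIV" using assms infinite_UNIV_nat by metis
  then obtain n where "\<not> \<theta> n \<le> t" by blast
  then show ?thesis using that[of n] by simp
qed

lemma first_step_less:
  assumes "\<And>i. i < n \<Longrightarrow> first_step \<kappa> i \<le> \<kappa> i" "i < n"
  shows "\<kappa> i < first_step \<kappa> n"
  using assms
proof (induction n)
  case (Suc n)
  show ?case
  proof (cases "i = n")
    case False
    then have "\<kappa> i < first_step \<kappa> n" using Suc by simp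
    also have "\<dots> \<le> \<kappa> n" using Suc.prems(1)[of n] by simp
    finally show ?thesis by simp
  qed simp
qed simp

lemma step_path_cadlag:
  assumes E: "closed E" and h: "0 < h" and l: "\<And>k. l k \<in> E"
  shows "step_path h l \<in> cadlag_paths E"
proof (rule cadlag_paths_pieces[OF E])
  show "\<exists>n. t < real n * h" for t
    using h reals_Archimedean2[of "t / h"] by (auto simp: pos_divide_less_eq)
  show "step_path h l t = l j" if "real j * h \<le> t" "t < real (Suc j) * h" for j t
  proof -
    have "real j \<le> t / h" "t / h < real j + 1" using that h by (simp_all add: field_simps)
    then have "\<lfloor>t / h\<rfloor> = int j" by (intro floor_unique) auto
    moreover have "0 \<le> t" using that(1) h by (meson less_imp_le mult_nonneg_nonneg of_nat_0_le_iff order_trans)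
    ultimately show ?thesis by (simp add: step_path_def)
  qed
qed (auto simp: step_path_def l)

section \<open>Hawkes paths, their clocks, and the clock scheme seen as a perturbed Hawkes
  path\<close>

context affine_hawkes
begin

abbreviation quadrant :: "(real \<times> real) set" where "quadrant \<equiv> {0..} \<times> {0..}"

definition hawkes_path :: "(nat \<Rightarrow> real) \<Rightarrow> (nat \<Rightarrow> real) \<Rightarrow> real \<Rightarrow> real \<times> real" where
  "hawkes_path \<theta> z = restrict (\<lambda>t. state \<theta> z (card {i. \<theta> i \<le> t}) t) {0..}"

text \<open>The S_n of the overview, written with the antiderivative \<open>cumhaz\<close>.\<close>

definition clock :: "(nat \<Rightarrow> real) \<Rightarrow> (nat \<Rightarrow> real) \<Rightarrow> nat \<Rightarrow> real" where
  "clock \<theta> z n = cumhaz (coefP \<theta> z n) (coefQ \<theta> z n) (\<theta> n) - cumhaz (coefP \<theta> z n) (coefQ \<theta> z n) (prev_jump \<theta> n)"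

lemma hawkes_path_eq:
  assumes "strict_mono \<theta>" "prev_jump \<theta> n \<le> t" "t < \<theta> n" "0 \<le> t"
  shows "hawkes_path \<theta> z t = state \<theta> z n t"
  using jump_count[OF assms(1-3)] assms(4) by (simp add: hawkes_path_def)

lemma hawkes_path_cadlag:
  assumes "jump_sequence \<theta> z"
  shows "hawkes_path \<theta> z \<in> cadlag_paths quadrant"
proof (rule cadlag_paths_pieces[of _ "prev_jump \<theta>" _ "state \<theta> z"])
  have \<theta>: "0 < \<theta> 0" "strict_mono \<theta>" "\<And>t. finite {i. \<theta> i \<le> t}" "\<And>i. 0 \<le> z i"
    using assms by (auto simp: jump_sequence_def)
  show "closed quadrant" by (intro closed_Times closed_atLeast)
  show "\<exists>n. t < prev_jump \<theta> n" for t
    using jump_sequence_unbounded[OF \<theta>(3)[of t]] by (metis prev_jump.simps(2))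
  show "hawkes_path \<theta> z t = state \<theta> z j t" if "prev_jump \<theta> j \<le> t" "t < prev_jump \<theta> (Suc j)" for j t
    using hawkes_path_eq[of \<theta> j t z] that \<theta> prev_jump_nonneg[of \<theta> j] by simp
  show "hawkes_path \<theta> z t \<in> quadrant" if "0 \<le> t" for t
  proof -
    obtain n where "t < \<theta> n" using jump_sequence_unbounded[OF \<theta>(3)[of t]] .
    then obtain j where j: "prev_jump \<theta> j \<le> t" "t < \<theta> j" 
      using ex_piece[of "prev_jump \<theta>" t n] \<open>0 \<le> t\<close> by auto
    have "\<theta> i \<le> t" if "i < j" for i using jump_count[OF \<theta>(2) j] that by auto
    then show ?thesis
      using state_bounds[of t j \<theta> z] \<theta>(4) hawkes_path_eq[OF \<theta>(2) j \<open>0 \<le> t\<close>, of z] \<open>0 \<le> t\<close> x lam_inf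
      by (auto simp: mem_Times_iff)
  qed
  show "continuous_on UNIV (state \<theta> z j)" for j unfolding state_def by (rule continuous_orbit)
qed (auto simp: hawkes_path_def)

lemma flow_quadrant: "0 \<le> h \<Longrightarrow> s \<in> quadrant \<Longrightarrow> flow h s \<in> quadrant"
  using \<beta> lam_inf by (auto simp: flow_def mem_Times_iff intro!: add_nonneg_nonneg mult_nonneg_nonneg)

lemma jump_quadrant: "s \<in> quadrant \<Longrightarrow> jump z s \<in> quadrant"
  using c1 c2 by (auto simp: jump_def mem_Times_iff intro!: add_nonneg_nonneg mult_nonneg_nonneg)

lemma clock_scheme_quadrant: "0 \<le> h \<Longrightarrow> s \<in> quadrant \<Longrightarrow> clock_scheme h k s Y \<in> quadrant"
proof (induction k arbitrary: s Y)
  case (Suc k)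
  have "clock_scheme h k (flow h s) Y' \<in> quadrant" "clock_scheme h k (flow h (jump z s)) Y' \<in> quadrant" for Y' z
    using Suc by (auto simp del: mem_Sigma_iff intro!: Suc.IH flow_quadrant jump_quadrant)
  then show ?case by (simp del: mem_Sigma_iff)
qed simp

text \<open>The first clause says that the scheme has followed a Hawkes state with jump times on the
  grid. The second is the restart property that carries the induction: after n jumps the scheme is a
  new one, fed with the clocks from index n on.\<close>

definition embedded :: "real \<Rightarrow> (nat \<Rightarrow> real \<times> real) \<Rightarrow> (nat \<Rightarrow> real) \<Rightarrow> (nat \<Rightarrow> nat) \<Rightarrow> nat \<Rightarrow> bool" where
  "embedded h Y z \<kappa> n \<longleftrightarrow>
     (\<forall>i<n. first_step \<kappa> i \<le> \<kappa> i \<and> (\<forall>k. first_step \<kappa> i \<le> k \<and> k \<le> \<kappa> i \<longrightarrow>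
        clock_scheme h k (x, 0) Y = state (\<lambda>i. real (\<kappa> i) * h) z i (real k * h))) \<and>
     (\<forall>k. clock_scheme h (first_step \<kappa> n + k) (x, 0) Y =
        clock_scheme h k (state (\<lambda>i. real (\<kappa> i) * h) z n (real (first_step \<kappa> n) * h)) (\<lambda>i. Y (n + i)))"

lemma embedded_Suc:
  assumes emb: "embedded h Y z \<kappa> n" and h: "0 < h" and z: "0 \<le> z n" "snd (Y n) = z n"
    and fp: "first_passage h (coefP (\<lambda>i. real (\<kappa> i) * h) z n) (coefQ (\<lambda>i. real (\<kappa> i) * h) z n)
      (real (first_step \<kappa> n) * h) (fst (Y n)) m"
  shows "embedded h Y z (\<kappa>(n := first_step \<kappa> n + m)) (Suc n)"
proof -
  let ?\<kappa> = "\<kappa>(n := first_step \<kappa> n + m)" and ?\<sigma> = "first_step \<kappa> n"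
  let ?\<theta> = "\<lambda>i. real (\<kappa> i) * h" and ?\<theta>' = "\<lambda>i. real (?\<kappa> i) * h" and ?Y = "\<lambda>i. Y (n + i)"
  let ?t = "real ?\<sigma> * h"
  \<comment> \<open>Changing \<kappa> at n affects neither \<open>first_step\<close> nor the states
    up to index n, since these read only earlier entries.\<close>
  have fs: "first_step ?\<kappa> i = first_step \<kappa> i" if "i \<le> n" for i using that by (cases i) auto
  have st: "state ?\<theta>' z i = state ?\<theta> z i" if "i \<le> n" for i using that by (intro state_cong) auto
  have emb': "clock_scheme h (?\<sigma> + k) (x, 0) Y = clock_scheme h k (state ?\<theta> z n ?t) ?Y" for k
    using emb unfolding embedded_def by blast
  have shift: "?t + real k * h = real (?\<sigma> + k) * h" for k by (simp add: algebra_simps)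
  have run: "clock_scheme h (?\<sigma> + k) (x, 0) Y = state ?\<theta> z n (real (?\<sigma> + k) * h)" if k: "k \<le> m" for k
  proof -
    have "hazard_sum h (coefP ?\<theta> z n) (coefQ ?\<theta> z n) ?t k \<le> hazard_sum h (coefP ?\<theta> z n) (coefQ ?\<theta> z n) ?t m"
      using k h fp unfolding first_passage_def by (intro hazard_sum_mono) auto
    then have "hazard_sum h (coefP ?\<theta> z n) (coefQ ?\<theta> z n) ?t k < fst (?Y 0)" using fp by (simp add: first_passage_def)
    then have "clock_scheme h (k + 0) (state ?\<theta> z n ?t) ?Y = state ?\<theta> z n (?t + real k * h)"
      unfolding state_def using k fp h
      by (subst clock_scheme_run) (auto simp: first_passage_def)
    then show ?thesis unfolding shift using emb'[of k] by simp
  qed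
  have "clock_scheme h (first_step ?\<kappa> (Suc n) + k) (x, 0) Y =
    clock_scheme h k (state ?\<theta>' z (Suc n) (real (first_step ?\<kappa> (Suc n)) * h)) (\<lambda>i. Y (Suc n + i))" for k
  proof -
    have "clock_scheme h (first_step ?\<kappa> (Suc n) + k) (x, 0) Y = clock_scheme h (Suc m + k) (state ?\<theta> z n ?t) ?Y"
    proof -
      have "first_step ?\<kappa> (Suc n) + k = ?\<sigma> + (Suc m + k)" by simp
      then show ?thesis by (simp only: emb')
    qed
    also have "\<dots> = clock_scheme h k (flow h (jump (snd (?Y 0)) (state ?\<theta> z n (?t + real m * h)))) (\<lambda>i. ?Y (Suc i))"
      unfolding state_def using fp h by (intro clock_scheme_jump) auto
    also have "jump (snd (?Y 0)) (state ?\<theta> z n (?t + real m * h)) = state ?\<theta>' z (Suc n) (?t + real m * h)"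
      unfolding shift using jump_state[of z n ?\<theta>'] z st[of n] by simp
    also have "flow h (state ?\<theta>' z (Suc n) (?t + real m * h)) = state ?\<theta>' z (Suc n) (real (first_step ?\<kappa> (Suc n)) * h)"
      unfolding state_def flow_orbit by (simp add: algebra_simps)
    finally show ?thesis by simp
  qed
  moreover have "first_step ?\<kappa> i \<le> ?\<kappa> i \<and> (\<forall>k. first_step ?\<kappa> i \<le> k \<and> k \<le> ?\<kappa> i \<longrightarrow>
        clock_scheme h k (x, 0) Y = state ?\<theta>' z i (real k * h))" if i: "i < Suc n" for i
  proof (cases "i = n")
    case True
    have "clock_scheme h k (x, 0) Y = state ?\<theta> z n (real k * h)" if "?\<sigma> \<le> k" "k \<le> ?\<sigma> + m" for k
      using run[of "k - ?\<sigma>"] that by simp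
    then show ?thesis using True fs[of n] st[of n] by auto
  next
    case False
    then have "i < n" using i by simp
    then show ?thesis using emb fs[of i] st[of i] unfolding embedded_def by simp
  qed
  ultimately show ?thesis unfolding embedded_def by blast
qed

text \<open>Induction on the number of jumps: convergence of the first n grid jump times gives
  convergence of the orbit coefficients, and \<open>waiting_time_converges\<close> then yields the
  next time. That \<kappa> depends on n is harmless, as a path neighbourhood involves finitely many
  jumps.\<close>

lemma clock_scheme_embedding:
  assumes h: "\<And>N. 0 < h N" "h \<longlonglongrightarrow> 0" and js: "jump_sequence \<theta> z"
    and Y: "\<And>n. Y n = (clock \<theta> z n, z n)"
  shows "\<exists>\<kappa>. (\<forall>i<n. (\<lambda>N. real (\<kappa> N i) * h N) \<longlonglongrightarrow> \<theta> i) \<and> (\<forall>\<^sub>F N in sequentially. embedded (h N) Y z (\<kappa> N) n)"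
proof (induction n)
  case 0
  have "state \<theta>' z 0 0 = (x, 0)" for \<theta>' by (simp add: state_def orbit_def coefP_def coefQ_def)
  then show ?case by (auto simp: embedded_def)
next
  case (Suc n)
  have \<theta>: "0 < \<theta> 0" "strict_mono \<theta>" "\<And>i. 0 \<le> z i"
    using js by (auto simp: jump_sequence_def)
  obtain \<kappa> where \<kappa>: "\<And>i. i < n \<Longrightarrow> (\<lambda>N. real (\<kappa> N i) * h N) \<longlonglongrightarrow> \<theta> i"
    and emb: "\<forall>\<^sub>F N in sequentially. embedded (h N) Y z (\<kappa> N) n" using Suc.IH by blast
  define \<sigma> where "\<sigma> N = first_step (\<kappa> N) n" for N
  define \<theta>' where "\<theta>' N i = real (\<kappa> N i) * h N" for N i
  have \<sigma>: "(\<lambda>N. real (\<sigma> N) * h N) \<longlonglongrightarrow> prev_jump \<theta> n"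
  proof (cases n)
    case (Suc n')
    \<comment> \<open>A jump decided at a step is visible one step later; the extra h vanishes in
      the limit.\<close>
    have "(\<lambda>N. real (\<kappa> N n') * h N + h N) \<longlonglongrightarrow> \<theta> n' + 0"
      using \<kappa>[of n'] Suc h(2) by (intro tendsto_add) auto
    then show ?thesis by (simp add: Suc \<sigma>_def algebra_simps)
  qed (simp add: \<sigma>_def)
  have PQ: "(\<lambda>N. coefP (\<theta>' N) z n) \<longlonglongrightarrow> coefP \<theta> z n" "(\<lambda>N. coefQ (\<theta>' N) z n) \<longlonglongrightarrow> coefQ \<theta> z n"
    using tendsto_coef[of n \<theta>' \<theta> sequentially "\<lambda>_. z" z] \<kappa> by (auto simp: \<theta>'_def)
  have pos: "0 < fst (orbit (coefP \<theta> z n) (coefQ \<theta> z n) t)" if "prev_jump \<theta> n \<le> t" for t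
  proof -
    show ?thesis
      using state_pos[of t n \<theta> z] \<theta> le_prev_jump[OF \<theta>(2), of _ n] prev_jump_nonneg[of \<theta> n] that unfolding state_def by force
  qed
  have nonneg: "\<forall>\<^sub>F N in sequentially. \<forall>j. 0 \<le> fst (orbit (coefP (\<theta>' N) z n) (coefQ (\<theta>' N) z n) (real (\<sigma> N) * h N + real j * h N))"
    using emb
  proof eventually_elim
    case (elim N)
    show ?case
    proof
      fix j
      have "\<theta>' N i \<le> real (\<sigma> N) * h N" if "i < n" for i
      proof -
        have "\<kappa> N i < \<sigma> N" unfolding \<sigma>_def
          using elim that by (intro first_step_less) (auto simp: embedded_def)
        then show ?thesis unfolding \<theta>'_def using h(1)[of N] by (intro mult_right_mono) auto
      qed
      moreover have "0 \<le> real j * h N" "0 \<le> real (\<sigma> N) * h N" using h(1)[of N] by simp_all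
      ultimately show "0 \<le> fst (orbit (coefP (\<theta>' N) z n) (coefQ (\<theta>' N) z n) (real (\<sigma> N) * h N + real j * h N))"
        using state_pos[of "real (\<sigma> N) * h N + real j * h N" n "\<theta>' N" z] \<theta>(3)
        unfolding state_def by (smt (verit))
    qed
  qed
  have less: "prev_jump \<theta> n < \<theta> n" by (rule prev_jump_less[OF \<theta>(1,2)])
  have e: "0 < fst (Y n)" unfolding Y clock_def
    using cumhaz_strict_mono[OF less, of "coefP \<theta> z n" "coefQ \<theta> z n"] pos by simp
  obtain m where m: "(\<lambda>N. real (\<sigma> N + m N) * h N) \<longlonglongrightarrow> \<theta> n"
    "\<forall>\<^sub>F N in sequentially. first_passage (h N) (coefP (\<theta>' N) z n) (coefQ (\<theta>' N) z n) (real (\<sigma> N) * h N) (fst (Y n)) (m N)"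
    using waiting_time_converges[OF h PQ \<sigma> prev_jump_nonneg[OF \<theta>(1,2)] less e _ pos nonneg]
    by (simp add: Y clock_def) blast
  show ?case
  proof (intro exI[of _ "\<lambda>N. (\<kappa> N)(n := \<sigma> N + m N)"] conjI allI impI)
    fix i assume "i < Suc n"
    then show "(\<lambda>N. real (((\<kappa> N)(n := \<sigma> N + m N)) i) * h N) \<longlonglongrightarrow> \<theta> i"
      using \<kappa>[of i] m(1) by (cases "i = n") auto
  next
    show "\<forall>\<^sub>F N in sequentially. embedded (h N) Y z ((\<kappa> N)(n := \<sigma> N + m N)) (Suc n)"
      using emb m(2)
    proof eventually_elim
      case (elim N)
      then show ?case unfolding \<sigma>_def \<theta>'_def[abs_def]
        by (intro embedded_Suc h) (auto simp: Y \<theta>(3))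
    qed
  qed
qed

text \<open>The filter is arbitrary because the lemma serves twice: for the scheme as N grows, and
  near a given pair (\<theta>, z) for the measurability of the Hawkes path. \<rho> is the time at
  which the state is read, rounded to the grid in the first use and exact in the second.\<close>

lemma hawkes_path_approx:
  assumes js: "jump_sequence \<theta> z" and m: "m < \<theta> n" and e: "0 < e"
    and cadlag: "\<forall>\<^sub>F \<iota> in F. y \<iota> \<in> cadlag_paths quadrant"
    and \<sigma>: "\<And>i. i \<le> Suc n \<Longrightarrow> ((\<lambda>\<iota>. \<sigma> \<iota> i) \<longlongrightarrow> prev_jump \<theta> i) F" "\<And>\<iota>. \<sigma> \<iota> 0 = 0"
    and \<theta>': "\<And>i. i < n \<Longrightarrow> ((\<lambda>\<iota>. \<theta>' \<iota> i) \<longlongrightarrow> \<theta> i) F"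
    and z': "\<And>i. i < n \<Longrightarrow> ((\<lambda>\<iota>. z' \<iota> i) \<longlongrightarrow> z i) F"
    and \<rho>: "\<And>\<delta>. 0 < \<delta> \<Longrightarrow> \<forall>\<^sub>F \<iota> in F. \<forall>t\<ge>0. \<bar>\<rho> \<iota> t - t\<bar> < \<delta>"
    and y: "\<forall>\<^sub>F \<iota> in F. \<forall>j\<le>n. \<forall>t\<ge>0. \<sigma> \<iota> j \<le> t \<and> t < \<sigma> \<iota> (Suc j) \<longrightarrow> y \<iota> t = state (\<theta>' \<iota>) (z' \<iota>) j (\<rho> \<iota> t)"
  shows "\<forall>\<^sub>F \<iota> in F. y \<iota> \<in> skorokhod_nbhd quadrant (hawkes_path \<theta> z) m e"
proof -
  have \<theta>: "0 < \<theta> 0" "strict_mono \<theta>" using js by (auto simp: jump_sequence_def)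
  have "\<exists>\<delta>>0. \<forall>P' Q' s s'. \<bar>P' - coefP \<theta> z j\<bar> < \<delta> \<longrightarrow> \<bar>Q' - coefQ \<theta> z j\<bar> < \<delta> \<longrightarrow> 0 \<le> s \<longrightarrow> s \<le> \<theta> n \<longrightarrow> \<bar>s' - s\<bar> < \<delta>
     \<longrightarrow> dist (orbit P' Q' s') (orbit (coefP \<theta> z j) (coefQ \<theta> z j) s) < e / 2" for j
    using orbit_uniform[of "e / 2" "coefP \<theta> z j" "coefQ \<theta> z j" "\<theta> n"] e by (metis half_gt_zero)
  then obtain \<delta>' where \<delta>'0: "\<And>j. 0 < \<delta>' j" and \<delta>': "\<And>j P' Q' s s'. \<bar>P' - coefP \<theta> z j\<bar> < \<delta>' j \<Longrightarrow> \<bar>Q' - coefQ \<theta> z j\<bar> < \<delta>' j \<Longrightarrow>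
     0 \<le> s \<Longrightarrow> s \<le> \<theta> n \<Longrightarrow> \<bar>s' - s\<bar> < \<delta>' j \<Longrightarrow> dist (orbit P' Q' s') (orbit (coefP \<theta> z j) (coefQ \<theta> z j) s) < e / 2"
    by metis
  define d where "d = Min (\<delta>' ` {..n})"
  have d0: "0 < d" using \<delta>'0 by (simp add: d_def)
  have d: "d \<le> \<delta>' j" if "j \<le> n" for j using that by (simp add: d_def)
  \<comment> \<open>Half of d is reserved for the time change and half for the rounding by
    \<rho>.\<close>
  define \<delta> where "\<delta> = min (d / 2) (e / 2)"
  have \<delta>0: "0 < \<delta>" using d0 e by (simp add: \<delta>_def)
  have "\<forall>\<^sub>F \<iota> in F. \<forall>i\<in>{..Suc n}. \<bar>\<sigma> \<iota> i - prev_jump \<theta> i\<bar> < \<delta>"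
    using \<sigma>(1) \<delta>0 by (intro eventually_ball_finite) (auto simp: tendsto_iff dist_real_def)
  moreover have "\<forall>\<^sub>F \<iota> in F. \<forall>i\<in>{..n}. \<sigma> \<iota> i < \<sigma> \<iota> (Suc i)"
  proof (intro eventually_ball_finite ballI)
    fix i assume i: "i \<in> {..n}"
    have "prev_jump \<theta> i < prev_jump \<theta> (Suc i)" using prev_jump_less[OF \<theta>] by simp
    then obtain c where c: "prev_jump \<theta> i < c" "c < prev_jump \<theta> (Suc i)" using dense by blast
    have "\<forall>\<^sub>F \<iota> in F. \<sigma> \<iota> i < c" "\<forall>\<^sub>F \<iota> in F. c < \<sigma> \<iota> (Suc i)"
      using order_tendstoD(2)[OF \<sigma>(1) c(1)] order_tendstoD(1)[OF \<sigma>(1) c(2)] i by auto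
    then show "\<forall>\<^sub>F \<iota> in F. \<sigma> \<iota> i < \<sigma> \<iota> (Suc i)" by eventually_elim simp
  qed simp
  moreover have "\<forall>\<^sub>F \<iota> in F. \<forall>j\<in>{..n}. \<bar>coefP (\<theta>' \<iota>) (z' \<iota>) j - coefP \<theta> z j\<bar> < d"
    using tendsto_coef(1)[of _ \<theta>' \<theta> F z' z] \<theta>' z' d0
    by (intro eventually_ball_finite) (auto simp: tendsto_iff dist_real_def)
  moreover have "\<forall>\<^sub>F \<iota> in F. \<forall>j\<in>{..n}. \<bar>coefQ (\<theta>' \<iota>) (z' \<iota>) j - coefQ \<theta> z j\<bar> < d"
    using tendsto_coef(2)[of _ \<theta>' \<theta> F z' z] \<theta>' z' d0
    by (intro eventually_ball_finite) (auto simp: tendsto_iff dist_real_def)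
  moreover have "\<forall>\<^sub>F \<iota> in F. \<forall>t\<ge>0. \<bar>\<rho> \<iota> t - t\<bar> < d / 2"
    by (rule \<rho>) (use d0 in simp)
  ultimately show ?thesis using cadlag y
  proof eventually_elim
    case (elim \<iota>)
    show ?case
    proof (rule skorokhod_nbhd_pieces[where \<tau> = "prev_jump \<theta>" and \<sigma> = "\<sigma> \<iota>" and n = n and \<delta> = \<delta> and d = "e / 2"])
      fix j s s' assume *: "j \<le> n" "prev_jump \<theta> j \<le> s" "s < prev_jump \<theta> (Suc j)" "\<sigma> \<iota> j \<le> s'" "s' < \<sigma> \<iota> (Suc j)"
        "0 \<le> s" "0 \<le> s'" "s < prev_jump \<theta> (Suc n)" "\<bar>s' - s\<bar> \<le> \<delta>"
      have "\<bar>\<rho> \<iota> s' - s'\<bar> < d / 2" using elim * by blast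
      moreover have "\<bar>s' - s\<bar> \<le> d / 2" using * by (simp add: \<delta>_def)
      ultimately have "\<bar>\<rho> \<iota> s' - s\<bar> < \<delta>' j" using d[OF *(1)] by linarith
      moreover have "y \<iota> s' = state (\<theta>' \<iota>) (z' \<iota>) j (\<rho> \<iota> s')" using elim * by blast
      moreover have "hawkes_path \<theta> z s = state \<theta> z j s" using * \<theta> by (intro hawkes_path_eq) auto
      moreover have "\<bar>coefP (\<theta>' \<iota>) (z' \<iota>) j - coefP \<theta> z j\<bar> < \<delta>' j" "\<bar>coefQ (\<theta>' \<iota>) (z' \<iota>) j - coefQ \<theta> z j\<bar> < \<delta>' j"
      proof -
        have "\<bar>coefP (\<theta>' \<iota>) (z' \<iota>) j - coefP \<theta> z j\<bar> < d" "\<bar>coefQ (\<theta>' \<iota>) (z' \<iota>) j - coefQ \<theta> z j\<bar> < d"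
          using elim(3,4) *(1) by blast+
        then show "\<bar>coefP (\<theta>' \<iota>) (z' \<iota>) j - coefP \<theta> z j\<bar> < \<delta>' j" "\<bar>coefQ (\<theta>' \<iota>) (z' \<iota>) j - coefQ \<theta> z j\<bar> < \<delta>' j"
          using d[OF *(1)] by linarith+
      qed
      ultimately show "dist (y \<iota> s') (hawkes_path \<theta> z s) \<le> e / 2"
        unfolding state_def using \<delta>'[where j=j and s=s and s'="\<rho> \<iota> s'"] * by (simp add: less_imp_le)
    next
      show "\<delta> \<le> e / 2" by (simp add: \<delta>_def)
      show "prev_jump \<theta> i < prev_jump \<theta> (Suc i)" for i using prev_jump_less[OF \<theta>] by simp
    qed (use elim e m \<sigma>(2) in \<open>auto intro: less_imp_le\<close>)
  qed
qed

lemma clock_scheme_path_converges: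
  assumes h: "\<And>N. 0 < h N" "h \<longlonglongrightarrow> 0" and js: "jump_sequence \<theta> z"
  shows "limitin (skorokhod_topology quadrant)
    (\<lambda>N. step_path (h N) (\<lambda>k. clock_scheme (h N) k (x, 0) (\<lambda>n. (clock \<theta> z n, z n)))) (hawkes_path \<theta> z) sequentially"
proof -
  define Y where "Y n = (clock \<theta> z n, z n)" for n
  define y where "y N = step_path (h N) (\<lambda>k. clock_scheme (h N) k (x, 0) Y)" for N
  have cad: "y N \<in> cadlag_paths quadrant" for N
    unfolding y_def using h(1)[of N] x
    by (intro step_path_cadlag closed_Times closed_atLeast clock_scheme_quadrant) auto
  have near: "\<forall>\<^sub>F N in sequentially. y N \<in> skorokhod_nbhd quadrant (hawkes_path \<theta> z) m e" if e: "0 < e" for m e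
  proof -
    \<comment> \<open>The horizon m lies before jump n, so the pieces 0 to n suffice; the last of
      them ends at index \<open>Suc n\<close>.\<close>
    obtain n where n: "m < \<theta> n" using js jump_sequence_unbounded[of \<theta> m] by (auto simp: jump_sequence_def)
    obtain \<kappa> where \<kappa>: "\<And>i. i < Suc n \<Longrightarrow> (\<lambda>N. real (\<kappa> N i) * h N) \<longlonglongrightarrow> \<theta> i"
      and emb: "\<forall>\<^sub>F N in sequentially. embedded (h N) Y z (\<kappa> N) (Suc n)"
      using clock_scheme_embedding[OF h js Y_def, of "Suc n"] by blast
    show ?thesis
    proof (rule hawkes_path_approx[OF js n e, where \<sigma> = "\<lambda>N i. real (first_step (\<kappa> N) i) * h N"
          and \<theta>' = "\<lambda>N i. real (\<kappa> N i) * h N" and z' = "\<lambda>_. z" and \<rho> = "\<lambda>N t. real (nat \<lfloor>t / h N\<rfloor>) * h N"])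
      show "(\<lambda>N. real (first_step (\<kappa> N) i) * h N) \<longlonglongrightarrow> prev_jump \<theta> i" if "i \<le> Suc n" for i
      proof (cases i)
        case (Suc i')
        have "(\<lambda>N. real (\<kappa> N i') * h N + h N) \<longlonglongrightarrow> \<theta> i' + 0"
          using \<kappa>[of i'] Suc that h(2) by (intro tendsto_add) auto
        then show ?thesis by (simp add: Suc algebra_simps)
      qed simp
      show "\<forall>\<^sub>F N in sequentially. \<forall>t\<ge>0. \<bar>real (nat \<lfloor>t / h N\<rfloor>) * h N - t\<bar> < \<delta>" if "0 < \<delta>" for \<delta>
      proof -
        have "\<forall>\<^sub>F N in sequentially. h N < \<delta>" using h(2) that by (rule order_tendstoD)
        then show ?thesis
        proof eventually_elim
          case (elim N)
          have "\<bar>real (nat \<lfloor>t / h N\<rfloor>) * h N - t\<bar> < \<delta>" if "0 \<le> t" for t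
          proof -
            have "0 \<le> \<lfloor>t / h N\<rfloor>" using that h(1)[of N] by simp
            then have "real (nat \<lfloor>t / h N\<rfloor>) * h N - t = (real_of_int \<lfloor>t / h N\<rfloor> - t / h N) * h N"
              using h(1)[of N] by (simp add: algebra_simps)
            moreover have "\<bar>real_of_int \<lfloor>t / h N\<rfloor> - t / h N\<bar> \<le> 1" by linarith
            ultimately have "\<bar>real (nat \<lfloor>t / h N\<rfloor>) * h N - t\<bar> \<le> 1 * h N"
              using h(1)[of N] by (simp only: abs_mult) (intro mult_mono, auto)
            then show ?thesis using elim by simp
          qed
          then show ?case by blast
        qed
      qed
      show "\<forall>\<^sub>F N in sequentially. \<forall>j\<le>n. \<forall>t\<ge>0. real (first_step (\<kappa> N) j) * h N \<le> t \<and> t < real (first_step (\<kappa> N) (Suc j)) * h N \<longrightarrow>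
          y N t = state (\<lambda>i. real (\<kappa> N i) * h N) z j (real (nat \<lfloor>t / h N\<rfloor>) * h N)"
        using emb
      proof eventually_elim
        case (elim N)
        show ?case
        proof (intro allI impI)
          fix j t assume j: "j \<le> n" and t: "0 \<le> t" "real (first_step (\<kappa> N) j) * h N \<le> t \<and> t < real (first_step (\<kappa> N) (Suc j)) * h N"
          have "real (first_step (\<kappa> N) j) \<le> t / h N" "t / h N < real (first_step (\<kappa> N) (Suc j))"
            using t h(1)[of N] by (simp_all add: pos_le_divide_eq pos_divide_less_eq)
          then have "first_step (\<kappa> N) j \<le> nat \<lfloor>t / h N\<rfloor>" "nat \<lfloor>t / h N\<rfloor> < first_step (\<kappa> N) (Suc j)"
            using le_nat_floor[of "first_step (\<kappa> N) j" "t / h N"] by (auto simp: floor_less_iff nat_less_iff)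
          then show "y N t = state (\<lambda>i. real (\<kappa> N i) * h N) z j (real (nat \<lfloor>t / h N\<rfloor>) * h N)"
            using elim j t(1) unfolding embedded_def y_def step_path_def by (simp add: less_Suc_eq_le)
        qed
      qed
    qed (use \<kappa> cad in auto)
  qed
  have "limitin (skorokhod_topology quadrant) y (hawkes_path \<theta> z) sequentially"
    unfolding limitin_def
  proof (intro conjI allI impI)
    show "hawkes_path \<theta> z \<in> topspace (skorokhod_topology quadrant)" using hawkes_path_cadlag[OF js] by simp
    fix V assume "openin (skorokhod_topology quadrant) V \<and> hawkes_path \<theta> z \<in> V"
    then obtain m e where "0 < e" "skorokhod_nbhd quadrant (hawkes_path \<theta> z) m e \<subseteq> V"
      unfolding openin_skorokhod by blast
    then show "\<forall>\<^sub>F N in sequentially. y N \<in> V" using near[of e m] by (auto elim: eventually_mono)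
  qed
  then show ?thesis unfolding y_def Y_def .
qed

text \<open>This continuous dependence on the jump times and marks is what makes the Hawkes path a random element
  of the Skorokhod space.\<close>

lemma openin_hawkes_path:
  assumes V: "openin (skorokhod_topology quadrant) V"
  shows "\<exists>W. open W \<and> (\<forall>\<theta> z. jump_sequence \<theta> z \<longrightarrow> (hawkes_path \<theta> z \<in> V \<longleftrightarrow> (\<theta>, z) \<in> W))"
proof -
  define S :: "((nat \<Rightarrow> real) \<times> (nat \<Rightarrow> real)) set" where "S = {(\<theta>, z). jump_sequence \<theta> z}"
  have "\<exists>W. open W \<and> p \<in> W \<and> (\<forall>q\<in>W. q \<in> S \<longrightarrow> hawkes_path (fst q) (snd q) \<in> V)"
    if p: "p \<in> S" "hawkes_path (fst p) (snd p) \<in> V" for p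
  proof -
    \<comment> \<open>Restricted to genuine jump sequences, for which the path is known to be
      cadlag.\<close>
    let ?F = "inf (nhds p) (principal S)"
    have js: "jump_sequence (fst p) (snd p)" using p by (auto simp: S_def)
    obtain m e where e: "0 < e" "skorokhod_nbhd quadrant (hawkes_path (fst p) (snd p)) m e \<subseteq> V"
      using V p unfolding openin_skorokhod by blast
    obtain n where n: "m < fst p n" using js jump_sequence_unbounded[of "fst p" m] by (auto simp: jump_sequence_def)
    have c: "continuous_on UNIV (\<lambda>q :: (nat \<Rightarrow> real) \<times> (nat \<Rightarrow> real). fst q i)"
      "continuous_on UNIV (\<lambda>q :: (nat \<Rightarrow> real) \<times> (nat \<Rightarrow> real). snd q i)" for i
      using continuous_on_compose2[OF continuous_on_product_coordinates continuous_on_fst[OF continuous_on_id]]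
        continuous_on_compose2[OF continuous_on_product_coordinates continuous_on_snd[OF continuous_on_id]]
      by auto
    have "((\<lambda>q. fst q i) \<longlongrightarrow> fst p i) (nhds p)" "((\<lambda>q. snd q i) \<longlongrightarrow> snd p i) (nhds p)" for i
      using c[of i] tendsto_at_iff_tendsto_nhds[of "\<lambda>q. fst q i" p] tendsto_at_iff_tendsto_nhds[of "\<lambda>q. snd q i" p]
      unfolding continuous_on_def by blast+
    then have lim: "((\<lambda>q. fst q i) \<longlongrightarrow> fst p i) ?F" "((\<lambda>q. snd q i) \<longlongrightarrow> snd p i) ?F" for i
      by (auto intro: tendsto_mono[OF inf_le1])
    have S: "\<forall>\<^sub>F q in ?F. jump_sequence (fst q) (snd q)"
      by (auto simp: eventually_inf_principal S_def case_prod_beta)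
    have "\<forall>\<^sub>F q in ?F. hawkes_path (fst q) (snd q) \<in> skorokhod_nbhd quadrant (hawkes_path (fst p) (snd p)) m e"
    proof (rule hawkes_path_approx[OF js n e(1), where \<sigma> = "\<lambda>q. prev_jump (fst q)" and \<theta>' = fst and z' = snd and \<rho> = "\<lambda>q t. t"])
      show "\<forall>\<^sub>F q in ?F. hawkes_path (fst q) (snd q) \<in> cadlag_paths quadrant"
        using S by eventually_elim (rule hawkes_path_cadlag)
      show "((\<lambda>q. prev_jump (fst q) i) \<longlongrightarrow> prev_jump (fst p) i) ?F" for i by (cases i) (auto intro: lim)
      show "\<forall>\<^sub>F q in ?F. \<forall>j\<le>n. \<forall>t\<ge>0. prev_jump (fst q) j \<le> t \<and> t < prev_jump (fst q) (Suc j) \<longrightarrow>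
          hawkes_path (fst q) (snd q) t = state (fst q) (snd q) j t"
        using S by eventually_elim (auto intro!: hawkes_path_eq simp: jump_sequence_def)
    qed (auto intro: lim)
    then have "\<forall>\<^sub>F q in ?F. hawkes_path (fst q) (snd q) \<in> V" using e(2) by (auto elim: eventually_mono)
    then show ?thesis unfolding eventually_inf_principal eventually_nhds by blast
  qed
  then obtain W where W: "\<And>p. p \<in> S \<Longrightarrow> hawkes_path (fst p) (snd p) \<in> V \<Longrightarrow> open (W p) \<and> p \<in> W p \<and>
      (\<forall>q\<in>W p. q \<in> S \<longrightarrow> hawkes_path (fst q) (snd q) \<in> V)" by metis
  show ?thesis
  proof (intro exI[of _ "\<Union>p\<in>{p \<in> S. hawkes_path (fst p) (snd p) \<in> V}. W p"] conjI allI impI)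
    show "open (\<Union>p\<in>{p \<in> S. hawkes_path (fst p) (snd p) \<in> V}. W p)" using W by auto
    fix \<theta> z assume "jump_sequence \<theta> z"
    then have "(\<theta>, z) \<in> S" by (simp add: S_def)
    then show "hawkes_path \<theta> z \<in> V \<longleftrightarrow> (\<theta>, z) \<in> (\<Union>p\<in>{p \<in> S. hawkes_path (fst p) (snd p) \<in> V}. W p)"
      using W by fastforce
  qed
qed

end

section \<open>Laws of sequences\<close>

abbreviation seq_space :: "(nat \<Rightarrow> 'a::topological_space) measure" where
  "seq_space \<equiv> \<Pi>\<^sub>M i\<in>UNIV. borel"

abbreviation iid :: "'a measure \<Rightarrow> (nat \<Rightarrow> 'a) measure" where
  "iid P \<equiv> \<Pi>\<^sub>M i\<in>UNIV. P"

text \<open>A cylinder over an arbitrary finite index set is padded with \<open>UNIV\<close> to one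
  over an initial segment, the form that inductions on the number of steps can treat.\<close>

lemma emeasure_cylinder:
  fixes A :: "nat \<Rightarrow> 'c::topological_space set"
  assumes J: "finite J" and A: "\<And>i. i \<in> J \<Longrightarrow> A i \<in> sets borel"
  obtains n C where "\<And>i. C i \<in> sets (borel :: 'c measure)"
    "prod_emb UNIV (\<lambda>_. borel) J (Pi\<^sub>E J A) \<in> sets seq_space"
    "\<And>y. indicator (prod_emb UNIV (\<lambda>_. borel) J (Pi\<^sub>E J A)) y = (\<Prod>i<n. indicator (C i) (y i) :: ennreal)"
proof -
  define C where "C i = (if i \<in> J then A i else UNIV)" for i
  obtain n where n: "J \<subseteq> {..<n}" using finite_nat_iff_bounded J by blast
  let ?B = "prod_emb UNIV (\<lambda>_. borel) J (Pi\<^sub>E J A)"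
  show ?thesis
  proof (rule that)
    show "C i \<in> sets borel" for i using A by (auto simp: C_def)
    show "?B \<in> sets seq_space" using J A by (intro sets_PiM_I) auto
    fix y
    have mem: "y \<in> ?B \<longleftrightarrow> (\<forall>i<n. y i \<in> C i)"
      using n by (auto simp: prod_emb_def C_def PiE_iff)
    show "indicator ?B y = (\<Prod>i<n. indicator (C i) (y i) :: ennreal)"
    proof (cases "y \<in> ?B")
      case True then show ?thesis using mem by simp
    next
      case False
      then obtain i where i: "i < n" "y i \<notin> C i" using mem by auto
      then have "(\<Prod>i<n. indicator (C i) (y i) :: ennreal) = 0" by (intro prod_zero bexI[of _ i]) auto
      then show ?thesis using False by simp
    qed
  qed
qed

text \<open>Finite-dimensional cylinders form an intersection-stable generator of the product
  sigma-algebra, so initial segments determine the law.\<close>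

lemma law_eqI:
  fixes X :: "'a \<Rightarrow> nat \<Rightarrow> 'c::topological_space" and X' :: "'b \<Rightarrow> nat \<Rightarrow> 'c"
  assumes M: "prob_space M" and X: "X \<in> M \<rightarrow>\<^sub>M seq_space" and X': "X' \<in> M' \<rightarrow>\<^sub>M seq_space"
    and eq: "\<And>n C. (\<And>i. C i \<in> sets borel) \<Longrightarrow>
      (\<integral>\<^sup>+\<omega>. (\<Prod>i<n. indicator (C i) (X \<omega> i)) \<partial>M) = (\<integral>\<^sup>+\<omega>. (\<Prod>i<n. indicator (C i) (X' \<omega> i)) \<partial>M')"
  shows "distr M seq_space X = distr M' seq_space X'"
proof (rule measure_eqI_PiM_infinite)
  interpret prob_space M by fact
  interpret D: prob_space "distr M seq_space X" by (rule prob_space_distr[OF X])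
  show "finite_measure (distr M seq_space X)" by (rule D.finite_measure_axioms)
  fix A and J :: "nat set" assume J: "finite J" and A: "\<And>i. i \<in> J \<Longrightarrow> A i \<in> sets (borel :: 'c measure)"
  let ?B = "prod_emb UNIV (\<lambda>_. borel) J (Pi\<^sub>E J A)"
  obtain n C where C: "\<And>i. C i \<in> sets (borel :: 'c measure)" and B: "?B \<in> sets seq_space"
    and ind: "\<And>y. indicator ?B y = (\<Prod>i<n. indicator (C i) (y i) :: ennreal)"
    by (rule emeasure_cylinder[of J A, OF J], erule A, rule that)
  have m: "(\<lambda>y. indicator ?B y :: ennreal) \<in> borel_measurable seq_space" using B by (rule borel_measurable_indicator)
  have "emeasure (distr M seq_space X) ?B = (\<integral>\<^sup>+y. indicator ?B y \<partial>distr M seq_space X)"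
    using B by (intro nn_integral_indicator[symmetric]) simp
  also have "\<dots> = (\<integral>\<^sup>+\<omega>. indicator ?B (X \<omega>) \<partial>M)" using m by (intro nn_integral_distr[OF X]) simp
  also have "\<dots> = (\<integral>\<^sup>+\<omega>. indicator ?B (X' \<omega>) \<partial>M')" unfolding ind by (rule eq[OF C])
  also have "\<dots> = (\<integral>\<^sup>+y. indicator ?B y \<partial>distr M' seq_space X')"
    using m by (intro nn_integral_distr[OF X', symmetric]) simp
  also have "\<dots> = emeasure (distr M' seq_space X') ?B" using B by (intro nn_integral_indicator) simp
  finally show "emeasure (distr M seq_space X) ?B = emeasure (distr M' seq_space X') ?B" .
qed simp_all

text \<open>An iid sequence is its first entry followed by an independent copy of the sequence. This
  is the source of the first-step recursions below.\<close>

lemma nn_integral_iid_split: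
  assumes M: "prob_space M" and f: "f \<in> borel_measurable (iid M)"
  shows "(\<integral>\<^sup>+\<omega>. f \<omega> \<partial>(iid M)) = (\<integral>\<^sup>+a. \<integral>\<^sup>+\<omega>. f (case_nat a \<omega>) \<partial>(iid M) \<partial>M)"
proof -
  interpret prob_space M by fact
  interpret sequence_space M ..
  let ?S = "iid M"
  have m: "(\<lambda>(s, \<omega>). case_nat s \<omega>) \<in> M \<Otimes>\<^sub>M ?S \<rightarrow>\<^sub>M ?S" 
    by measurable
  have "(\<integral>\<^sup>+\<omega>. f \<omega> \<partial>?S) = (\<integral>\<^sup>+\<omega>. f \<omega> \<partial>distr (M \<Otimes>\<^sub>M ?S) ?S (\<lambda>(s, \<omega>). case_nat s \<omega>))"
    unfolding PiM_iter ..
  also have "\<dots> = (\<integral>\<^sup>+p. f (case p of (s, \<omega>) \<Rightarrow> case_nat s \<omega>) \<partial>(M \<Otimes>\<^sub>M ?S))"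
    by (subst nn_integral_distr[OF m]) (simp_all add: f)
  also have "\<dots> = (\<integral>\<^sup>+a. \<integral>\<^sup>+\<omega>. f (case_nat a \<omega>) \<partial>?S \<partial>M)"
    using P.nn_integral_fst[of "\<lambda>p. f (case p of (s, \<omega>) \<Rightarrow> case_nat s \<omega>)" M] measurable_compose[OF m f]
    by simp
  finally show ?thesis .
qed

abbreviation std_exponential :: "real measure" where
  "std_exponential \<equiv> density lborel (exponential_density 1)"

lemma prob_space_std_exponential: "prob_space std_exponential"
  by (rule prob_space_exponential_density) simp

text \<open>Shifting the argument of the density by \<eta> multiplies it by exp (- \<eta>) on the
  positive half-line.\<close>

lemma std_exponential_memoryless:
  assumes \<eta>: "0 \<le> \<eta>" and K[measurable]: "K \<in> borel_measurable borel"
  shows "(\<integral>\<^sup>+e. indicator {\<eta><..} e * K (e - \<eta>) \<partial>std_exponential) = ennreal (exp (- \<eta>)) * (\<integral>\<^sup>+e. K e \<partial>std_exponential)"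
proof -
  have "(\<integral>\<^sup>+e. indicator {\<eta><..} e * K (e - \<eta>) \<partial>std_exponential)
     = (\<integral>\<^sup>+e. ennreal (exponential_density 1 e) * (indicator {\<eta><..} e * K (e - \<eta>)) \<partial>lborel)"
    by (intro nn_integral_density) (auto simp: exponential_density_def)
  also have "\<dots> = (\<integral>\<^sup>+e. ennreal (exponential_density 1 (\<eta> + 1 * e)) * (indicator {\<eta><..} (\<eta> + 1 * e) * K (\<eta> + 1 * e - \<eta>)) \<partial>lborel)"
    by (subst nn_integral_real_affine[where c = 1 and t = \<eta>]) auto
  also have "\<dots> = (\<integral>\<^sup>+e. ennreal (exp (- \<eta>)) * (ennreal (exponential_density 1 e) * K e) \<partial>lborel)"
  proof (intro nn_integral_cong_AE)
    \<comment> \<open>At e = 0 the strict indicator vanishes while the density does not; that point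
      is null.\<close>
    have "AE e in lborel. e \<noteq> (0::real)" by (rule AE_lborel_singleton)
    then show "AE e in lborel. ennreal (exponential_density 1 (\<eta> + 1 * e)) * (indicator {\<eta><..} (\<eta> + 1 * e) * K (\<eta> + 1 * e - \<eta>))
        = ennreal (exp (- \<eta>)) * (ennreal (exponential_density 1 e) * K e)"
    proof eventually_elim
      case (elim e)
      show ?case
      proof (cases "0 < e")
        case True
        then have "exponential_density 1 (\<eta> + 1 * e) = exp (- \<eta>) * exponential_density 1 e"
          using \<eta> by (simp add: exponential_density_def exp_add[symmetric])
        then have "ennreal (exponential_density 1 (\<eta> + 1 * e)) = ennreal (exp (- \<eta>)) * ennreal (exponential_density 1 e)"
          by (simp add: ennreal_mult'')
        then show ?thesis using True by (simp add: mult.assoc)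
      next
        case False
        then show ?thesis using elim by (simp add: exponential_density_def)
      qed
    qed
  qed
  also have "\<dots> = ennreal (exp (- \<eta>)) * (\<integral>\<^sup>+e. ennreal (exponential_density 1 e) * K e \<partial>lborel)"
    by (intro nn_integral_cmult) auto
  also have "(\<integral>\<^sup>+e. ennreal (exponential_density 1 e) * K e \<partial>lborel) = (\<integral>\<^sup>+e. K e \<partial>std_exponential)"
    by (intro nn_integral_density[symmetric]) auto
  finally show ?thesis .
qed

lemma std_exponential_tail:
  assumes "0 \<le> \<eta>" shows "emeasure std_exponential {\<eta><..} = ennreal (exp (- \<eta>))"
proof -
  interpret prob_space std_exponential by (rule prob_space_std_exponential)
  show ?thesis
    using std_exponential_memoryless[OF assms, of "\<lambda>_. 1"] emeasure_space_1 by simp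
qed

section \<open>Equality in law of the two forms of the scheme\<close>

context affine_hawkes
begin

text \<open>Recursion on the initial state with shifted noise lets the first noise pair be
  integrated out. Noise indices start at 0 here and at 1 in the given schemes.\<close>

primrec uniform_scheme :: "real \<Rightarrow> nat \<Rightarrow> real \<times> real \<Rightarrow> (nat \<Rightarrow> real) \<Rightarrow> (nat \<Rightarrow> real) \<Rightarrow> real \<times> real" where
  "uniform_scheme h 0 = (\<lambda>s u z. s)"
| "uniform_scheme h (Suc k) = (\<lambda>s u z.
     uniform_scheme h k (flow h (if u 0 < fst s * h then jump (z 0) s else s)) (\<lambda>i. u (Suc i)) (\<lambda>i. z (Suc i)))"

lemma uniform_scheme_quadrant: "0 \<le> h \<Longrightarrow> s \<in> quadrant \<Longrightarrow> uniform_scheme h k s u z \<in> quadrant"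
proof (induction k arbitrary: s u z)
  case (Suc k)
  then show ?case by (simp del: mem_Sigma_iff add: flow_quadrant jump_quadrant)
qed simp

section \<open>Measurability of the schemes\<close>

lemma measurable_flow [measurable]: "flow h \<in> borel_measurable borel"
  unfolding flow_def by (intro borel_measurable_continuous_onI continuous_intros)

lemma measurable_jump:
  assumes [measurable]: "f \<in> borel_measurable N" "g \<in> borel_measurable N"
  shows "(\<lambda>\<omega>. jump (f \<omega>) (g \<omega>)) \<in> borel_measurable N"
proof -
  have "continuous_on UNIV (\<lambda>p :: real \<times> real \<times> real. jump (fst p) (snd p))"
    unfolding jump_def by (intro continuous_intros)
  then have "(\<lambda>p. jump (fst p) (snd p)) \<in> borel_measurable borel" by (rule borel_measurable_continuous_onI)
  from measurable_compose[OF borel_measurable_Pair[OF assms] this] show ?thesis by simp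
qed

lemma measurable_seq_shift:
  assumes "g \<in> N \<rightarrow>\<^sub>M seq_space"
  shows "(\<lambda>\<omega> i. g \<omega> (Suc i)) \<in> N \<rightarrow>\<^sub>M seq_space"
  by (rule measurable_PiM_single') (auto intro: measurable_compose[OF assms measurable_component_singleton])

lemma measurable_fst_borel: "f \<in> borel_measurable N \<Longrightarrow> (\<lambda>\<omega>. fst (f \<omega> :: real \<times> real)) \<in> borel_measurable N"
  and measurable_snd_borel: "f \<in> borel_measurable N \<Longrightarrow> (\<lambda>\<omega>. snd (f \<omega> :: real \<times> real)) \<in> borel_measurable N"
  by (auto intro!: measurable_compose[of f N borel] borel_measurable_continuous_onI continuous_intros)

lemma measurable_uniform_scheme:
  assumes "f \<in> borel_measurable N" "g \<in> N \<rightarrow>\<^sub>M seq_space" "z \<in> N \<rightarrow>\<^sub>M seq_space"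
  shows "(\<lambda>\<omega>. uniform_scheme h k (f \<omega>) (g \<omega>) (z \<omega>)) \<in> borel_measurable N"
  using assms
proof (induction k arbitrary: f g z)
  case (Suc k)
  note [measurable] = Suc.prems measurable_jump measurable_fst_borel measurable_snd_borel
  have "(\<lambda>\<omega>. flow h (if g \<omega> 0 < fst (f \<omega>) * h then jump (z \<omega> 0) (f \<omega>) else f \<omega>)) \<in> borel_measurable N"
    by measurable
  then show ?case
    using Suc.IH[OF _ measurable_seq_shift[OF Suc.prems(2)] measurable_seq_shift[OF Suc.prems(3)]] by simp
qed simp

lemma measurable_clock_scheme:
  assumes "f \<in> borel_measurable N" "Y \<in> N \<rightarrow>\<^sub>M seq_space"
  shows "(\<lambda>\<omega>. clock_scheme h k (f \<omega>) (Y \<omega>)) \<in> borel_measurable N"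
  using assms
proof (induction k arbitrary: f Y)
  case (Suc k)
  have c[measurable]: "(\<lambda>\<omega>. Y \<omega> i) \<in> borel_measurable N" for i
    using measurable_compose[OF Suc.prems(2) measurable_component_singleton] by simp
  note [measurable] = Suc.prems(1) measurable_jump measurable_fst_borel measurable_snd_borel
  have 1: "(\<lambda>\<omega>. clock_scheme h k (flow h (jump (snd (Y \<omega> 0)) (f \<omega>))) (\<lambda>i. Y \<omega> (Suc i))) \<in> borel_measurable N"
    by (intro Suc.IH measurable_seq_shift Suc.prems) measurable
  have "(\<lambda>\<omega>. ((Y \<omega>)(0 := (fst (Y \<omega> 0) + ln (1 - fst (f \<omega>) * h), snd (Y \<omega> 0)))) i) \<in> borel_measurable N" for i
    by (cases "i = 0") (auto intro!: borel_measurable_Pair)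
  then have "(\<lambda>\<omega>. (Y \<omega>)(0 := (fst (Y \<omega> 0) + ln (1 - fst (f \<omega>) * h), snd (Y \<omega> 0)))) \<in> N \<rightarrow>\<^sub>M seq_space"
    by (intro measurable_PiM_single') auto
  then have 2: "(\<lambda>\<omega>. clock_scheme h k (flow h (f \<omega>)) ((Y \<omega>)(0 := (fst (Y \<omega> 0) + ln (1 - fst (f \<omega>) * h), snd (Y \<omega> 0))))) \<in> borel_measurable N"
    by (intro Suc.IH) measurable
  show ?case using 1 2 by simp
qed simp

end

lemma sets_seq_space_cong:
  assumes "sets \<nu> = sets (borel :: 'c::topological_space measure)"
  shows "sets (iid \<nu>) = sets (seq_space :: (nat \<Rightarrow> 'c) measure)"
  by (intro sets_PiM_cong) (simp_all add: assms)

lemma space_seq_space [simp]: "space seq_space = UNIV"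
  by (simp add: space_PiM)

lemma measurable_seq_cons:
  fixes f :: "'a \<Rightarrow> 'c::topological_space"
  assumes "f \<in> N \<rightarrow>\<^sub>M borel" "Y \<in> N \<rightarrow>\<^sub>M seq_space"
  shows "(\<lambda>\<omega>. case_nat (f \<omega>) (Y \<omega>)) \<in> N \<rightarrow>\<^sub>M seq_space"
proof (rule measurable_PiM_single')
  fix i
  show "(\<lambda>\<omega>. case_nat (f \<omega>) (Y \<omega>) i) \<in> N \<rightarrow>\<^sub>M borel"
    using assms(1) measurable_compose[OF assms(2) measurable_component_singleton] by (cases i) auto
qed simp

abbreviation std_uniform :: "real measure" where
  "std_uniform \<equiv> uniform_measure lborel {0..1}"

lemma prob_space_std_uniform: "prob_space std_uniform"
  by (rule prob_space_uniform_measure) auto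

lemma std_uniform_less:
  assumes "0 \<le> p" shows "emeasure std_uniform {..<p} = ennreal (min 1 p)"
proof -
  have "emeasure std_uniform {..<p} = emeasure lborel ({0..1} \<inter> {..<p})"
    by (simp add: emeasure_uniform_measure divide_ennreal_def)
  also have "\<dots> = ennreal (min 1 p)"
  proof (cases "p \<le> 1")
    case True
    then have "{0..1} \<inter> {..<p} = {0..<p}" by auto
    then show ?thesis using True assms by (simp add: min_absorb2)
  next
    case False
    then have "{0..1} \<inter> {..<p} = {0..1}" by auto
    then show ?thesis using False by (simp add: min_absorb1)
  qed
  finally show ?thesis .
qed

lemma nn_integral_two_values:
  assumes "prob_space M" and A: "A \<in> sets M" "emeasure M A = ennreal p" "0 \<le> p" "p \<le> 1"
  shows "(\<integral>\<^sup>+\<omega>. (if \<omega> \<in> A then a else b) \<partial>M) = ennreal p * a + ennreal (1 - p) * b"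
proof -
  interpret prob_space M by fact
  have "emeasure M (space M - A) = ennreal (1 - p)"
    using A emeasure_compl[OF A(1)] emeasure_space_1 by (simp add: ennreal_minus[symmetric] del: ennreal_minus)
  moreover have "(\<integral>\<^sup>+\<omega>. (if \<omega> \<in> A then a else b) \<partial>M) = (\<integral>\<^sup>+\<omega>. a * indicator A \<omega> + b * indicator (space M - A) \<omega> \<partial>M)"
    by (intro nn_integral_cong) (auto simp: indicator_def)
  moreover have "\<dots> = a * emeasure M A + b * emeasure M (space M - A)"
    using A(1) by (simp add: nn_integral_add nn_integral_cmult_indicator)
  ultimately show ?thesis using A by (simp add: mult.commute)
qed

section \<open>First-step recursions of the two forms of the scheme\<close>

context affine_hawkes
begin

lemma measurable_uniform_cylinder:
  assumes C: "\<And>i. C i \<in> sets borel"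
    and m: "f \<in> borel_measurable N" "u \<in> N \<rightarrow>\<^sub>M seq_space" "z \<in> N \<rightarrow>\<^sub>M seq_space"
  shows "(\<lambda>\<omega>. \<Prod>i<n. indicator (C i) (uniform_scheme h i (f \<omega>) (u \<omega>) (z \<omega>)) :: ennreal) \<in> borel_measurable N"
  by (intro borel_measurable_prod_ennreal measurable_compose[OF measurable_uniform_scheme[OF m] borel_measurable_indicator] C)

lemma measurable_clock_cylinder:
  assumes C: "\<And>i. C i \<in> sets borel"
    and m: "f \<in> borel_measurable N" "Y \<in> N \<rightarrow>\<^sub>M seq_space"
  shows "(\<lambda>\<omega>. \<Prod>i<n. indicator (C i) (clock_scheme h i (f \<omega>) (Y \<omega>)) :: ennreal) \<in> borel_measurable N"
  by (intro borel_measurable_prod_ennreal measurable_compose[OF measurable_clock_scheme[OF m] borel_measurable_indicator] C)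

lemma measurable_uniform_step:
  fixes a :: "'x \<Rightarrow> real"
  assumes [measurable]: "a \<in> borel_measurable N" "\<zeta> \<in> borel_measurable N"
  shows "(\<lambda>\<omega>. flow h (if a \<omega> < c then jump (\<zeta> \<omega>) s else s)) \<in> borel_measurable N"
proof -
  note [measurable] = measurable_jump
  show ?thesis by measurable
qed

text \<open>First-step analysis: the first uniform variable falls below l h with probability min 1
  (l h), which covers states with l h > 1, and the remaining noise is an independent copy that
  drives the scheme from the new state.\<close>

lemma uniform_scheme_integral_Suc:
  fixes C :: "nat \<Rightarrow> (real \<times> real) set"
  assumes \<nu>: "prob_space \<nu>" "sets \<nu> = sets borel" and C: "\<And>i. C i \<in> sets borel"
    and s: "0 \<le> fst s * h"
  defines "J \<equiv> \<lambda>n C s. \<integral>\<^sup>+u. \<integral>\<^sup>+z. (\<Prod>i<n. indicator (C i) (uniform_scheme h i s u z))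
       \<partial>(iid \<nu>) \<partial>(iid std_uniform) :: ennreal"
  shows "J (Suc n) C s = indicator (C 0) s * (ennreal (min 1 (fst s * h)) * (\<integral>\<^sup>+\<zeta>. J n (\<lambda>i. C (Suc i)) (flow h (jump \<zeta> s)) \<partial>\<nu>)
     + ennreal (1 - min 1 (fst s * h)) * J n (\<lambda>i. C (Suc i)) (flow h s))"
proof -
  interpret \<nu>: prob_space \<nu> by fact
  interpret Uni: prob_space std_uniform by (rule prob_space_std_uniform)
  let ?Z = "iid \<nu>" and ?U = "iid std_uniform"
  interpret Z: prob_space ?Z by (rule prob_space_PiM) (rule \<nu>)
  interpret U: prob_space ?U by (rule prob_space_PiM) (rule prob_space_std_uniform)
  interpret UZ: pair_sigma_finite ?U \<nu> ..
  note [measurable_cong] = \<nu>(2)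
  have [measurable_cong]: "sets ?Z = sets seq_space" by (rule sets_seq_space_cong[OF \<nu>(2)])
  have [measurable_cong]: "sets ?U = sets seq_space" by (rule sets_seq_space_cong) simp
  define g where "g s u z = (\<Prod>i<n. indicator (C (Suc i)) (uniform_scheme h i s u z) :: ennreal)" for s u z
  note g = measurable_uniform_cylinder[of "\<lambda>i. C (Suc i)", OF C, where n = n and h = h, folded g_def]
  note meas = g measurable_uniform_step measurable_seq_shift measurable_compose[OF measurable_jump measurable_flow]
  let ?c = "indicator (C 0) s :: ennreal" and ?J = "J n (\<lambda>i. C (Suc i))"
  let ?s = "\<lambda>a \<zeta>. flow h (if a < fst s * h then jump \<zeta> s else s)"
  have J: "?J s' = (\<integral>\<^sup>+u. \<integral>\<^sup>+z. g s' u z \<partial>?Z \<partial>?U)" for s'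
    by (simp add: J_def g_def)
  have "J (Suc n) C s = (\<integral>\<^sup>+u. \<integral>\<^sup>+z. ?c * g (?s (u 0) (z 0)) (\<lambda>i. u (Suc i)) (\<lambda>i. z (Suc i)) \<partial>?Z \<partial>?U)"
    unfolding J_def g_def prod.lessThan_Suc_shift by simp
  also have "\<dots> = (\<integral>\<^sup>+u. \<integral>\<^sup>+\<zeta>. \<integral>\<^sup>+z. ?c * g (?s (u 0) \<zeta>) (\<lambda>i. u (Suc i)) z \<partial>?Z \<partial>\<nu> \<partial>?U)"
  proof (rule nn_integral_cong, goal_cases)
    case (1 u)
    have m: "(\<lambda>z. ?c * g (?s (u 0) (z 0)) (\<lambda>i. u (Suc i)) (\<lambda>i. z (Suc i))) \<in> borel_measurable ?Z"
      by (intro borel_measurable_times_ennreal meas; measurable)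
    show ?case
      using nn_integral_iid_split[OF \<nu>(1) m] unfolding nat.case .
  qed
  also have "\<dots> = (\<integral>\<^sup>+a. \<integral>\<^sup>+u. \<integral>\<^sup>+\<zeta>. \<integral>\<^sup>+z. ?c * g (?s a \<zeta>) u z \<partial>?Z \<partial>\<nu> \<partial>?U \<partial>std_uniform)"
  proof -
    have "(\<lambda>p. ?c * g (?s (fst (fst p) 0) (snd (fst p))) (\<lambda>i. fst (fst p) (Suc i)) (snd p)) \<in> borel_measurable ((?U \<Otimes>\<^sub>M \<nu>) \<Otimes>\<^sub>M ?Z)"
      by (intro borel_measurable_times_ennreal meas; measurable)
    then have "(\<lambda>u. \<integral>\<^sup>+\<zeta>. \<integral>\<^sup>+z. ?c * g (?s (u 0) \<zeta>) (\<lambda>i. u (Suc i)) z \<partial>?Z \<partial>\<nu>) \<in> borel_measurable ?U"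
      by (intro \<nu>.borel_measurable_nn_integral Z.borel_measurable_nn_integral) (simp add: case_prod_beta)
    from nn_integral_iid_split[OF prob_space_std_uniform this] show ?thesis unfolding nat.case .
  qed
  \<comment> \<open>The first mark is moved outside the remaining noise, so that the inner integrals
    become \<open>?J\<close> at the new state.\<close>
  also have "\<dots> = (\<integral>\<^sup>+a. \<integral>\<^sup>+\<zeta>. \<integral>\<^sup>+u. \<integral>\<^sup>+z. ?c * g (?s a \<zeta>) u z \<partial>?Z \<partial>?U \<partial>\<nu> \<partial>std_uniform)"
  proof (rule nn_integral_cong, goal_cases)
    case (1 a)
    have "(\<lambda>p. ?c * g (?s a (snd (fst p))) (fst (fst p)) (snd p)) \<in> borel_measurable ((?U \<Otimes>\<^sub>M \<nu>) \<Otimes>\<^sub>M ?Z)"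
      by (intro borel_measurable_times_ennreal meas; measurable)
    then have "(\<lambda>(u, \<zeta>). \<integral>\<^sup>+z. ?c * g (?s a \<zeta>) u z \<partial>?Z) \<in> borel_measurable (?U \<Otimes>\<^sub>M \<nu>)"
      unfolding case_prod_beta by (intro Z.borel_measurable_nn_integral) (simp add: case_prod_beta)
    from UZ.Fubini'[OF this]
    show ?case by simp
  qed
  also have "\<dots> = (\<integral>\<^sup>+a. \<integral>\<^sup>+\<zeta>. ?c * ?J (?s a \<zeta>) \<partial>\<nu> \<partial>std_uniform)"
  proof (intro nn_integral_cong, goal_cases)
    case (1 a \<zeta>)
    have *: "(\<lambda>p. g (?s a \<zeta>) (fst p) (snd p)) \<in> borel_measurable (?U \<Otimes>\<^sub>M ?Z)"
      by (intro meas; measurable)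
    then have "(\<lambda>u. \<integral>\<^sup>+z. g (?s a \<zeta>) u z \<partial>?Z) \<in> borel_measurable ?U"
      by (intro Z.borel_measurable_nn_integral) (simp add: case_prod_beta)
    moreover have "(\<lambda>z. g (?s a \<zeta>) u z) \<in> borel_measurable ?Z" for u
      by (intro meas; measurable)
    ultimately show ?case
      unfolding J by (simp add: nn_integral_cmult)
  qed
  also have "\<dots> = (\<integral>\<^sup>+a. (if a \<in> {..<fst s * h} then ?c * (\<integral>\<^sup>+\<zeta>. ?J (flow h (jump \<zeta> s)) \<partial>\<nu>)
      else ?c * ?J (flow h s)) \<partial>std_uniform)"
  proof (intro nn_integral_cong, goal_cases)
    case (1 a)
    have "(\<lambda>p. g (flow h (jump (fst (fst p)) s)) (snd (fst p)) (snd p)) \<in> borel_measurable ((\<nu> \<Otimes>\<^sub>M ?U) \<Otimes>\<^sub>M ?Z)"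
      by (intro meas; measurable)
    then have "(\<lambda>\<zeta>. ?J (flow h (jump \<zeta> s))) \<in> borel_measurable \<nu>"
      unfolding J by (intro U.borel_measurable_nn_integral Z.borel_measurable_nn_integral) (simp add: case_prod_beta)
    then show ?case
      by (auto simp: nn_integral_cmult \<nu>.emeasure_space_1)
  qed
  also have "\<dots> = ennreal (min 1 (fst s * h)) * (?c * (\<integral>\<^sup>+\<zeta>. ?J (flow h (jump \<zeta> s)) \<partial>\<nu>))
     + ennreal (1 - min 1 (fst s * h)) * (?c * ?J (flow h s))"
    using s by (intro nn_integral_two_values prob_space_std_uniform) (auto simp: std_uniform_less[OF s])
  finally show ?thesis by (simp add: distrib_left mult_ac)
qed

text \<open>The recursion of \<open>uniform_scheme_integral_Suc\<close> again: if l h < 1, the clock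
  survives a step of hazard -ln (1 - l h) with probability 1 - l h, and what is left of it is a
  fresh exponential clock.\<close>

lemma clock_scheme_integral_Suc:
  fixes C :: "nat \<Rightarrow> (real \<times> real) set"
  assumes \<nu>: "prob_space \<nu>" "sets \<nu> = sets borel" and C: "\<And>i. C i \<in> sets borel"
    and s: "0 \<le> fst s * h"
  defines "K \<equiv> \<lambda>n C s. \<integral>\<^sup>+Y. (\<Prod>i<n. indicator (C i) (clock_scheme h i s Y))
       \<partial>(iid (std_exponential \<Otimes>\<^sub>M \<nu>)) :: ennreal"
  shows "K (Suc n) C s = indicator (C 0) s * (ennreal (min 1 (fst s * h)) * (\<integral>\<^sup>+\<zeta>. K n (\<lambda>i. C (Suc i)) (flow h (jump \<zeta> s)) \<partial>\<nu>)
     + ennreal (1 - min 1 (fst s * h)) * K n (\<lambda>i. C (Suc i)) (flow h s))"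
proof -
  interpret \<nu>: prob_space \<nu> by fact
  interpret Exp: prob_space std_exponential by (rule prob_space_std_exponential)
  interpret P: pair_prob_space std_exponential \<nu> ..
  let ?P = "std_exponential \<Otimes>\<^sub>M \<nu>"
  let ?Y = "iid ?P"
  interpret Y: prob_space ?Y by (rule prob_space_PiM) (rule P.prob_space_axioms)
  note [measurable_cong] = \<nu>(2)
  have P_borel: "sets ?P = sets borel"
    unfolding borel_prod[symmetric] by (rule sets_pair_measure_cong) (simp_all add: \<nu>(2))
  have [measurable_cong]: "sets ?Y = sets seq_space" by (rule sets_seq_space_cong[OF P_borel])
  define g where "g s Y = (\<Prod>i<n. indicator (C (Suc i)) (clock_scheme h i s Y) :: ennreal)" for s Y
  note g = measurable_clock_cylinder[of "\<lambda>i. C (Suc i)", OF C, where n = n and h = h, folded g_def]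
  note meas = g measurable_seq_shift measurable_seq_cons measurable_compose[OF measurable_jump measurable_flow] borel_measurable_Pair
  let ?c = "indicator (C 0) s :: ennreal" and ?C = "\<lambda>i. C (Suc i)"
  have K: "K n ?C s' = (\<integral>\<^sup>+Y. g s' Y \<partial>?Y)" for s' by (simp add: K_def g_def)
  \<comment> \<open>The continuation without a jump as a function of the remaining clock e; the mark
    attached to that clock is averaged out.\<close>
  define Kf where "Kf e = (\<integral>\<^sup>+\<zeta>. \<integral>\<^sup>+Y. g (flow h s) (case_nat (e, \<zeta>) Y) \<partial>?Y \<partial>\<nu>)" for e
  have gm: "(\<lambda>Y. g s' Y) \<in> borel_measurable ?Y" for s'
    by (intro meas; measurable)
  have gm2: "(\<lambda>p. g (flow h s) (case_nat (fst p) (snd p))) \<in> borel_measurable (?P \<Otimes>\<^sub>M ?Y)"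
    by (intro meas measurable_compose[OF measurable_fst] measurable_snd measurable_ident_sets P_borel) (measurable; fail)+
  have gm3: "(\<lambda>p. \<integral>\<^sup>+Y. g (flow h s) (case_nat p Y) \<partial>?Y) \<in> borel_measurable ?P"
    using gm2 by (intro Y.borel_measurable_nn_integral) (simp add: case_prod_beta)
  have Kfm [measurable]: "Kf \<in> borel_measurable borel"
  proof -
    have "(\<lambda>e. \<integral>\<^sup>+\<zeta>. \<integral>\<^sup>+Y. g (flow h s) (case_nat (e, \<zeta>) Y) \<partial>?Y \<partial>\<nu>) \<in> borel_measurable std_exponential"
      using gm3 by (intro \<nu>.borel_measurable_nn_integral) (simp add: case_prod_beta)
    then show ?thesis unfolding Kf_def[abs_def] by simp
  qed
  have Kf: "(\<integral>\<^sup>+e. Kf e \<partial>std_exponential) = K n ?C (flow h s)"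
    unfolding Kf_def K nn_integral_iid_split[OF P.prob_space_axioms gm]
    using \<nu>.nn_integral_fst[OF gm3] by simp
  define A where "A = (\<integral>\<^sup>+\<zeta>. K n ?C (flow h (jump \<zeta> s)) \<partial>\<nu>)"
  have Am: "(\<lambda>p. K n ?C (flow h (jump (snd p) s))) \<in> borel_measurable ?P"
  proof -
    have "(\<lambda>q. g (flow h (jump (snd (fst q)) s)) (snd q)) \<in> borel_measurable (?P \<Otimes>\<^sub>M ?Y)"
      by (intro meas; measurable)
    then show ?thesis unfolding K by (intro Y.borel_measurable_nn_integral) (simp add: case_prod_beta)
  qed
  define go where "go e \<longleftrightarrow> fst s * h < 1 \<and> - ln (1 - fst s * h) < e" for e
  let ?\<eta> = "- ln (1 - fst s * h)"
  let ?G = "\<lambda>p Y. if go (fst p) then g (flow h s) (case_nat (fst p - ?\<eta>, snd p) Y) else g (flow h (jump (snd p) s)) Y"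
  let ?I = "\<lambda>p. if go (fst p) then \<integral>\<^sup>+Y. g (flow h s) (case_nat (fst p - ?\<eta>, snd p) Y) \<partial>?Y
      else K n ?C (flow h (jump (snd p) s))"
  have rec: "(\<Prod>i<Suc n. indicator (C i) (clock_scheme h i s (case_nat p Y)) :: ennreal) =
      ?c * ?G p Y" for p Y
  proof -
    have "(case_nat p Y)(0 := (fst p + ln (1 - fst s * h), snd p)) = case_nat (fst p - ?\<eta>, snd p) Y"
      by (rule ext) (simp split: nat.split)
    then have "clock_scheme h (Suc i) s (case_nat p Y) = (if go (fst p) then clock_scheme h i (flow h s) (case_nat (fst p - ?\<eta>, snd p) Y)
        else clock_scheme h i (flow h (jump (snd p) s)) Y)" for i
      unfolding clock_scheme.simps nat.case go_def by simp
    then show ?thesis unfolding prod.lessThan_Suc_shift by (simp add: g_def del: clock_scheme.simps(2))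
  qed
  have "K (Suc n) C s = (\<integral>\<^sup>+p. \<integral>\<^sup>+Y. ?c * ?G p Y \<partial>?Y \<partial>?P)"
  proof -
    have "(\<lambda>Y. \<Prod>i<Suc n. indicator (C i) (clock_scheme h i s Y) :: ennreal) \<in> borel_measurable ?Y"
      by (intro measurable_clock_cylinder C; measurable)
    then show ?thesis unfolding K_def nn_integral_iid_split[OF P.prob_space_axioms] rec
      by (subst nn_integral_iid_split[OF P.prob_space_axioms]) (simp_all only: rec)
  qed
  also have "\<dots> = (\<integral>\<^sup>+p. ?c * ?I p \<partial>?P)"
  proof (rule nn_integral_cong, goal_cases)
    case (1 p)
    have "(\<lambda>Y. g (flow h s) (case_nat (fst p - ?\<eta>, snd p) Y)) \<in> borel_measurable ?Y"
      by (intro meas; measurable)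
    then show ?case
      using gm by (simp add: K nn_integral_cmult)
  qed
  also have "\<dots> = (\<integral>\<^sup>+e. ?c * (if go e then Kf (e - ?\<eta>) else A) \<partial>std_exponential)"
  proof -
    have [measurable]: "Measurable.pred borel go" unfolding go_def[abs_def] by measurable
    have m1: "(\<lambda>p. \<integral>\<^sup>+Y. g (flow h s) (case_nat (fst p - ?\<eta>, snd p) Y) \<partial>?Y) \<in> borel_measurable ?P"
    proof -
      have "(\<lambda>q. g (flow h s) (case_nat (fst (fst q) - ?\<eta>, snd (fst q)) (snd q))) \<in> borel_measurable (?P \<Otimes>\<^sub>M ?Y)"
        by (intro meas; measurable)
      then show ?thesis by (intro Y.borel_measurable_nn_integral) (simp add: case_prod_beta)
    qed
    have "(\<lambda>p. ?c * ?I p) \<in> borel_measurable ?P"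
      using m1 Am by measurable
    note fst = \<nu>.nn_integral_fst[OF this, symmetric]
    show ?thesis unfolding fst
    proof (rule nn_integral_cong, goal_cases)
      case (1 e)
      have "(\<lambda>\<zeta>. \<integral>\<^sup>+Y. g (flow h s) (case_nat (e - ?\<eta>, \<zeta>) Y) \<partial>?Y) \<in> borel_measurable \<nu>"
        using measurable_compose[OF measurable_Pair1'[of e std_exponential \<nu>] m1] by simp
      moreover have "(\<lambda>\<zeta>. K n ?C (flow h (jump \<zeta> s))) \<in> borel_measurable \<nu>"
        using measurable_compose[OF measurable_Pair1'[of e std_exponential \<nu>] Am] by simp
      ultimately show ?case
        by (simp add: Kf_def A_def nn_integral_cmult)
    qed
  qed
  also have "\<dots> = ?c * (ennreal (min 1 (fst s * h)) * A + ennreal (1 - min 1 (fst s * h)) * K n ?C (flow h s))"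
  proof (cases "fst s * h < 1")
    case True
    have \<eta>: "0 \<le> ?\<eta>" using True s by (simp add: ln_le_zero_iff)
    have ex: "exp (- ?\<eta>) = 1 - fst s * h" using True by simp
    have tail: "emeasure std_exponential {?\<eta><..} = ennreal (1 - fst s * h)"
      using std_exponential_tail[OF \<eta>] unfolding ex .
    have "(\<integral>\<^sup>+e. (if go e then Kf (e - ?\<eta>) else A) \<partial>std_exponential) =
       (\<integral>\<^sup>+e. indicator {?\<eta><..} e * Kf (e - ?\<eta>) + (if e \<in> {?\<eta><..} then 0 else A) \<partial>std_exponential)"
      using True by (intro nn_integral_cong) (auto simp: go_def)
    also have "\<dots> = (\<integral>\<^sup>+e. indicator {?\<eta><..} e * Kf (e - ?\<eta>) \<partial>std_exponential) + (\<integral>\<^sup>+e. (if e \<in> {?\<eta><..} then 0 else A) \<partial>std_exponential)"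
      by (intro nn_integral_add) measurable
    also have "(\<integral>\<^sup>+e. indicator {?\<eta><..} e * Kf (e - ?\<eta>) \<partial>std_exponential) = ennreal (1 - fst s * h) * K n ?C (flow h s)"
      using std_exponential_memoryless[OF \<eta> Kfm] unfolding ex Kf .
    also have "(\<integral>\<^sup>+e. (if e \<in> {?\<eta><..} then 0 else A) \<partial>std_exponential) = ennreal (fst s * h) * A"
      using nn_integral_two_values[OF prob_space_std_exponential _ tail, of 0 A] True s by simp
    finally have 1: "(\<integral>\<^sup>+e. (if go e then Kf (e - ?\<eta>) else A) \<partial>std_exponential)
      = ennreal (1 - fst s * h) * K n ?C (flow h s) + ennreal (fst s * h) * A" .
    have [measurable]: "Measurable.pred borel go" unfolding go_def[abs_def] by measurable
    have "(\<integral>\<^sup>+e. ?c * (if go e then Kf (e - ?\<eta>) else A) \<partial>std_exponential)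
       = ?c * (\<integral>\<^sup>+e. (if go e then Kf (e - ?\<eta>) else A) \<partial>std_exponential)"
      by (intro nn_integral_cmult) measurable
    then show ?thesis unfolding 1 using True by (simp add: min_absorb2 add.commute)
  next
    \<comment> \<open>Here l h \<ge> 1: no clock survives the step, and min 1 (l h) = 1.\<close>
    case False
    then show ?thesis using Exp.emeasure_space_1 by (simp add: go_def min_absorb1)
  qed
  finally show ?thesis unfolding A_def .
qed

text \<open>Both integrals obey the same recursion and agree for n = 0; invariance of the quadrant
  keeps l h \<ge> 0 along the way.\<close>

lemma uniform_clock_scheme_integral:
  fixes C :: "nat \<Rightarrow> (real \<times> real) set"
  assumes \<nu>: "prob_space \<nu>" "sets \<nu> = sets borel" and h: "0 < h" and C: "\<And>i. C i \<in> sets borel" and s: "s \<in> quadrant"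
  shows "(\<integral>\<^sup>+u. \<integral>\<^sup>+z. (\<Prod>i<n. indicator (C i) (uniform_scheme h i s u z))
       \<partial>(iid \<nu>) \<partial>(iid std_uniform))
     = (\<integral>\<^sup>+Y. (\<Prod>i<n. indicator (C i) (clock_scheme h i s Y)) \<partial>(iid (std_exponential \<Otimes>\<^sub>M \<nu>)) :: ennreal)"
  using C s
proof (induction n arbitrary: C s)
  case 0
  interpret \<nu>: prob_space \<nu> by fact
  interpret Exp: prob_space std_exponential by (rule prob_space_std_exponential)
  interpret P: pair_prob_space std_exponential \<nu> ..
  interpret Y: prob_space "iid (std_exponential \<Otimes>\<^sub>M \<nu>)" by (rule prob_space_PiM) (rule P.prob_space_axioms)
  interpret Z: prob_space "iid \<nu>" by (rule prob_space_PiM) (rule \<nu>)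
  interpret U: prob_space "iid std_uniform" by (rule prob_space_PiM) (rule prob_space_std_uniform)
  show ?case using Y.emeasure_space_1 Z.emeasure_space_1 U.emeasure_space_1 by simp
next
  case (Suc n)
  have sh: "0 \<le> fst s * h" using Suc.prems h by (auto simp: mem_Times_iff)
  have "flow h s \<in> quadrant" "flow h (jump \<zeta> s) \<in> quadrant" for \<zeta>
    using Suc.prems(2) h by (auto simp del: mem_Sigma_iff intro!: flow_quadrant jump_quadrant)
  then show ?case
    unfolding uniform_scheme_integral_Suc[OF \<nu> Suc.prems(1) sh] clock_scheme_integral_Suc[OF \<nu> Suc.prems(1) sh]
    using Suc.IH[of "\<lambda>i. C (Suc i)"] Suc.prems(1) by (simp del: mem_Sigma_iff)
qed

end

section \<open>The clocks of a Hawkes process are independent exponentials\<close>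

locale affine_hawkes_process = affine_hawkes c1 c2 \<beta> lam_inf x + compound_hawkes M F \<theta> \<zeta> \<nu> lam
  for c1 c2 \<beta> lam_inf x :: real and M :: "'a measure" and F \<theta> \<zeta> \<nu> lam +
  assumes lam_eq: "\<And>t \<omega>. lam t \<omega> = lam_inf + (x - lam_inf) * exp (- \<beta> * t)
      + loss_integral \<theta> \<zeta> (\<lambda>s. (c1 + c2 * (t - s)) * exp (- \<beta> * (t - s))) t \<omega>"
    and marks_pos: "AE z in \<nu>. 0 < z"
begin

definition jumps :: "'a \<Rightarrow> nat \<Rightarrow> real" where "jumps \<omega> i = \<theta> i \<omega>"

text \<open>Almost surely equal to \<zeta>, but nonnegative for every outcome, so that every outcome
  gives a jump sequence.\<close>

definition pos_marks :: "'a \<Rightarrow> nat \<Rightarrow> real" where "pos_marks \<omega> i = max 0 (\<zeta> i \<omega>)"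

definition clocks :: "nat \<Rightarrow> 'a \<Rightarrow> real" where "clocks n \<omega> = clock (jumps \<omega>) (pos_marks \<omega>) n"

lemma sets_marks: "sets \<nu> = sets borel"
  using marks_distr[of 0] by (metis sets_distr)

lemma measurable_mark [measurable]: "\<zeta> i \<in> borel_measurable M"
  using marks_indep by (simp add: indep_vars_def)

lemma prob_space_marks: "prob_space \<nu>"
  using prob_space_distr[of "\<zeta> 0" borel] marks_distr[of 0] by simp

lemma AE_marks_pos: "AE \<omega> in M. \<forall>i. 0 < \<zeta> i \<omega>"
  unfolding AE_all_countable
proof
  fix i
  have "AE z in distr M borel (\<zeta> i). 0 < z" unfolding marks_distr by (rule marks_pos)
  then show "AE \<omega> in M. 0 < \<zeta> i \<omega>" by (subst (asm) AE_distr_iff) auto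
qed

lemma jump_sequence_jumps: "\<omega> \<in> space M \<Longrightarrow> jump_sequence (jumps \<omega>) (pos_marks \<omega>)"
  using jump_times_pos jump_times_increasing finitely_many_jumps
  by (simp add: jump_sequence_def jumps_def[abs_def] pos_marks_def)

lemma jump_time_pos: "\<omega> \<in> space M \<Longrightarrow> 0 < \<theta> i \<omega>"
  using jump_times_pos[of \<omega>] jump_times_increasing[of \<omega>] strict_mono_less_eq[of "\<lambda>i. \<theta> i \<omega>" 0 i] by simp

lemma measurable_jump_time [measurable]: "\<theta> i \<in> borel_measurable M"
proof (rule borel_measurableI_le)
  fix t
  show "{\<omega> \<in> space M. \<theta> i \<omega> \<le> t} \<in> sets M"
  proof (cases "0 \<le> t")
    case True
    then show ?thesis using adapted[of t UNIV i] sub_algebra[of t] by auto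
  next
    case False
    then have "{\<omega> \<in> space M. \<theta> i \<omega> \<le> t} = {}" using jump_time_pos[of _ i] by fastforce
    then show ?thesis by (simp only: sets.empty_sets)
  qed
qed

lemma clocks_pos:
  assumes "\<omega> \<in> space M" shows "0 < clocks n \<omega>"
proof -
  have js: "0 < jumps \<omega> 0" "strict_mono (jumps \<omega>)" "\<And>i. 0 \<le> pos_marks \<omega> i"
    using jump_sequence_jumps[OF assms] by (auto simp: jump_sequence_def)
  note le = le_prev_jump[OF js(2), of _ n]
  have "0 < fst (state (jumps \<omega>) (pos_marks \<omega>) n u)" if "prev_jump (jumps \<omega>) n \<le> u" for u
    using that js prev_jump_nonneg[OF js(1,2), of n] by (intro state_pos) (auto dest: le)
  then have "cumhaz (coefP (jumps \<omega>) (pos_marks \<omega>) n) (coefQ (jumps \<omega>) (pos_marks \<omega>) n) (prev_jump (jumps \<omega>) n)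
    < cumhaz (coefP (jumps \<omega>) (pos_marks \<omega>) n) (coefQ (jumps \<omega>) (pos_marks \<omega>) n) (jumps \<omega> n)"
    by (intro cumhaz_strict_mono prev_jump_less js) (simp add: state_def)
  then show ?thesis unfolding clocks_def clock_def by simp
qed

text \<open>Up to and including the next jump time the left limit sees only the first n jumps, so on
  each such interval the compensator integrates a single smooth orbit.\<close>

lemma Lim_intensity:
  assumes \<omega>: "\<omega> \<in> space M" "\<forall>i. 0 < \<zeta> i \<omega>" and t: "prev_jump (jumps \<omega>) n < t" "t \<le> \<theta> n \<omega>"
  shows "Lim (at_left t) (\<lambda>s. lam s \<omega>) = fst (state (jumps \<omega>) (pos_marks \<omega>) n t)"
proof (rule tendsto_Lim)
  show "\<not> trivial_limit (at_left t)" by simp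
  have js: "strict_mono (jumps \<omega>)" using jump_sequence_jumps[OF \<omega>(1)] by (simp add: jump_sequence_def)
  have "isCont (\<lambda>s. fst (state (jumps \<omega>) (pos_marks \<omega>) n s)) t"
    unfolding state_def orbit_def by (intro continuous_intros)
  then have "((\<lambda>s. fst (state (jumps \<omega>) (pos_marks \<omega>) n s)) \<longlongrightarrow> fst (state (jumps \<omega>) (pos_marks \<omega>) n t)) (at_left t)"
    by (auto simp: isCont_def intro: tendsto_within_subset)
  moreover have "\<forall>\<^sub>F s in at_left t. fst (state (jumps \<omega>) (pos_marks \<omega>) n s) = lam s \<omega>"
    using eventually_at_left_real[OF t(1)]
  proof eventually_elim
    case (elim s)
    then have "{i. \<theta> i \<omega> \<le> s} = {..<n}"
      using jump_count[OF js, of n s] t by (simp add: jumps_def)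
    moreover have "pos_marks \<omega> = (\<lambda>i. \<zeta> i \<omega>)" using \<omega>(2) by (auto simp: pos_marks_def fun_eq_iff less_imp_le)
    ultimately show ?case by (simp add: lam_eq loss_integral_def fst_state jumps_def)
  qed
  ultimately show "((\<lambda>s. lam s \<omega>) \<longlongrightarrow> fst (state (jumps \<omega>) (pos_marks \<omega>) n t)) (at_left t)"
    by (rule Lim_transform_eventually)
qed

section \<open>Predictability of the past before the current time\<close>

abbreviation "predictable \<equiv> predictable_sigma M F"

lemma space_predictable: "space predictable = space M \<times> {0..}"
  unfolding predictable_sigma_def
proof (rule space_measure_of)
  have "A \<subseteq> space M" if "A \<in> sets (F t)" for A t
    using sets.sets_into_space[OF that] by (simp add: space_F)
  then show "{A \<times> {0} |A. A \<in> sets (F 0)} \<union> {A \<times> {s<..t} |A s t. 0 \<le> s \<and> s \<le> t \<and> A \<in> sets (F s)}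
     \<subseteq> Pow (space M \<times> {0..})" by fastforce
qed

lemma predictable_rectangle:
  assumes s: "0 \<le> s" and A: "A \<in> sets (F s)"
  shows "A \<times> {s<..} \<in> sets predictable"
proof -
  have sp: "B \<subseteq> space M" if "B \<in> sets (F t)" for B t
    using sets.sets_into_space[OF that] by (simp add: space_F)
  have sub: "{A \<times> {0} |A. A \<in> sets (F 0)} \<union> {A \<times> {s<..t} |A s t. 0 \<le> s \<and> s \<le> t \<and> A \<in> sets (F s)}
     \<subseteq> Pow (space M \<times> {0..})" using sp by fastforce
  have "A \<times> {s<..s + real k} \<in> sets predictable" for k
    unfolding predictable_sigma_def sets_measure_of[OF sub] using s A
    by (intro sigma_sets.Basic UnI2 CollectI exI[of _ A] exI[of _ s] exI[of _ "s + real k"]) auto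
  then have "(\<Union>k. A \<times> {s<..s + real k}) \<in> sets predictable" by blast
  also have "(\<Union>k. A \<times> {s<..s + real k}) = A \<times> {s<..}"
  proof -
    have "\<exists>k. t \<le> s + real k" for t using real_arch_simple[of "t - s"] by (auto simp: algebra_simps)
    then show ?thesis by auto
  qed
  finally show ?thesis .
qed

lemma predictable_time [measurable]: "(\<lambda>p. snd p) \<in> borel_measurable predictable"
proof (rule borel_measurableI_greater)
  fix t :: real
  show "{p \<in> space predictable. t < snd p} \<in> sets predictable"
  proof (cases "0 \<le> t")
    case True
    have "{p \<in> space predictable. t < snd p} = space M \<times> {t<..}" using True by (auto simp: space_predictable)
    then show ?thesis using predictable_rectangle[OF True sets.top] by (simp add: space_F)
  next
    case False
    then have "{p \<in> space predictable. t < snd p} = space predictable" by (auto simp: space_predictable)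
    then show ?thesis by simp
  qed
qed

text \<open>The strict inequality leaves room for a rational q between the jump time and the current
  time; the event is decided at time q, and the set is a countable union of predictable
  rectangles.\<close>

lemma predictable_past:
  assumes B: "B \<in> sets borel"
  shows "{p \<in> space predictable. \<theta> i (fst p) < snd p \<and> \<theta> i (fst p) \<le> a \<and> \<zeta> i (fst p) \<in> B} \<in> sets predictable" (is "?E \<in> _")
proof (cases "0 \<le> a")
  case True
  \<comment> \<open>The bound a is merged into min q a, and \<open>F (min q a)\<close> is contained
    in \<open>F q\<close>.\<close>
  define R where "R q = {\<omega> \<in> space M. \<theta> i \<omega> \<le> min q a \<and> \<zeta> i \<omega> \<in> B} \<times> {q<..}" for q
  have "R q \<in> sets predictable" if "0 \<le> q" for q
    unfolding R_def using that True B sets_F_mono[of "min q a" q]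
    by (intro predictable_rectangle subsetD[OF sets_F_mono[of "min q a" q]] adapted) auto
  then have "(\<Union>q\<in>{q \<in> \<rat>. 0 \<le> q}. R q) \<in> sets predictable"
    by (intro sets.countable_UN' countable_subset[OF _ countable_rat]) auto
  also have "(\<Union>q\<in>{q \<in> \<rat>. 0 \<le> q}. R q) = ?E"
  proof (intro set_eqI iffI)
    fix p assume "p \<in> (\<Union>q\<in>{q \<in> \<rat>. 0 \<le> q}. R q)"
    then show "p \<in> ?E"
      by (auto simp: R_def space_predictable)
  next
    fix p assume p: "p \<in> ?E"
    then obtain q where q: "q \<in> \<rat>" "\<theta> i (fst p) < q" "q < snd p" using Rats_dense_in_real[of "\<theta> i (fst p)" "snd p"] by auto
    moreover have "0 < \<theta> i (fst p)" using p jump_time_pos[of "fst p" i] by (auto simp: space_predictable)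
    ultimately have "p \<in> R q" "0 \<le> q" using p by (auto simp: R_def space_predictable mem_Times_iff)
    then show "p \<in> (\<Union>q\<in>{q \<in> \<rat>. 0 \<le> q}. R q)" using q by blast
  qed
  finally show ?thesis .
next
  case False
  then have "?E = {}"
    using jump_time_pos[of _ i] by (fastforce simp: space_predictable)
  then show ?thesis by (simp only: sets.empty_sets)
qed

lemma predictable_past_mark:
  assumes B: "B \<in> sets borel"
  shows "{p \<in> space predictable. \<theta> i (fst p) < snd p \<and> \<zeta> i (fst p) \<in> B} \<in> sets predictable" (is "?G \<in> _")
proof -
  have "(\<Union>k. {p \<in> space predictable. \<theta> i (fst p) < snd p \<and> \<theta> i (fst p) \<le> real k \<and> \<zeta> i (fst p) \<in> B}) \<in> sets predictable" (is "?U \<in> _")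
    using predictable_past[OF B] by blast
  also have "?U = ?G"
    using real_arch_simple by auto
  finally show ?thesis .
qed

text \<open>Truncation at the current time makes the past a predictable process.\<close>

definition past_jumps :: "'a \<times> real \<Rightarrow> nat \<Rightarrow> real" where
  "past_jumps p i = (if \<theta> i (fst p) < snd p then \<theta> i (fst p) else 0)"

definition past_marks :: "'a \<times> real \<Rightarrow> nat \<Rightarrow> real" where
  "past_marks p i = (if \<theta> i (fst p) < snd p then \<zeta> i (fst p) else 0)"

lemma predictable_jump_past [measurable]: "Measurable.pred predictable (\<lambda>p. \<theta> i (fst p) < snd p)"
  using predictable_past_mark[of UNIV i] by (simp add: pred_def)

lemma predictable_past_jumps [measurable]: "(\<lambda>p. past_jumps p i) \<in> borel_measurable predictable"
proof (rule borel_measurableI_le)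
  fix a
  have "{p \<in> space predictable. past_jumps p i \<le> a} = {p \<in> space predictable. \<theta> i (fst p) < snd p \<and> \<theta> i (fst p) \<le> a \<and> \<zeta> i (fst p) \<in> UNIV}
    \<union> {p \<in> space predictable. \<not> \<theta> i (fst p) < snd p \<and> 0 \<le> a}" (is "_ = ?A \<union> _")
    by (auto simp: past_jumps_def)
  also have "\<dots> \<in> sets predictable"
  proof (rule sets.Un)
    show "?A \<in> sets predictable"
      by (rule predictable_past) simp
  qed measurable
  finally show "{p \<in> space predictable. past_jumps p i \<le> a} \<in> sets predictable" .
qed

lemma predictable_past_marks [measurable]: "(\<lambda>p. past_marks p i) \<in> borel_measurable predictable"
proof (rule measurableI)
  fix B :: "real set" assume B: "B \<in> sets borel"
  have "(\<lambda>p. past_marks p i) -` B \<inter> space predictable = {p \<in> space predictable. \<theta> i (fst p) < snd p \<and> \<zeta> i (fst p) \<in> B}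
    \<union> {p \<in> space predictable. \<not> \<theta> i (fst p) < snd p \<and> 0 \<in> B}"
    by (auto simp: past_marks_def split: if_splits)
  also have "\<dots> \<in> sets predictable" by (intro sets.Un predictable_past_mark B) measurable
  finally show "(\<lambda>p. past_marks p i) -` B \<inter> space predictable \<in> sets predictable" .
qed simp

end

section \<open>The compensator formula in the time scale of the integrated intensity\<close>

context affine_hawkes
begin

lemma measurable_coef:
  assumes [measurable]: "\<And>i. (\<lambda>\<omega>. a \<omega> i) \<in> borel_measurable N" "\<And>i. (\<lambda>\<omega>. b \<omega> i) \<in> borel_measurable N"
  shows "(\<lambda>\<omega>. coefP (a \<omega>) (b \<omega>) n) \<in> borel_measurable N" "(\<lambda>\<omega>. coefQ (a \<omega>) (b \<omega>) n) \<in> borel_measurable N"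
  unfolding coefP_def coefQ_def by measurable

lemma measurable_cumhaz:
  assumes [measurable]: "P \<in> borel_measurable N" "Q \<in> borel_measurable N" "t \<in> borel_measurable N"
  shows "(\<lambda>\<omega>. cumhaz (P \<omega>) (Q \<omega>) (t \<omega>)) \<in> borel_measurable N"
  unfolding cumhaz_def by measurable

lemma measurable_prev_jump:
  assumes "\<And>i. (\<lambda>\<omega>. a \<omega> i) \<in> borel_measurable N"
  shows "(\<lambda>\<omega>. prev_jump (a \<omega>) n) \<in> borel_measurable N"
  using assms by (cases n) auto

lemma measurable_clock:
  assumes "\<And>i. (\<lambda>\<omega>. a \<omega> i) \<in> borel_measurable N" "\<And>i. (\<lambda>\<omega>. b \<omega> i) \<in> borel_measurable N"
  shows "(\<lambda>\<omega>. clock (a \<omega>) (b \<omega>) n) \<in> borel_measurable N"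
  unfolding clock_def by (intro borel_measurable_diff measurable_cumhaz measurable_coef measurable_prev_jump assms)

lemma prev_jump_cong: "(\<And>j. j < n \<Longrightarrow> a j = a' j) \<Longrightarrow> prev_jump a n = prev_jump a' n"
  by (cases n) auto

lemma clock_cong:
  assumes "\<And>j. j \<le> n \<Longrightarrow> a j = a' j" "\<And>j. j < n \<Longrightarrow> b j = b' j"
  shows "clock a b n = clock a' b' n"
  unfolding clock_def using assms by (simp add: coef_cong[of n a a' b b'] prev_jump_cong[of n a a'])

text \<open>Change of variables to the integrated intensity since a, whose derivative is the
  intensity; the left end point is a null set.\<close>

lemma hazard_substitution:
  assumes a: "0 \<le> a" "a < b" and pos: "\<And>t. a \<le> t \<Longrightarrow> t \<le> b \<Longrightarrow> 0 \<le> fst (orbit P Q t)"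
    and k: "k \<in> borel_measurable borel"
  shows "(\<integral>\<^sup>+t. indicator {a<..b} t * k (cumhaz P Q t - cumhaz P Q a) * ennreal (fst (orbit P Q t)) \<partial>lborel)
     = (\<integral>\<^sup>+s. k s * indicator {0..cumhaz P Q b - cumhaz P Q a} s \<partial>lborel)"
proof -
  let ?g = "\<lambda>t. cumhaz P Q t - cumhaz P Q a" and ?l = "\<lambda>t. fst (orbit P Q t)"
  have "(\<integral>\<^sup>+s. k s * indicator {?g a..?g b} s \<partial>lborel) = (\<integral>\<^sup>+t. k (?g t) * ennreal (?l t) * indicator {a..b} t \<partial>lborel)"
  proof (rule nn_integral_substitution_aux[OF k])
    show "(?g has_real_derivative ?l t) (at t)" for t
      using DERIV_diff[OF cumhaz_deriv[of P Q t] DERIV_const[of "cumhaz P Q a"]] by simp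
    show "continuous_on {a..b} ?l" unfolding orbit_def by (intro continuous_intros)
  qed (use a pos in auto)
  also have "\<dots> = (\<integral>\<^sup>+t. indicator {a<..b} t * k (?g t) * ennreal (?l t) \<partial>lborel)"
  proof (rule nn_integral_cong_AE)
    show "AE t in lborel. k (?g t) * ennreal (?l t) * indicator {a..b} t = indicator {a<..b} t * k (?g t) * ennreal (?l t)"
      using AE_lborel_singleton[of a] by eventually_elim (auto simp: indicator_def)
  qed
  finally show ?thesis by simp
qed

end

context affine_hawkes_process
begin

lemma measurable_clocks [measurable]: "clocks n \<in> borel_measurable M"
  unfolding clocks_def[abs_def] jumps_def[abs_def] pos_marks_def[abs_def] by (intro measurable_clock) measurable

lemma predictable_started: "Measurable.pred predictable (\<lambda>p. prev_jump (jumps (fst p)) n < snd p)"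
  by (cases n) (simp_all add: jumps_def)

lemma past_eq:
  assumes "\<omega> \<in> space M" "prev_jump (jumps \<omega>) n < t" "i < n"
  shows "past_jumps (\<omega>, t) i = jumps \<omega> i" "past_marks (\<omega>, t) i = \<zeta> i \<omega>"
proof -
  have js: "strict_mono (jumps \<omega>)" using jump_sequence_jumps[OF assms(1)] by (simp add: jump_sequence_def)
  have "\<theta> i \<omega> < t" using le_prev_jump[OF js assms(3)] assms(2) by (simp add: jumps_def)
  then show "past_jumps (\<omega>, t) i = jumps \<omega> i" "past_marks (\<omega>, t) i = \<zeta> i \<omega>"
    by (simp_all add: past_jumps_def past_marks_def jumps_def)
qed

definition past_event :: "(nat \<Rightarrow> (real \<times> real) set) \<Rightarrow> nat \<Rightarrow> 'a \<Rightarrow> ennreal" where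
  "past_event C n \<omega> = (\<Prod>i<n. indicator (C i) (clocks i \<omega>, \<zeta> i \<omega>))"

lemma measurable_past_event:
  assumes C: "\<And>i. C i \<in> sets borel"
  shows "past_event C n \<in> borel_measurable M"
proof -
  have "(\<lambda>\<omega>. (clocks i \<omega>, \<zeta> i \<omega>)) \<in> borel_measurable M" for i
    by (intro borel_measurable_Pair measurable_clocks measurable_mark)
  then show ?thesis unfolding past_event_def[abs_def]
    using C by (intro borel_measurable_prod_ennreal) (rule measurable_compose[OF _ borel_measurable_indicator])
qed

text \<open>The compensator is tested on the interval from the previous jump to jump n, with a
  function of the intensity integrated so far. The jump side sees only jump n, where that integral
  equals the clock; the time side becomes Lebesgue measure on [0, clock] by
  \<open>hazard_substitution\<close>.\<close>

lemma compensator_clock: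
  assumes C: "\<And>i. C i \<in> sets borel" and B: "B \<in> sets borel" and k: "k \<in> borel_measurable borel"
  shows "(\<integral>\<^sup>+\<omega>. past_event C n \<omega> * k (clocks n \<omega>) * indicator B (\<zeta> n \<omega>) \<partial>M)
     = emeasure \<nu> B * (\<integral>\<^sup>+\<omega>. past_event C n \<omega> * (\<integral>\<^sup>+s. k s * indicator {0..clocks n \<omega>} s \<partial>lborel) \<partial>M)"
proof -
  define a b where "a p = past_jumps p" and "b p i = max 0 (past_marks p i)" for p i
  \<comment> \<open>Written with the truncated past, hence predictable; on the interval considered
    it agrees with the actual history.\<close>
  define G where "G p = (\<Prod>i<n. indicator (C i) (clock (a p) (b p) i, past_marks p i)) *
     k (cumhaz (coefP (a p) (b p) n) (coefQ (a p) (b p) n) (snd p)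
       - cumhaz (coefP (a p) (b p) n) (coefQ (a p) (b p) n) (prev_jump (a p) n))" for p
  \<comment> \<open>The second condition reads t \<le> \<theta> n, so that jump n itself is
    counted.\<close>
  define W where "W q = (if prev_jump (jumps (fst (fst q))) n < snd (fst q) \<and> \<not> \<theta> n (fst (fst q)) < snd (fst q)
     then G (fst q) * indicator B (snd q) else 0)" for q
  define P Q where "P \<omega> = coefP (jumps \<omega>) (pos_marks \<omega>) n" and "Q \<omega> = coefQ (jumps \<omega>) (pos_marks \<omega>) n" for \<omega>
  have am: "(\<lambda>p. a p i) \<in> borel_measurable predictable" for i unfolding a_def by measurable
  have bm: "(\<lambda>p. b p i) \<in> borel_measurable predictable" for i unfolding b_def by measurable
  have "(\<lambda>p. (clock (a p) (b p) i, past_marks p i)) \<in> borel_measurable predictable" for i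
    by (intro borel_measurable_Pair measurable_clock am bm predictable_past_marks)
  then have "(\<lambda>p. \<Prod>i<n. indicator (C i) (clock (a p) (b p) i, past_marks p i) :: ennreal) \<in> borel_measurable predictable"
    using C by (intro borel_measurable_prod_ennreal) (rule measurable_compose[OF _ borel_measurable_indicator])
  then have Gm: "G \<in> borel_measurable predictable"
    unfolding G_def[abs_def]
    by (intro borel_measurable_times_ennreal measurable_compose[OF _ k] borel_measurable_diff
        measurable_cumhaz measurable_coef measurable_prev_jump am bm predictable_time)
  have Wm: "W \<in> borel_measurable (predictable \<Otimes>\<^sub>M borel)"
  proof -
    note [measurable] = Gm B predictable_started
    show ?thesis unfolding W_def[abs_def] by measurable
  qed
  have G_eq: "G (\<omega>, t) = past_event C n \<omega> * k (cumhaz (P \<omega>) (Q \<omega>) t - cumhaz (P \<omega>) (Q \<omega>) (prev_jump (jumps \<omega>) n))"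
    if "\<omega> \<in> space M" "prev_jump (jumps \<omega>) n < t" for \<omega> t
  proof -
    have e: "a (\<omega>, t) i = jumps \<omega> i" "b (\<omega>, t) i = pos_marks \<omega> i" "past_marks (\<omega>, t) i = \<zeta> i \<omega>" if "i < n" for i
      using past_eq[OF \<open>\<omega> \<in> space M\<close> \<open>prev_jump (jumps \<omega>) n < t\<close> that] by (simp_all add: a_def b_def pos_marks_def)
    have "clock (a (\<omega>, t)) (b (\<omega>, t)) i = clocks i \<omega>" if "i < n" for i
      unfolding clocks_def using that e by (intro clock_cong) auto
    then show ?thesis
      unfolding G_def past_event_def P_def Q_def using e
      by (simp add: coef_cong[of n "a (\<omega>, t)" "jumps \<omega>" "b (\<omega>, t)" "pos_marks \<omega>"]
          prev_jump_cong[of n "a (\<omega>, t)" "jumps \<omega>"])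
  qed
  have "(\<integral>\<^sup>+\<omega>. (\<Sum>i. W ((\<omega>, \<theta> i \<omega>), \<zeta> i \<omega>)) \<partial>M) = (\<integral>\<^sup>+\<omega>. past_event C n \<omega> * k (clocks n \<omega>) * indicator B (\<zeta> n \<omega>) \<partial>M)"
  proof (rule nn_integral_cong)
    fix \<omega> assume \<omega>: "\<omega> \<in> space M"
    have js: "0 < jumps \<omega> 0" "strict_mono (jumps \<omega>)" using jump_sequence_jumps[OF \<omega>] by (auto simp: jump_sequence_def)
    \<comment> \<open>Earlier jumps do not come after the previous jump time, later ones lie beyond
      \<theta> n.\<close>
    have zero: "W ((\<omega>, \<theta> i \<omega>), \<zeta> i \<omega>) = 0" if "i \<notin> {n}" for i
    proof (cases "i < n")
      case True
      then show ?thesis using le_prev_jump[OF js(2) True] by (simp add: W_def jumps_def)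
    next
      case False
      then have "jumps \<omega> n < jumps \<omega> i" using that js by (simp add: strict_mono_less)
      then show ?thesis by (simp add: W_def jumps_def)
    qed
    have "(\<Sum>i. W ((\<omega>, \<theta> i \<omega>), \<zeta> i \<omega>)) = W ((\<omega>, \<theta> n \<omega>), \<zeta> n \<omega>)"
      using suminf_finite[of "{n}" "\<lambda>i. W ((\<omega>, \<theta> i \<omega>), \<zeta> i \<omega>)"] zero by simp
    also have "\<dots> = G (\<omega>, jumps \<omega> n) * indicator B (\<zeta> n \<omega>)"
      using prev_jump_less[OF js, of n] by (simp add: W_def jumps_def)
    finally show "(\<Sum>i. W ((\<omega>, \<theta> i \<omega>), \<zeta> i \<omega>)) = past_event C n \<omega> * k (clocks n \<omega>) * indicator B (\<zeta> n \<omega>)"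
      using G_eq[OF \<omega> prev_jump_less[OF js]] by (simp add: clocks_def clock_def P_def Q_def)
  qed
  moreover have "(\<integral>\<^sup>+\<omega>. (\<integral>\<^sup>+t\<in>{0..}. (\<integral>\<^sup>+z. W ((\<omega>, t), z) \<partial>\<nu>) * ennreal (Lim (at_left t) (\<lambda>s. lam s \<omega>)) \<partial>lborel) \<partial>M)
     = (\<integral>\<^sup>+\<omega>. emeasure \<nu> B * (past_event C n \<omega> * (\<integral>\<^sup>+s. k s * indicator {0..clocks n \<omega>} s \<partial>lborel)) \<partial>M)"
  proof (rule nn_integral_cong_AE)
    show "AE \<omega> in M. (\<integral>\<^sup>+t\<in>{0..}. (\<integral>\<^sup>+z. W ((\<omega>, t), z) \<partial>\<nu>) * ennreal (Lim (at_left t) (\<lambda>s. lam s \<omega>)) \<partial>lborel)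
      = emeasure \<nu> B * (past_event C n \<omega> * (\<integral>\<^sup>+s. k s * indicator {0..clocks n \<omega>} s \<partial>lborel))"
      using AE_marks_pos AE_space
    proof eventually_elim
      case (elim \<omega>)
      have js: "0 < jumps \<omega> 0" "strict_mono (jumps \<omega>)" "\<And>i. 0 \<le> pos_marks \<omega> i"
        using jump_sequence_jumps[OF elim(2)] by (auto simp: jump_sequence_def)
      let ?\<tau> = "prev_jump (jumps \<omega>) n" and ?\<theta> = "jumps \<omega> n"
      let ?f = "\<lambda>t. indicator {?\<tau><..?\<theta>} t * k (cumhaz (P \<omega>) (Q \<omega>) t - cumhaz (P \<omega>) (Q \<omega>) ?\<tau>) * ennreal (fst (orbit (P \<omega>) (Q \<omega>) t))"
      have \<tau>0: "0 \<le> ?\<tau>" by (rule prev_jump_nonneg[OF js(1,2)])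
      have "(\<integral>\<^sup>+z. W ((\<omega>, t), z) \<partial>\<nu>) * ennreal (Lim (at_left t) (\<lambda>s. lam s \<omega>)) * indicator {0..} t
        = emeasure \<nu> B * past_event C n \<omega> * ?f t" for t
      proof (cases "?\<tau> < t \<and> t \<le> ?\<theta>")
        case True
        then have "(\<integral>\<^sup>+z. W ((\<omega>, t), z) \<partial>\<nu>) = G (\<omega>, t) * emeasure \<nu> B"
          using B by (simp add: W_def jumps_def not_less nn_integral_cmult_indicator sets_marks)
        moreover have "Lim (at_left t) (\<lambda>s. lam s \<omega>) = fst (orbit (P \<omega>) (Q \<omega>) t)"
          using Lim_intensity[OF elim(2,1), of n t] True by (simp add: state_def P_def Q_def jumps_def)
        ultimately show ?thesis using G_eq[OF elim(2), of t] True \<tau>0 by (simp add: mult_ac)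
      next
        case False
        then have "W ((\<omega>, t), z) = 0" for z by (auto simp: W_def jumps_def)
        then show ?thesis using False by auto
      qed
      then have "(\<integral>\<^sup>+t\<in>{0..}. (\<integral>\<^sup>+z. W ((\<omega>, t), z) \<partial>\<nu>) * ennreal (Lim (at_left t) (\<lambda>s. lam s \<omega>)) \<partial>lborel)
        = (\<integral>\<^sup>+t. emeasure \<nu> B * past_event C n \<omega> * ?f t \<partial>lborel)" by simp
      also have "\<dots> = emeasure \<nu> B * past_event C n \<omega> * (\<integral>\<^sup>+t. ?f t \<partial>lborel)"
      proof (rule nn_integral_cmult)
        note [measurable] = k
        have [measurable]: "(\<lambda>t. cumhaz (P \<omega>) (Q \<omega>) t) \<in> borel_measurable borel" by (intro measurable_cumhaz) measurable
        show "?f \<in> borel_measurable lborel" unfolding orbit_def by measurable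
      qed
      also have "(\<integral>\<^sup>+t. ?f t \<partial>lborel) = (\<integral>\<^sup>+s. k s * indicator {0..clocks n \<omega>} s \<partial>lborel)"
      proof -
        note le = le_prev_jump[OF js(2), of _ n]
        have "0 \<le> fst (orbit (P \<omega>) (Q \<omega>) t)" if "?\<tau> \<le> t" for t
          using that \<tau>0 js state_pos[of t n "jumps \<omega>" "pos_marks \<omega>"] unfolding state_def P_def Q_def
          by (meson le less_imp_le order_trans)
        then have "(\<integral>\<^sup>+t. ?f t \<partial>lborel) = (\<integral>\<^sup>+s. k s * indicator {0..cumhaz (P \<omega>) (Q \<omega>) ?\<theta> - cumhaz (P \<omega>) (Q \<omega>) ?\<tau>} s \<partial>lborel)"
          by (intro hazard_substitution \<tau>0 prev_jump_less js k)
        then show ?thesis by (simp add: clocks_def clock_def P_def Q_def)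
      qed
      finally show ?case by (simp add: mult.assoc)
    qed
  qed
  moreover have "\<dots> = emeasure \<nu> B * (\<integral>\<^sup>+\<omega>. past_event C n \<omega> * (\<integral>\<^sup>+s. k s * indicator {0..clocks n \<omega>} s \<partial>lborel) \<partial>M)"
  proof (rule nn_integral_cmult)
    note [measurable] = k
    have [measurable]: "past_event C n \<in> borel_measurable M" by (rule measurable_past_event[OF C])
    have "(\<lambda>p. k (snd p) * indicator {0..clocks n (fst p)} (snd p)) \<in> borel_measurable (M \<Otimes>\<^sub>M lborel)"
      by (simp add: indicator_def) measurable
    then have "(\<lambda>\<omega>. \<integral>\<^sup>+s. k s * indicator {0..clocks n \<omega>} s \<partial>lborel) \<in> borel_measurable M"
      by (intro lborel.borel_measurable_nn_integral) (simp add: case_prod_beta)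
    then show "(\<lambda>\<omega>. past_event C n \<omega> * (\<integral>\<^sup>+s. k s * indicator {0..clocks n \<omega>} s \<partial>lborel)) \<in> borel_measurable M"
      by measurable
  qed
  ultimately show ?thesis using compensator[OF Wm] by simp
qed

end

lemma nn_integral_iid_cylinder:
  fixes P :: "'c::topological_space measure"
  assumes P: "prob_space P" "sets P = sets borel" and C: "\<And>i. C i \<in> sets borel"
  shows "(\<integral>\<^sup>+\<omega>. (\<Prod>i<n. indicator (C i) (\<omega> i)) \<partial>(iid P)) = (\<Prod>i<n. emeasure P (C i))"
  using C
proof (induction n arbitrary: C)
  case 0
  interpret prob_space "iid P" by (rule prob_space_PiM) (rule P)
  show ?case using emeasure_space_1 by simp
next
  case (Suc n)
  let ?S = "iid P"
  have ms: "sets ?S = sets seq_space" by (rule sets_seq_space_cong[OF P(2)])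
  have m: "(\<lambda>\<omega>. \<Prod>i<n. indicator (C i) (\<omega> i) :: ennreal) \<in> borel_measurable ?S" if "\<And>i. C i \<in> sets borel" for n and C :: "nat \<Rightarrow> 'c set"
    using that unfolding measurable_cong_sets[OF ms refl]
    by (intro borel_measurable_prod_ennreal) (rule measurable_compose[OF measurable_component_singleton borel_measurable_indicator], auto)
  have "(\<integral>\<^sup>+\<omega>. (\<Prod>i<Suc n. indicator (C i) (\<omega> i)) \<partial>?S)
     = (\<integral>\<^sup>+a. \<integral>\<^sup>+\<omega>. indicator (C 0) a * (\<Prod>i<n. indicator (C (Suc i)) (\<omega> i)) \<partial>?S \<partial>P)"
    by (subst nn_integral_iid_split[OF P(1) m[OF Suc.prems]]) (simp_all only: prod.lessThan_Suc_shift nat.case)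
  also have "\<dots> = (\<integral>\<^sup>+a. indicator (C 0) a * (\<Prod>i<n. emeasure P (C (Suc i))) \<partial>P)"
    using Suc.IH[of "\<lambda>i. C (Suc i)"] Suc.prems m[of "\<lambda>i. C (Suc i)" n]
    by (simp add: nn_integral_cmult)
  also have "\<dots> = emeasure P (C 0) * (\<Prod>i<n. emeasure P (C (Suc i)))"
    using Suc.prems[of 0] P(2) by (simp add: nn_integral_multc)
  finally show ?case unfolding prod.lessThan_Suc_shift .
qed

text \<open>Both sides are exp (min S a); the 1 on the left avoids a subtraction of extended
  nonnegative numbers.\<close>

lemma exp_indicator_integral:
  assumes "0 \<le> a" "0 < S"
  shows "(\<integral>\<^sup>+s. (ennreal (exp s) * indicator {..a} s) * indicator {0..S} s \<partial>lborel) + 1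
    = ennreal (exp S) * indicator {..a} S + ennreal (exp a) * indicator {a<..} S"
proof -
  have "(\<integral>\<^sup>+s. (ennreal (exp s) * indicator {..a} s) * indicator {0..S} s \<partial>lborel)
     = (\<integral>\<^sup>+s. ennreal (exp s) * indicator {0..min S a} s \<partial>lborel)"
    by (intro nn_integral_cong) (auto simp: indicator_def)
  also have "\<dots> = ennreal (exp (min S a) - exp 0)"
    using assms by (intro nn_integral_FTC_Icc) (auto intro!: derivative_eq_intros)
  also have "\<dots> + 1 = ennreal (exp (min S a))"
    using assms by (subst ennreal_1[symmetric], subst ennreal_plus[symmetric]) auto
  finally show ?thesis by (cases "S \<le> a") (auto simp: min_def)
qed

lemma emeasure_distr_density:
  assumes "c \<in> borel_measurable M" and Y: "Y \<in> M \<rightarrow>\<^sub>M N" and X: "X \<in> sets N"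
  shows "emeasure (distr (density M c) N Y) X = (\<integral>\<^sup>+\<omega>. c \<omega> * indicator X (Y \<omega>) \<partial>M)"
proof -
  have "emeasure (distr (density M c) N Y) X = (\<integral>\<^sup>+\<omega>. c \<omega> * indicator (Y -` X \<inter> space M) \<omega> \<partial>M)"
    using assms measurable_sets[OF Y X] by (subst emeasure_distr) (auto simp: emeasure_density)
  also have "\<dots> = (\<integral>\<^sup>+\<omega>. c \<omega> * indicator X (Y \<omega>) \<partial>M)"
    by (intro nn_integral_cong) (auto simp: indicator_def)
  finally show ?thesis .
qed

section \<open>Law and independence of the clocks and marks\<close>

context affine_hawkes_process
begin

lemma past_event_le: "past_event C n \<omega> \<le> 1"
  unfolding past_event_def by (intro prod_le_1) (auto simp: indicator_def)

text \<open>In \<open>compensator_clock\<close> the set B enters the right side only through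
  \<open>emeasure \<nu> B\<close>; comparison with \<open>B = UNIV\<close> separates the mark from
  the past and the clock.\<close>

lemma past_event_independent_mark:
  assumes C: "\<And>i. C i \<in> sets borel" and B: "B \<in> sets borel" and k: "k \<in> borel_measurable borel"
  shows "(\<integral>\<^sup>+\<omega>. past_event C n \<omega> * k (clocks n \<omega>) * indicator B (\<zeta> n \<omega>) \<partial>M)
     = emeasure \<nu> B * (\<integral>\<^sup>+\<omega>. past_event C n \<omega> * k (clocks n \<omega>) \<partial>M)"
proof -
  have "emeasure \<nu> UNIV = 1"
    using prob_space.emeasure_space_1[OF prob_space_marks] sets_eq_imp_space_eq[OF sets_marks] by simp
  then show ?thesis
    using compensator_clock[of C B k n, OF C B k] compensator_clock[of C UNIV k n, OF C _ k] by simp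
qed

text \<open>The test function \<open>e\<^sup>s 1\<^bsub>s \<le> a\<^esub>\<close> integrates to itself, up to the tail, so that the compensator
  formula yields the tail of the clock at once.\<close>

lemma past_event_clock_tail:
  assumes C: "\<And>i. C i \<in> sets borel" and a: "0 \<le> a"
  shows "(\<integral>\<^sup>+\<omega>. past_event C n \<omega> * indicator {a<..} (clocks n \<omega>) \<partial>M) = ennreal (exp (- a)) * (\<integral>\<^sup>+\<omega>. past_event C n \<omega> \<partial>M)"
proof -
  let ?k = "\<lambda>s. ennreal (exp s) * indicator {..a} s" and ?c = "past_event C n" and ?S = "clocks n"
  have [measurable]: "?c \<in> borel_measurable M" by (rule measurable_past_event[OF C])
  have "(\<lambda>p. ?k (snd p) * indicator {0..?S (fst p)} (snd p)) \<in> borel_measurable (M \<Otimes>\<^sub>M lborel)"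
    by (simp add: indicator_def) measurable
  then have [measurable]: "(\<lambda>\<omega>. \<integral>\<^sup>+s. ?k s * indicator {0..?S \<omega>} s \<partial>lborel) \<in> borel_measurable M"
    by (intro lborel.borel_measurable_nn_integral) (simp add: case_prod_beta)
  have "emeasure \<nu> UNIV = 1"
    using prob_space.emeasure_space_1[OF prob_space_marks] sets_eq_imp_space_eq[OF sets_marks] by simp
  then have 1: "(\<integral>\<^sup>+\<omega>. ?c \<omega> * ?k (?S \<omega>) \<partial>M) = (\<integral>\<^sup>+\<omega>. ?c \<omega> * (\<integral>\<^sup>+s. ?k s * indicator {0..?S \<omega>} s \<partial>lborel) \<partial>M)"
    using compensator_clock[of C UNIV ?k n, OF C] by simp
  have "(\<integral>\<^sup>+\<omega>. ?c \<omega> * ?k (?S \<omega>) \<partial>M) + (\<integral>\<^sup>+\<omega>. ?c \<omega> \<partial>M) =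
      (\<integral>\<^sup>+\<omega>. ?c \<omega> * ((\<integral>\<^sup>+s. ?k s * indicator {0..?S \<omega>} s \<partial>lborel) + 1) \<partial>M)"
    unfolding 1 by (subst nn_integral_add[symmetric]) (simp_all add: distrib_left)
  also have "\<dots> = (\<integral>\<^sup>+\<omega>. ?c \<omega> * (?k (?S \<omega>) + ennreal (exp a) * indicator {a<..} (?S \<omega>)) \<partial>M)"
    by (intro nn_integral_cong) (simp add: exp_indicator_integral[OF a clocks_pos])
  also have "\<dots> = (\<integral>\<^sup>+\<omega>. ?c \<omega> * ?k (?S \<omega>) + ennreal (exp a) * (?c \<omega> * indicator {a<..} (?S \<omega>)) \<partial>M)"
    by (intro nn_integral_cong) (simp add: distrib_left mult_ac)
  also have "\<dots> = (\<integral>\<^sup>+\<omega>. ?c \<omega> * ?k (?S \<omega>) \<partial>M) + ennreal (exp a) * (\<integral>\<^sup>+\<omega>. ?c \<omega> * indicator {a<..} (?S \<omega>) \<partial>M)"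
    by (subst nn_integral_add) (simp_all add: nn_integral_cmult)
  finally have eq: "(\<integral>\<^sup>+\<omega>. ?c \<omega> * ?k (?S \<omega>) \<partial>M) + (\<integral>\<^sup>+\<omega>. ?c \<omega> \<partial>M)
     = (\<integral>\<^sup>+\<omega>. ?c \<omega> * ?k (?S \<omega>) \<partial>M) + ennreal (exp a) * (\<integral>\<^sup>+\<omega>. ?c \<omega> * indicator {a<..} (?S \<omega>) \<partial>M)" .
  \<comment> \<open>The common term is finite, since the integrand is at most exp a, and can
    therefore be cancelled.\<close>
  have "(\<integral>\<^sup>+\<omega>. ?c \<omega> * ?k (?S \<omega>) \<partial>M) \<le> (\<integral>\<^sup>+\<omega>. ennreal (exp a) \<partial>M)"
  proof (rule nn_integral_mono)
    fix \<omega>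
    have "?c \<omega> * ?k (?S \<omega>) \<le> 1 * ennreal (exp a)"
      by (intro mult_mono past_event_le) (auto simp: indicator_def ennreal_leI)
    then show "?c \<omega> * ?k (?S \<omega>) \<le> ennreal (exp a)" by simp
  qed
  also have "\<dots> < \<infinity>" using emeasure_space_1 by simp
  finally have "(\<integral>\<^sup>+\<omega>. ?c \<omega> \<partial>M) = ennreal (exp a) * (\<integral>\<^sup>+\<omega>. ?c \<omega> * indicator {a<..} (?S \<omega>) \<partial>M)"
    using eq by (auto simp: ennreal_add_left_cancel)
  then show ?thesis
    by (simp add: mult.assoc[symmetric] ennreal_mult[symmetric] exp_add[symmetric])
qed

text \<open>Under M weighted by the past event, tails identify the law of the clock as r times the
  exponential law, r being the mass of the event; the mark splits off on rectangles, which determine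
  the product measure.\<close>

lemma past_event_clock_mark:
  assumes C: "\<And>i. C i \<in> sets borel" and D: "D \<in> sets borel"
  shows "(\<integral>\<^sup>+\<omega>. past_event C n \<omega> * indicator D (clocks n \<omega>, \<zeta> n \<omega>) \<partial>M)
    = (\<integral>\<^sup>+\<omega>. past_event C n \<omega> \<partial>M) * emeasure (std_exponential \<Otimes>\<^sub>M \<nu>) D"
proof -
  let ?c = "past_event C n" and ?S = "clocks n"
  define r where "r = (\<integral>\<^sup>+\<omega>. ?c \<omega> \<partial>M)"
  have [measurable]: "?c \<in> borel_measurable M" by (rule measurable_past_event[OF C])
  have YM: "(\<lambda>\<omega>. (?S \<omega>, \<zeta> n \<omega>)) \<in> borel_measurable M"
    by (intro borel_measurable_Pair measurable_clocks measurable_mark)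
  interpret Exp: prob_space std_exponential by (rule prob_space_std_exponential)
  interpret \<nu>: prob_space \<nu> by (rule prob_space_marks)
  have "r \<le> (\<integral>\<^sup>+\<omega>. 1 \<partial>M)" unfolding r_def by (intro nn_integral_mono past_event_le)
  then have r: "r < \<infinity>" using emeasure_space_1 by (simp add: le_less_trans)
  define D1 where "D1 = scale_measure r std_exponential"
  have D1: "emeasure D1 X = r * emeasure std_exponential X" for X by (simp add: D1_def)
  have fin: "finite_measure D1"
    using r Exp.emeasure_space_1 by (intro finite_measureI) (simp add: D1_def space_scale_measure)
  interpret D1: finite_measure D1 by fact
  have "distr (density M ?c) borel ?S = D1"
  proof (rule measure_eqI_lessThan)
    note em = emeasure_distr_density[of ?c M ?S borel]
    fix a :: real
    show eq: "emeasure (distr (density M ?c) borel ?S) {a<..} = emeasure D1 {a<..}"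
    proof (cases "0 \<le> a")
      case True
      then show ?thesis
        using past_event_clock_tail[of C a n, OF C True] by (simp add: em D1 std_exponential_tail r_def mult.commute)
    next
      \<comment> \<open>Clocks are positive, so for a < 0 both tails carry the full mass.\<close>
      case False
      have "(\<integral>\<^sup>+\<omega>. ?c \<omega> * indicator {a<..} (?S \<omega>) \<partial>M) = r" unfolding r_def
      proof (rule nn_integral_cong)
        fix \<omega> assume "\<omega> \<in> space M"
        then show "?c \<omega> * indicator {a<..} (?S \<omega>) = ?c \<omega>" using clocks_pos[of \<omega> n] False by simp
      qed
      moreover have "emeasure std_exponential {a<..} = 1"
      proof (rule antisym)
        have "1 = emeasure std_exponential {0<..}" using std_exponential_tail[of 0] by simp
        also have "\<dots> \<le> emeasure std_exponential {a<..}" using False by (intro emeasure_mono) auto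
        finally show "1 \<le> emeasure std_exponential {a<..}" .
      qed (rule Exp.emeasure_le_1)
      ultimately show ?thesis by (simp add: em D1)
    qed
    show "emeasure (distr (density M ?c) borel ?S) {a<..} < \<infinity>"
      unfolding eq infinity_ennreal_def by (rule less_top[THEN iffD1, OF D1.emeasure_finite])
  qed (simp_all add: D1_def)
  note S_law = this
  have tail: "(\<integral>\<^sup>+\<omega>. ?c \<omega> * indicator A (?S \<omega>) \<partial>M) = emeasure D1 A" if "A \<in> sets borel" for A
    unfolding S_law[symmetric] using that by (simp add: emeasure_distr_density)
  note joint = emeasure_distr_density[OF \<open>?c \<in> borel_measurable M\<close> YM]
  have "D1 \<Otimes>\<^sub>M \<nu> = distr (density M ?c) borel (\<lambda>\<omega>. (?S \<omega>, \<zeta> n \<omega>))"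
  proof (rule pair_measure_eqI)
    show "sigma_finite_measure D1" "sigma_finite_measure \<nu>" by unfold_locales
    show "sets (D1 \<Otimes>\<^sub>M \<nu>) = sets (distr (density M ?c) borel (\<lambda>\<omega>. (?S \<omega>, \<zeta> n \<omega>)))"
      unfolding sets_distr borel_prod[symmetric]
      by (rule sets_pair_measure_cong) (simp_all add: sets_marks D1_def)
    fix A B assume "A \<in> sets D1" "B \<in> sets \<nu>"
    then have A: "A \<in> sets borel" and B: "B \<in> sets borel" by (simp_all add: sets_marks D1_def)
    have "A \<times> B \<in> sets borel" unfolding borel_prod[symmetric] using A B by simp
    from joint[OF this] show "emeasure D1 A * emeasure \<nu> B = emeasure (distr (density M ?c) borel (\<lambda>\<omega>. (?S \<omega>, \<zeta> n \<omega>))) (A \<times> B)"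
      using past_event_independent_mark[of C B "indicator A" n, OF C B] A tail[OF A]
      by (simp add: indicator_times mult_ac)
  qed
  then have "(\<integral>\<^sup>+\<omega>. ?c \<omega> * indicator D (?S \<omega>, \<zeta> n \<omega>) \<partial>M) = emeasure (D1 \<Otimes>\<^sub>M \<nu>) D"
    using joint[OF D] by simp
  also have "\<dots> = r * emeasure (std_exponential \<Otimes>\<^sub>M \<nu>) D"
  proof -
    have D': "D \<in> sets (std_exponential \<Otimes>\<^sub>M \<nu>)"
      using D unfolding borel_prod[symmetric]
      by (subst sets_pair_measure_cong[of _ borel _ borel]) (simp_all add: sets_marks)
    have D'': "D \<in> sets (D1 \<Otimes>\<^sub>M \<nu>)"
      using D unfolding borel_prod[symmetric]
      by (subst sets_pair_measure_cong[of _ borel _ borel]) (simp_all add: sets_marks D1_def)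
    have "(\<lambda>x. \<integral>\<^sup>+y. indicator D (x, y) \<partial>\<nu>) \<in> borel_measurable std_exponential"
      using D' by (intro \<nu>.borel_measurable_nn_integral) simp
    then show ?thesis
      unfolding \<nu>.emeasure_pair_measure[OF D'] \<nu>.emeasure_pair_measure[OF D''] unfolding D1_def
      by (rule nn_integral_scale_measure)
  qed
  finally show ?thesis unfolding r_def .
qed

text \<open>The last pair factors out of the past event by \<open>past_event_clock_mark\<close>, so
  cylinder probabilities are products.\<close>

lemma clocks_iid:
  "distr M seq_space (\<lambda>\<omega> i. (clocks i \<omega>, \<zeta> i \<omega>)) = (iid (std_exponential \<Otimes>\<^sub>M \<nu>))"
proof -
  interpret Exp: prob_space std_exponential by (rule prob_space_std_exponential)
  interpret \<nu>: prob_space \<nu> by (rule prob_space_marks)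
  interpret P: pair_prob_space std_exponential \<nu> ..
  let ?P = "std_exponential \<Otimes>\<^sub>M \<nu>"
  let ?Y = "iid ?P"
  have P_borel: "sets ?P = sets borel"
    unfolding borel_prod[symmetric] by (rule sets_pair_measure_cong) (simp_all add: sets_marks)
  have sY: "sets ?Y = sets seq_space" by (rule sets_seq_space_cong[OF P_borel])
  have "distr M seq_space (\<lambda>\<omega> i. (clocks i \<omega>, \<zeta> i \<omega>)) = distr ?Y seq_space (\<lambda>\<omega>. \<omega>)"
  proof (rule law_eqI)
    show "prob_space M" by (rule prob_space_axioms)
    show "(\<lambda>\<omega> i. (clocks i \<omega>, \<zeta> i \<omega>)) \<in> M \<rightarrow>\<^sub>M seq_space"
      by (intro measurable_PiM_single' borel_measurable_Pair measurable_clocks measurable_mark) simp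
    show "(\<lambda>\<omega>. \<omega>) \<in> ?Y \<rightarrow>\<^sub>M seq_space" using sY by (rule measurable_ident_sets)
    fix n and C :: "nat \<Rightarrow> (real \<times> real) set" assume C: "\<And>i. C i \<in> sets borel"
    have "(\<integral>\<^sup>+\<omega>. past_event C n \<omega> \<partial>M) = (\<Prod>i<n. emeasure ?P (C i))"
    proof (induction n)
      case 0
      show ?case using emeasure_space_1 by (simp add: past_event_def)
    next
      case (Suc n)
      have "(\<integral>\<^sup>+\<omega>. past_event C (Suc n) \<omega> \<partial>M) = (\<integral>\<^sup>+\<omega>. past_event C n \<omega> * indicator (C n) (clocks n \<omega>, \<zeta> n \<omega>) \<partial>M)"
        by (simp add: past_event_def)
      then show ?case using past_event_clock_mark[of C "C n" n, OF C C] Suc.IH by simp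
    qed
    then show "(\<integral>\<^sup>+\<omega>. (\<Prod>i<n. indicator (C i) (clocks i \<omega>, \<zeta> i \<omega>)) \<partial>M) = (\<integral>\<^sup>+\<omega>. (\<Prod>i<n. indicator (C i) (\<omega> i)) \<partial>?Y)"
      unfolding nn_integral_iid_cylinder[OF P.prob_space_axioms P_borel, of C n, OF C] past_event_def .
  qed
  also have "\<dots> = ?Y" using sY by (intro distr_id2) simp
  finally show ?thesis .
qed

end

section \<open>Convergence in law\<close>

text \<open>The given schemes read their noise from index 1 on; dropping the first entry of an iid
  sequence preserves its law.\<close>

lemma nn_integral_iid_shift:
  assumes "prob_space P" "f \<in> borel_measurable (iid P)"
  shows "(\<integral>\<^sup>+u. f (\<lambda>i. u (Suc i)) \<partial>(iid P)) = (\<integral>\<^sup>+u. f u \<partial>(iid P))"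
proof -
  interpret prob_space P by fact
  have "(\<lambda>u i. u (Suc i)) \<in> (iid P) \<rightarrow>\<^sub>M (iid P)"
    by (rule measurable_PiM_single') (auto simp: space_PiM intro: measurable_component_singleton)
  from nn_integral_iid_split[OF assms(1) measurable_compose[OF this assms(2)]]
  show ?thesis by (simp add: emeasure_space_1)
qed

lemma (in scheme_noise) noise_law:
  "distr M (seq_space \<Otimes>\<^sub>M seq_space) (\<lambda>\<omega>. (\<lambda>k. U k \<omega>, \<lambda>k. Z k \<omega>))
     = (iid std_uniform) \<Otimes>\<^sub>M (iid \<nu>)"
proof -
  have rv: "random_variable borel (U k)" "random_variable borel (Z k)" for k
    using U_indep Z_indep by (auto simp: indep_vars_def)
  have "distr M seq_space (\<lambda>\<omega> k. U k \<omega>) = (iid std_uniform)"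
    using U_indep indep_vars_iff_distr_eq_PiM[where I = UNIV and M' = "\<lambda>_. borel" and X = U] rv U_distr by (simp add: restrict_UNIV)
  moreover have "distr M seq_space (\<lambda>\<omega> k. Z k \<omega>) = (iid \<nu>)"
    using Z_indep indep_vars_iff_distr_eq_PiM[where I = UNIV and M' = "\<lambda>_. borel" and X = Z] rv Z_distr by (simp add: restrict_UNIV)
  ultimately show ?thesis using U_Z_indep unfolding indep_var_distribution_eq by simp
qed

lemma (in scheme_noise) scheme_marks: "prob_space \<nu>" "sets \<nu> = sets borel"
proof -
  have "random_variable borel (Z 0)" using Z_indep by (auto simp: indep_vars_def)
  from prob_space_distr[OF this] show "prob_space \<nu>" by (simp add: Z_distr)
  show "sets \<nu> = sets borel" using Z_distr[of 0] by (metis sets_distr)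
qed

text \<open>The projection onto the quadrant: it makes the path map total on sequences and changes
  nothing along a scheme.\<close>

definition clip :: "real \<times> real \<Rightarrow> real \<times> real" where "clip s = (max 0 (fst s), max 0 (snd s))"

text \<open>Up to a finite horizon the path depends on finitely many entries, and nearby entries
  give nearby paths without any time change. Preimages of open sets are thus open in the product
  topology, whose Borel sets are those of the product sigma-algebra.\<close>

lemma measurable_step_path:
  assumes h: "0 < h"
  shows "(\<lambda>l. step_path h (\<lambda>k. clip (l k))) \<in> seq_space \<rightarrow>\<^sub>M borel_of_topology (skorokhod_topology ({0..} \<times> {0..}))"
    (is "?\<Phi> \<in> _ \<rightarrow>\<^sub>M borel_of_topology (skorokhod_topology ?E)")
proof (rule measurable_borel_of_topologyI)
  have cad: "?\<Phi> l \<in> cadlag_paths ?E" for l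
    using h by (intro step_path_cadlag closed_Times closed_atLeast) (auto simp: clip_def)
  show "?\<Phi> l \<in> topspace (skorokhod_topology ?E)" for l using cad by simp
  fix V assume V: "openin (skorokhod_topology ?E) V"
  have "\<exists>W. open W \<and> p \<in> W \<and> (\<forall>q\<in>W. ?\<Phi> q \<in> V)" if p: "?\<Phi> p \<in> V" for p
  proof -
    obtain m e where e: "0 < e" "skorokhod_nbhd ?E (?\<Phi> p) m e \<subseteq> V"
      using V p unfolding openin_skorokhod by blast
    have "continuous_on UNIV (\<lambda>q :: nat \<Rightarrow> real \<times> real. clip (q k))" for k
      unfolding clip_def by (intro continuous_intros continuous_on_product_coordinates)
    then have lim: "((\<lambda>q. clip (q k)) \<longlongrightarrow> clip (p k)) (nhds p)" for k
      using tendsto_at_iff_tendsto_nhds[of "\<lambda>q. clip (q k)" p] unfolding continuous_on_def by blast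
    have "\<forall>\<^sub>F q in nhds p. \<forall>k\<in>{..nat \<lfloor>m / h\<rfloor>}. dist (clip (q k)) (clip (p k)) < e / 2"
      by (intro eventually_ball_finite ballI tendstoD[OF lim]) (use e in auto)
    then have "\<forall>\<^sub>F q in nhds p. ?\<Phi> q \<in> V"
    proof eventually_elim
      case (elim q)
      have "dist (?\<Phi> q s) (?\<Phi> p s) \<le> e / 2" if "s \<in> {0..m}" for s
      proof -
        have "nat \<lfloor>s / h\<rfloor> \<le> nat \<lfloor>m / h\<rfloor>" using that h by (intro nat_mono floor_mono divide_right_mono) auto
        then show ?thesis using elim that by (simp add: step_path_def less_imp_le)
      qed
      then have "?\<Phi> q \<in> skorokhod_nbhd ?E (?\<Phi> p) m e"
        unfolding skorokhod_nbhd_def using cad e(1)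
        by (intro CollectI conjI exI[of _ "\<lambda>s. s"] exI[of _ "e / 2"]) (auto simp: time_change_id)
      then show ?case using e(2) by blast
    qed
    then show ?thesis unfolding eventually_nhds by blast
  qed
  note nbhd = this
  have "open {l. ?\<Phi> l \<in> V}"
  proof (subst open_subopen, intro ballI)
    fix p assume "p \<in> {l. ?\<Phi> l \<in> V}"
    then obtain W where W: "open W" "p \<in> W" "\<forall>q\<in>W. ?\<Phi> q \<in> V" using nbhd[of p] by auto
    show "\<exists>T. open T \<and> p \<in> T \<and> T \<subseteq> {l. ?\<Phi> l \<in> V}"
      using W by (intro exI[of _ W] conjI subsetI CollectI) simp_all
  qed
  then show "{l \<in> space seq_space. ?\<Phi> l \<in> V} \<in> sets (seq_space :: (nat \<Rightarrow> real \<times> real) measure)"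
    by (simp add: sets_PiM_equal_borel)
qed

context affine_hawkes
begin

text \<open>Moves the recursion from the first step to the last, the form in which the given schemes
  are defined.\<close>

lemma uniform_scheme_Suc:
  "uniform_scheme h (Suc k) s u z = flow h (if u k < fst (uniform_scheme h k s u z) * h then
     jump (z k) (uniform_scheme h k s u z) else uniform_scheme h k s u z)"
proof (induction k arbitrary: s u z)
  case (Suc k)
  let ?s = "flow h (if u 0 < fst s * h then jump (z 0) s else s)"
  let ?u = "\<lambda>i. u (Suc i)" and ?z = "\<lambda>i. z (Suc i)"
  have step: "uniform_scheme h (Suc j) s u z = uniform_scheme h j ?s ?u ?z" for j
    by (simp only: uniform_scheme.simps)
  have "uniform_scheme h (Suc (Suc k)) s u z = uniform_scheme h (Suc k) ?s ?u ?z" by (rule step)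
  also note Suc.IH
  also note step[of k, symmetric]
  finally show ?case .
qed simp

text \<open>The noise enters only through its law: it is transported to the product of iid
  sequences, its index is shifted, and \<open>uniform_clock_scheme_integral\<close> compares
  cylinders.\<close>

lemma scheme_law:
  assumes noise: "scheme_noise N U Z \<nu>" and h: "0 < h"
  shows "distr N seq_space (\<lambda>\<omega> k. uniform_scheme h k (x, 0) (\<lambda>i. U (Suc i) \<omega>) (\<lambda>i. Z (Suc i) \<omega>))
    = distr (iid (std_exponential \<Otimes>\<^sub>M \<nu>)) seq_space (\<lambda>Y k. clock_scheme h k (x, 0) Y)"
    and scheme_measurable: "(\<lambda>\<omega> k. uniform_scheme h k (x, 0) (\<lambda>i. U (Suc i) \<omega>) (\<lambda>i. Z (Suc i) \<omega>)) \<in> N \<rightarrow>\<^sub>M seq_space"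
proof -
  interpret N: scheme_noise N U Z \<nu> by fact
  note \<nu> = N.scheme_marks
  interpret \<nu>: prob_space \<nu> by (rule \<nu>)
  let ?Z = "iid \<nu>" and ?U = "iid std_uniform"
  let ?Y = "iid (std_exponential \<Otimes>\<^sub>M \<nu>)"
  interpret Z: prob_space ?Z by (rule prob_space_PiM) (rule \<nu>)
  have sZ: "sets ?Z = sets seq_space" by (rule sets_seq_space_cong[OF \<nu>(2)])
  have sU: "sets ?U = sets seq_space" by (rule sets_seq_space_cong) simp
  have sY: "sets ?Y = sets seq_space"
    unfolding borel_prod[symmetric]
    by (intro sets_PiM_cong sets_pair_measure_cong) (simp_all add: \<nu>(2))
  note [measurable_cong] = sZ sU
  have rv: "U k \<in> borel_measurable N" "Z k \<in> borel_measurable N" for k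
    using N.U_indep N.Z_indep by (auto simp: N.indep_vars_def)
  have Um: "(\<lambda>\<omega> k. U k \<omega>) \<in> N \<rightarrow>\<^sub>M seq_space" "(\<lambda>\<omega> k. Z k \<omega>) \<in> N \<rightarrow>\<^sub>M seq_space"
    by (auto intro!: measurable_PiM_single' rv)
  show Xm: "(\<lambda>\<omega> k. uniform_scheme h k (x, 0) (\<lambda>i. U (Suc i) \<omega>) (\<lambda>i. Z (Suc i) \<omega>)) \<in> N \<rightarrow>\<^sub>M seq_space"
    using measurable_seq_shift[OF Um(1)] measurable_seq_shift[OF Um(2)]
    by (intro measurable_PiM_single' measurable_uniform_scheme) auto
  show "distr N seq_space (\<lambda>\<omega> k. uniform_scheme h k (x, 0) (\<lambda>i. U (Suc i) \<omega>) (\<lambda>i. Z (Suc i) \<omega>))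
    = distr ?Y seq_space (\<lambda>Y k. clock_scheme h k (x, 0) Y)"
  proof (rule law_eqI[OF N.prob_space_axioms Xm])
    show "(\<lambda>Y k. clock_scheme h k (x, 0) Y) \<in> ?Y \<rightarrow>\<^sub>M seq_space"
      by (intro measurable_PiM_single' measurable_clock_scheme measurable_ident_sets[OF sY]) auto
    fix n and C :: "nat \<Rightarrow> (real \<times> real) set" assume C: "\<And>i. C i \<in> sets borel"
    define g where "g u z = (\<Prod>i<n. indicator (C i) (uniform_scheme h i (x, 0) u z) :: ennreal)" for u z
    have gm: "(\<lambda>p. g (\<lambda>i. fst p (Suc i)) (\<lambda>i. snd p (Suc i))) \<in> borel_measurable (seq_space \<Otimes>\<^sub>M seq_space)"
      by (intro measurable_uniform_cylinder[of C, OF C, where n = n and h = h and f = "\<lambda>_. (x, 0)", folded g_def] measurable_seq_shift) simp_all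
    have gm': "(\<lambda>p. g (\<lambda>i. fst p (Suc i)) (snd p)) \<in> borel_measurable (?U \<Otimes>\<^sub>M ?Z)"
      by (intro measurable_uniform_cylinder[of C, OF C, where n = n and h = h and f = "\<lambda>_. (x, 0)", folded g_def] measurable_seq_shift) measurable
    have gm'': "(\<lambda>p. g (fst p) (snd p)) \<in> borel_measurable (?U \<Otimes>\<^sub>M ?Z)"
      by (intro measurable_uniform_cylinder[of C, OF C, where n = n and h = h and f = "\<lambda>_. (x, 0)", folded g_def]) measurable
    have "(\<integral>\<^sup>+\<omega>. g (\<lambda>i. U (Suc i) \<omega>) (\<lambda>i. Z (Suc i) \<omega>) \<partial>N)
       = (\<integral>\<^sup>+p. g (\<lambda>i. fst p (Suc i)) (\<lambda>i. snd p (Suc i)) \<partial>distr N (seq_space \<Otimes>\<^sub>M seq_space) (\<lambda>\<omega>. (\<lambda>k. U k \<omega>, \<lambda>k. Z k \<omega>)))"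
      using gm by (subst nn_integral_distr) (auto intro!: measurable_Pair Um)
    also have "\<dots> = (\<integral>\<^sup>+u. \<integral>\<^sup>+z. g (\<lambda>i. u (Suc i)) (\<lambda>i. z (Suc i)) \<partial>?Z \<partial>?U)"
      unfolding N.noise_law using gm
      by (subst Z.nn_integral_fst[symmetric]) (simp_all add: measurable_cong_sets[OF sets_pair_measure_cong[OF sU sZ] refl])
    also have "\<dots> = (\<integral>\<^sup>+u. \<integral>\<^sup>+z. g (\<lambda>i. u (Suc i)) z \<partial>?Z \<partial>?U)"
    proof (rule nn_integral_cong)
      fix u assume "u \<in> space ?U"
      then have "(\<lambda>z. g (\<lambda>i. u (Suc i)) z) \<in> borel_measurable ?Z" using measurable_compose[OF measurable_Pair1' gm'] by simp
      then show "(\<integral>\<^sup>+z. g (\<lambda>i. u (Suc i)) (\<lambda>i. z (Suc i)) \<partial>?Z) = (\<integral>\<^sup>+z. g (\<lambda>i. u (Suc i)) z \<partial>?Z)"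
        by (rule nn_integral_iid_shift[OF \<nu>(1)])
    qed
    also have "\<dots> = (\<integral>\<^sup>+u. \<integral>\<^sup>+z. g u z \<partial>?Z \<partial>?U)"
      using gm'' by (intro nn_integral_iid_shift[OF prob_space_std_uniform] Z.borel_measurable_nn_integral) (simp add: case_prod_beta)
    also have "\<dots> = (\<integral>\<^sup>+Y. (\<Prod>i<n. indicator (C i) (clock_scheme h i (x, 0) Y)) \<partial>?Y)"
      unfolding g_def using x by (intro uniform_clock_scheme_integral \<nu> h C) simp
    finally show "(\<integral>\<^sup>+\<omega>. (\<Prod>i<n. indicator (C i) (uniform_scheme h i (x, 0) (\<lambda>i. U (Suc i) \<omega>) (\<lambda>i. Z (Suc i) \<omega>))) \<partial>N)
       = (\<integral>\<^sup>+Y. (\<Prod>i<n. indicator (C i) (clock_scheme h i (x, 0) Y)) \<partial>?Y)" unfolding g_def .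
  qed
qed

end

context affine_hawkes_process
begin

lemma measurable_hawkes_path:
  "(\<lambda>\<omega>. hawkes_path (jumps \<omega>) (pos_marks \<omega>)) \<in> M \<rightarrow>\<^sub>M borel_of_topology (skorokhod_topology quadrant)"
proof (rule measurable_borel_of_topologyI)
  show "hawkes_path (jumps \<omega>) (pos_marks \<omega>) \<in> topspace (skorokhod_topology quadrant)" if "\<omega> \<in> space M" for \<omega>
    using hawkes_path_cadlag[OF jump_sequence_jumps[OF that]] by simp
  fix V assume "openin (skorokhod_topology quadrant) V"
  then obtain W :: "((nat \<Rightarrow> real) \<times> (nat \<Rightarrow> real)) set" where W: "open W"
    "\<forall>\<theta> z. jump_sequence \<theta> z \<longrightarrow> (hawkes_path \<theta> z \<in> V \<longleftrightarrow> (\<theta>, z) \<in> W)"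
    using openin_hawkes_path by blast
  have "jumps \<in> M \<rightarrow>\<^sub>M seq_space" "pos_marks \<in> M \<rightarrow>\<^sub>M seq_space"
    unfolding jumps_def[abs_def] pos_marks_def[abs_def] by (intro measurable_PiM_single'; measurable)+
  then have "jumps \<in> borel_measurable M" "pos_marks \<in> borel_measurable M"
    by (simp_all add: measurable_cong_sets[OF refl sets_PiM_equal_borel])
  then have "(\<lambda>\<omega>. (jumps \<omega>, pos_marks \<omega>)) \<in> borel_measurable M" by (rule borel_measurable_Pair)
  from measurable_sets[OF this, of W] W(1) have "{\<omega> \<in> space M. (jumps \<omega>, pos_marks \<omega>) \<in> W} \<in> sets M"
    by (simp add: vimage_def Int_def conj_commute)
  also have "{\<omega> \<in> space M. (jumps \<omega>, pos_marks \<omega>) \<in> W} = {\<omega> \<in> space M. hawkes_path (jumps \<omega>) (pos_marks \<omega>) \<in> V}"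
    using W(2) jump_sequence_jumps by blast
  finally show "{\<omega> \<in> space M. hawkes_path (jumps \<omega>) (pos_marks \<omega>) \<in> V} \<in> sets M" .
qed

lemma uniform_scheme_converges_in_law:
  assumes noise: "\<And>n. scheme_noise (Ms n) (U n) (Z n) \<nu>" and h: "\<And>n. 0 < h n" "h \<longlonglongrightarrow> 0"
  shows "converges_in_law (skorokhod_topology quadrant) Ms
    (\<lambda>n \<omega>. step_path (h n) (\<lambda>k. uniform_scheme (h n) k (x, 0) (\<lambda>i. U n (Suc i) \<omega>) (\<lambda>i. Z n (Suc i) \<omega>)))
    M (\<lambda>\<omega>. hawkes_path (jumps \<omega>) (pos_marks \<omega>))"
proof -
  let ?T = "skorokhod_topology quadrant"
  define X where "X n \<omega> k = uniform_scheme (h n) k (x, 0) (\<lambda>i. U n (Suc i) \<omega>) (\<lambda>i. Z n (Suc i) \<omega>)" for n \<omega> k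
  define \<Phi> where "\<Phi> n l = step_path (h n) (\<lambda>k. clip (l k))" for n and l :: "nat \<Rightarrow> real \<times> real"
  define Y where "Y \<omega> i = (clocks i \<omega>, \<zeta> i \<omega>)" for \<omega> i
  \<comment> \<open>The coupling: every \<open>X' n\<close> is driven by the same clocks and marks
    on the Hawkes space, and it is tied to \<open>X n\<close> through its law alone.\<close>
  define X' where "X' n \<omega> k = clock_scheme (h n) k (x, 0) (Y \<omega>)" for n \<omega> k
  have \<Phi>m: "\<Phi> n \<in> seq_space \<rightarrow>\<^sub>M borel_of_topology ?T" for n
    unfolding \<Phi>_def[abs_def] by (rule measurable_step_path[OF h(1)])
  have Xm: "X n \<in> Ms n \<rightarrow>\<^sub>M seq_space" for n
    unfolding X_def[abs_def] by (rule scheme_measurable[OF noise h(1)])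
  have Ym: "Y \<in> M \<rightarrow>\<^sub>M seq_space"
    unfolding Y_def[abs_def] by (intro measurable_PiM_single' borel_measurable_Pair measurable_clocks measurable_mark) simp
  have clockm: "(\<lambda>Y k. clock_scheme (h n) k (x, 0) Y) \<in> seq_space \<rightarrow>\<^sub>M seq_space" for n
    by (intro measurable_PiM_single' measurable_clock_scheme) auto
  have X'm: "X' n \<in> M \<rightarrow>\<^sub>M seq_space" for n
    unfolding X'_def[abs_def] using measurable_compose[OF Ym clockm] .
  have clip_id: "clip s = s" if "s \<in> quadrant" for s using that by (auto simp: clip_def)
  have clip_X: "clip (X n \<omega> k) = X n \<omega> k" for n \<omega> k
    unfolding X_def using h(1)[of n] x by (intro clip_id uniform_scheme_quadrant) auto
  have clip_X': "clip (X' n \<omega> k) = X' n \<omega> k" for n \<omega> k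
    unfolding X'_def using h(1)[of n] x by (intro clip_id clock_scheme_quadrant) auto
  have law: "distr (Ms n) seq_space (X n) = distr M seq_space (X' n)" for n
  proof -
    have "distr (Ms n) seq_space (X n) = distr (distr M seq_space Y) seq_space (\<lambda>Y k. clock_scheme (h n) k (x, 0) Y)"
      unfolding X_def[abs_def] Y_def[abs_def] clocks_iid by (rule scheme_law[OF noise h(1)])
    also have "\<dots> = distr M seq_space (X' n)"
      using distr_distr[OF clockm Ym, of n] by (simp add: X'_def[abs_def] comp_def)
    finally show ?thesis .
  qed
  define \<mu>s where "\<mu>s n = distr (Ms n) (borel_of_topology ?T) (\<lambda>\<omega>. \<Phi> n (X n \<omega>))" for n
  define H where "H \<omega> = hawkes_path (jumps \<omega>) (pos_marks \<omega>)" for \<omega>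
  define \<mu> where "\<mu> = distr M (borel_of_topology ?T) H"
  have Hm: "H \<in> M \<rightarrow>\<^sub>M borel_of_topology ?T" unfolding H_def[abs_def] by (rule measurable_hawkes_path)
  have "has_law ?T (Ms n) (\<lambda>\<omega>. step_path (h n) (X n \<omega>)) (\<mu>s n)" for n
    unfolding has_law_def \<mu>s_def
    by (intro bexI[of _ "\<lambda>\<omega>. \<Phi> n (X n \<omega>)"] conjI measurable_compose[OF Xm \<Phi>m]) (simp_all add: \<Phi>_def clip_X)
  moreover have "has_law ?T M H \<mu>" unfolding has_law_def \<mu>_def using Hm by (intro bexI[of _ H]) auto
  moreover have "converges_weakly ?T \<mu>s \<mu>" unfolding converges_weakly_def
  proof (intro allI impI)
    fix f assume f: "continuous_map ?T euclideanreal f \<and> bounded (f ` topspace ?T)"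
    have fm: "f \<in> borel_measurable (borel_of_topology ?T)" using f continuous_map_borel_measurable by blast
    obtain B where B: "\<And>p. p \<in> cadlag_paths quadrant \<Longrightarrow> \<bar>f p\<bar> \<le> B" using f by (auto simp: bounded_iff)
    have "(\<integral>p. f p \<partial>\<mu>s n) = (\<integral>\<omega>. f (\<Phi> n (X' n \<omega>)) \<partial>M)" for n
    proof -
      have "(\<integral>p. f p \<partial>\<mu>s n) = (\<integral>\<omega>. f (\<Phi> n (X n \<omega>)) \<partial>Ms n)"
        unfolding \<mu>s_def by (rule integral_distr[OF measurable_compose[OF Xm \<Phi>m] fm])
      also have "\<dots> = (\<integral>l. f (\<Phi> n l) \<partial>distr (Ms n) seq_space (X n))"
        by (rule integral_distr[OF Xm measurable_compose[OF \<Phi>m fm], symmetric])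
      also have "\<dots> = (\<integral>\<omega>. f (\<Phi> n (X' n \<omega>)) \<partial>M)"
        unfolding law by (rule integral_distr[OF X'm measurable_compose[OF \<Phi>m fm]])
      finally show ?thesis .
    qed
    moreover have "(\<integral>p. f p \<partial>\<mu>) = (\<integral>\<omega>. f (H \<omega>) \<partial>M)" unfolding \<mu>_def by (rule integral_distr[OF Hm fm])
    moreover have "(\<lambda>n. \<integral>\<omega>. f (\<Phi> n (X' n \<omega>)) \<partial>M) \<longlonglongrightarrow> (\<integral>\<omega>. f (H \<omega>) \<partial>M)"
    proof (rule integral_dominated_convergence[where w = "\<lambda>_. B"])
      show "(\<lambda>\<omega>. f (H \<omega>)) \<in> borel_measurable M" by (rule measurable_compose[OF Hm fm])
      show "(\<lambda>\<omega>. f (\<Phi> n (X' n \<omega>))) \<in> borel_measurable M" for n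
        by (rule measurable_compose[OF measurable_compose[OF X'm \<Phi>m] fm])
      show "AE \<omega> in M. (\<lambda>n. f (\<Phi> n (X' n \<omega>))) \<longlonglongrightarrow> f (H \<omega>)"
        using AE_marks_pos AE_space
      proof eventually_elim
        case (elim \<omega>)
        \<comment> \<open>Where all marks are positive, truncation changes nothing and Y is the
          input of \<open>clock_scheme_path_converges\<close>.\<close>
        have "Y \<omega> = (\<lambda>n. (clock (jumps \<omega>) (pos_marks \<omega>) n, pos_marks \<omega> n))"
          using elim(1) by (simp add: Y_def fun_eq_iff clocks_def pos_marks_def less_imp_le)
        then have "limitin ?T (\<lambda>n. \<Phi> n (X' n \<omega>)) (H \<omega>) sequentially"
          using clock_scheme_path_converges[OF h jump_sequence_jumps[OF elim(2)]]
          by (simp add: \<Phi>_def clip_X' H_def) (simp add: X'_def[abs_def])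
        then have "limitin euclideanreal (f \<circ> (\<lambda>n. \<Phi> n (X' n \<omega>))) (f (H \<omega>)) sequentially"
          using f by (intro continuous_map_limit) auto
        then show ?case by (simp add: comp_def)
      qed
      show "AE \<omega> in M. norm (f (\<Phi> n (X' n \<omega>))) \<le> B" for n
      proof (rule AE_I2)
        fix \<omega> assume \<omega>: "\<omega> \<in> space M"
        have "\<Phi> n (X' n \<omega>) \<in> cadlag_paths quadrant"
          using measurable_space[OF measurable_compose[OF X'm \<Phi>m] \<omega>, of n] by simp
        then show "norm (f (\<Phi> n (X' n \<omega>))) \<le> B" using B by simp
      qed
    qed simp
    ultimately show "(\<lambda>n. \<integral>p. f p \<partial>\<mu>s n) \<longlonglongrightarrow> (\<integral>p. f p \<partial>\<mu>)" by simp
  qed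
  ultimately show ?thesis unfolding converges_in_law_def X_def H_def[abs_def] by blast
qed

end

section \<open>The given schemes and intensities as special cases\<close>

lemma (in scheme_noise) AE_marks:
  assumes "AE z in \<nu>. 0 < z"
  shows "AE \<omega> in M. \<forall>k. 0 < Z k \<omega>"
  unfolding AE_all_countable
proof
  fix k
  have [measurable]: "Z k \<in> borel_measurable M" using Z_indep by (auto simp: indep_vars_def)
  have "AE z in distr M borel (Z k). 0 < z" unfolding Z_distr by (rule assms)
  then show "AE \<omega> in M. 0 < Z k \<omega>" by (subst (asm) AE_distr_iff) auto
qed

text \<open>With c1 = 0, the flow after the jump adds h times the decayed auxiliary value, which is
  the term a_{k+1} h of the scheme. For nonnegative marks the truncation in \<open>jump\<close> is
  invisible.\<close>

lemma erlang_scheme_eq_uniform_scheme: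
  assumes A: "affine_hawkes 0 \<alpha> \<beta> lam_inf x" and z: "\<And>k. 0 \<le> z k"
  shows "erlang_scheme \<alpha> \<beta> lam_inf x h u z k
    = affine_hawkes.uniform_scheme 0 \<alpha> \<beta> lam_inf h k (x, 0) (\<lambda>i. u (Suc i)) (\<lambda>i. z (Suc i))"
proof (induction k)
  case 0
  then show ?case by (simp add: affine_hawkes.uniform_scheme.simps[OF A])
next
  case (Suc k)
  show ?case
    unfolding affine_hawkes.uniform_scheme_Suc[OF A] Suc.IH[symmetric]
    using z[of "Suc k"]
    by (auto simp: affine_hawkes.flow_def[OF A] affine_hawkes.jump_def[OF A] Let_def case_prod_beta of_bool_def algebra_simps)
qed

text \<open>With c2 = 0 the second coordinate starts at 0 and stays there, so the pair carries the
  scalar scheme.\<close>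

lemma exp_scheme_eq_uniform_scheme:
  assumes A: "affine_hawkes \<alpha> 0 \<beta> lam_inf x" and z: "\<And>k. 0 \<le> z k"
  shows "affine_hawkes.uniform_scheme \<alpha> 0 \<beta> lam_inf h k (x, 0) (\<lambda>i. u (Suc i)) (\<lambda>i. z (Suc i))
    = (exp_scheme \<alpha> \<beta> lam_inf x h u z k, 0)"
proof (induction k)
  case 0
  then show ?case by (simp add: affine_hawkes.uniform_scheme.simps[OF A])
next
  case (Suc k)
  show ?case
    unfolding affine_hawkes.uniform_scheme_Suc[OF A] Suc.IH
    using z[of "Suc k"]
    by (auto simp: affine_hawkes.flow_def[OF A] affine_hawkes.jump_def[OF A] Let_def of_bool_def algebra_simps)
qed

lemma (in affine_hawkes_process) hawkes_path_jumps:
  assumes \<omega>: "\<omega> \<in> space M" "\<forall>i. 0 < \<zeta> i \<omega>"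
  shows "hawkes_path (jumps \<omega>) (pos_marks \<omega>)
    = restrict (\<lambda>t. (lam t \<omega>, loss_integral \<theta> \<zeta> (\<lambda>s. c2 * exp (- \<beta> * (t - s))) t \<omega>)) {0..}"
  unfolding hawkes_path_def
proof (rule restrict_ext)
  fix t :: real assume t: "t \<in> {0..}"
  have js: "strict_mono (jumps \<omega>)" "finite {i. jumps \<omega> i \<le> t}"
    using jump_sequence_jumps[OF \<omega>(1)] by (auto simp: jump_sequence_def)
  obtain n where "t < jumps \<omega> n" by (rule jump_sequence_unbounded[OF js(2)])
  then obtain j where j: "prev_jump (jumps \<omega>) j \<le> t" "t < jumps \<omega> j"
    using ex_piece[of "prev_jump (jumps \<omega>)" t n] t by auto
  have count: "{i. jumps \<omega> i \<le> t} = {..<j}" by (rule jump_count[OF js(1) j])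
  then have count': "{i. \<theta> i \<omega> \<le> t} = {..<j}" by (simp add: jumps_def)
  have "pos_marks \<omega> = (\<lambda>i. \<zeta> i \<omega>)" using \<omega>(2) by (auto simp: pos_marks_def fun_eq_iff less_imp_le)
  then show "state (jumps \<omega>) (pos_marks \<omega>) (card {i. jumps \<omega> i \<le> t}) t
    = (lam t \<omega>, loss_integral \<theta> \<zeta> (\<lambda>s. c2 * exp (- \<beta> * (t - s))) t \<omega>)"
    unfolding count by (intro prod_eqI) (simp_all add: fst_state snd_state lam_eq loss_integral_def count' jumps_def)
qed

lemma sample_path_interpolation:
  assumes "0 < T" and "\<And>t. X t \<omega> = l (nat \<lfloor>real (Suc n) * t / T\<rfloor>)"
  shows "sample_path X \<omega> = step_path (T / real (Suc n)) l"
  unfolding sample_path_def step_path_def assms(2) using assms(1) by (simp add: mult.commute)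

theorem theorem1p6:
  fixes \<nu> :: "real measure" and \<alpha> \<beta> lam_inf x T :: real
    and M :: "nat \<Rightarrow> 'a measure" and U Z :: "nat \<Rightarrow> nat \<Rightarrow> 'a \<Rightarrow> real"
    and M\<^sub>1 :: "'b measure" and F\<^sub>1 :: "real \<Rightarrow> 'b measure" and \<theta>\<^sub>1 \<zeta>\<^sub>1 :: "nat \<Rightarrow> 'b \<Rightarrow> real"
    and M\<^sub>2 :: "'c measure" and F\<^sub>2 :: "real \<Rightarrow> 'c measure" and \<theta>\<^sub>2 \<zeta>\<^sub>2 :: "nat \<Rightarrow> 'c \<Rightarrow> real"
  assumes "prob_space \<nu>" and "sets \<nu> = sets borel"
    and "AE z in \<nu>. 0 < z" and "integrable \<nu> (\<lambda>z. z)"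
    and "0 < \<alpha>" and "0 < \<beta>" and "0 < lam_inf" and "0 < x" and "0 < T"
    and "\<And>N. 1 \<le> N \<Longrightarrow> scheme_noise (M N) (U N) (Z N) \<nu>"
  shows
    "(\<alpha> * (\<integral>z. z \<partial>\<nu>) < \<beta> \<and>
      compound_hawkes M\<^sub>1 F\<^sub>1 \<theta>\<^sub>1 \<zeta>\<^sub>1 \<nu> (hawkes_intensity (exp_kernel \<alpha> \<beta>) \<beta> lam_inf x \<theta>\<^sub>1 \<zeta>\<^sub>1)
      \<longrightarrow> converges_in_law (skorokhod_topology {0..})
            (\<lambda>n. M (Suc n))
            (\<lambda>n. sample_path (exp_interpolation \<alpha> \<beta> lam_inf x T (Suc n) (U (Suc n)) (Z (Suc n))))
            M\<^sub>1
            (sample_path (hawkes_intensity (exp_kernel \<alpha> \<beta>) \<beta> lam_inf x \<theta>\<^sub>1 \<zeta>\<^sub>1)))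
     \<and>
     (\<alpha> * (\<integral>z. z \<partial>\<nu>) < \<beta>\<^sup>2 \<and>
      compound_hawkes M\<^sub>2 F\<^sub>2 \<theta>\<^sub>2 \<zeta>\<^sub>2 \<nu> (hawkes_intensity (erlang_kernel \<alpha> \<beta>) \<beta> lam_inf x \<theta>\<^sub>2 \<zeta>\<^sub>2)
      \<longrightarrow> converges_in_law (skorokhod_topology ({0..} \<times> {0..}))
            (\<lambda>n. M (Suc n))
            (\<lambda>n. sample_path (erlang_interpolation \<alpha> \<beta> lam_inf x T (Suc n) (U (Suc n)) (Z (Suc n))))
            M\<^sub>2
            (sample_path (\<lambda>t \<omega>. (hawkes_intensity (erlang_kernel \<alpha> \<beta>) \<beta> lam_inf x \<theta>\<^sub>2 \<zeta>\<^sub>2 t \<omega>,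
                          erlang_auxiliary \<alpha> \<beta> \<theta>\<^sub>2 \<zeta>\<^sub>2 t \<omega>))))"
proof -
  \<comment> \<open>Index n stands for N = n + 1.\<close>
  let ?h = "\<lambda>n. T / real (Suc n)"
  have h: "0 < ?h n" for n using assms(9) by simp
  have h0: "?h \<longlonglongrightarrow> 0" using LIMSEQ_Suc[OF lim_const_over_n[of T]] by simp
  have noise: "scheme_noise (M (Suc n)) (U (Suc n)) (Z (Suc n)) \<nu>" for n using assms(10) by simp
  have Zpos: "AE \<omega> in M (Suc n). \<forall>k. 0 < Z (Suc n) k \<omega>" for n
    using scheme_noise.AE_marks[OF noise assms(3)] .
  show ?thesis
  proof (intro conjI impI, goal_cases)
    case 1
    have A: "affine_hawkes \<alpha> 0 \<beta> lam_inf x" using assms by unfold_locales auto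
    interpret affine_hawkes_process \<alpha> 0 \<beta> lam_inf x M\<^sub>1 F\<^sub>1 \<theta>\<^sub>1 \<zeta>\<^sub>1 \<nu> "hawkes_intensity (exp_kernel \<alpha> \<beta>) \<beta> lam_inf x \<theta>\<^sub>1 \<zeta>\<^sub>1"
      using A 1 assms(3)
      by (intro affine_hawkes_process.intro affine_hawkes_process_axioms.intro)
        (auto simp: hawkes_intensity_def exp_kernel_def)
    let ?g = "\<lambda>p :: real \<Rightarrow> real \<times> real. restrict (\<lambda>t. fst (p t)) {0..}"
    show ?case
    proof (rule converges_in_law_continuous_map[OF uniform_scheme_converges_in_law[OF noise h h0] continuous_map_skorokhod_fst])
      fix n
      show "AE \<omega> in M (Suc n). sample_path (exp_interpolation \<alpha> \<beta> lam_inf x T (Suc n) (U (Suc n)) (Z (Suc n))) \<omega> =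
        ?g (step_path (?h n) (\<lambda>k. uniform_scheme (?h n) k (x, 0) (\<lambda>i. U (Suc n) (Suc i) \<omega>) (\<lambda>i. Z (Suc n) (Suc i) \<omega>)))"
        using Zpos
      proof eventually_elim
        case (elim \<omega>)
        have "sample_path (exp_interpolation \<alpha> \<beta> lam_inf x T (Suc n) (U (Suc n)) (Z (Suc n))) \<omega>
          = step_path (?h n) (exp_scheme \<alpha> \<beta> lam_inf x (?h n) (\<lambda>k. U (Suc n) k \<omega>) (\<lambda>k. Z (Suc n) k \<omega>))"
          by (rule sample_path_interpolation[OF assms(9)]) (simp add: exp_interpolation_def)
        then show ?case
          using exp_scheme_eq_uniform_scheme[OF A, of "\<lambda>k. Z (Suc n) k \<omega>" "?h n" _ "\<lambda>k. U (Suc n) k \<omega>"] elim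
          by (auto simp: step_path_def less_imp_le fun_eq_iff)
      qed
    next
      show "AE \<omega> in M\<^sub>1. sample_path (hawkes_intensity (exp_kernel \<alpha> \<beta>) \<beta> lam_inf x \<theta>\<^sub>1 \<zeta>\<^sub>1) \<omega> = ?g (hawkes_path (jumps \<omega>) (pos_marks \<omega>))"
        using AE_marks_pos AE_space
        by eventually_elim (auto simp: hawkes_path_jumps sample_path_def fun_eq_iff)
    qed
  next
    case 2
    have A: "affine_hawkes 0 \<alpha> \<beta> lam_inf x" using assms by unfold_locales auto
    interpret affine_hawkes_process 0 \<alpha> \<beta> lam_inf x M\<^sub>2 F\<^sub>2 \<theta>\<^sub>2 \<zeta>\<^sub>2 \<nu> "hawkes_intensity (erlang_kernel \<alpha> \<beta>) \<beta> lam_inf x \<theta>\<^sub>2 \<zeta>\<^sub>2"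
      using A 2 assms(3)
      by (intro affine_hawkes_process.intro affine_hawkes_process_axioms.intro)
        (auto simp: hawkes_intensity_def erlang_kernel_def)
    show ?case
    \<comment> \<open>The identity map passes between almost surely equal processes.\<close>
    proof (rule converges_in_law_continuous_map[OF uniform_scheme_converges_in_law[OF noise h h0] continuous_map_id])
      fix n
      show "AE \<omega> in M (Suc n). sample_path (erlang_interpolation \<alpha> \<beta> lam_inf x T (Suc n) (U (Suc n)) (Z (Suc n))) \<omega> =
        id (step_path (?h n) (\<lambda>k. uniform_scheme (?h n) k (x, 0) (\<lambda>i. U (Suc n) (Suc i) \<omega>) (\<lambda>i. Z (Suc n) (Suc i) \<omega>)))"
        using Zpos
      proof eventually_elim
        case (elim \<omega>)
        have "sample_path (erlang_interpolation \<alpha> \<beta> lam_inf x T (Suc n) (U (Suc n)) (Z (Suc n))) \<omega>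
          = step_path (?h n) (erlang_scheme \<alpha> \<beta> lam_inf x (?h n) (\<lambda>k. U (Suc n) k \<omega>) (\<lambda>k. Z (Suc n) k \<omega>))"
          by (rule sample_path_interpolation[OF assms(9)]) (simp add: erlang_interpolation_def)
        then show ?case
          using erlang_scheme_eq_uniform_scheme[OF A, of "\<lambda>k. Z (Suc n) k \<omega>" "?h n" "\<lambda>k. U (Suc n) k \<omega>"] elim
          by (auto simp: step_path_def less_imp_le fun_eq_iff)
      qed
    next
      show "AE \<omega> in M\<^sub>2. sample_path (\<lambda>t \<omega>. (hawkes_intensity (erlang_kernel \<alpha> \<beta>) \<beta> lam_inf x \<theta>\<^sub>2 \<zeta>\<^sub>2 t \<omega>,
          erlang_auxiliary \<alpha> \<beta> \<theta>\<^sub>2 \<zeta>\<^sub>2 t \<omega>)) \<omega> = id (hawkes_path (jumps \<omega>) (pos_marks \<omega>))"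
        using AE_marks_pos AE_space
        by eventually_elim (simp add: hawkes_path_jumps sample_path_def erlang_auxiliary_def)
    qed
  qed
qed

end
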